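(* Let $n\ge 1$, let $\sigma_0,\mu\in\mathcal{W}_{2,ac}(\mathbb{R}^n)$, and fix $1\le j\le n$. Assume: (A1) There is a set $K\subseteq \mathcal{W}_{2,ac}(\mathbb{R}^n)$, compact with respect to $W_2$, such that (i) for every choice of step sizes $\gamma_k\in[0,1]$ and matrices $P_k\in O(n)$ $(k\ge 0)$, the sequence $\{\sigma_k\}_{k\ge 1}$ produced from $\sigma_0$ by the $j$-slice matching scheme $$\sigma_{k+1}=\bigl((1-\gamma_k)\,\mathrm{id}+\gamma_k T^j_{\sigma_k,P_k}\bigr)_\sharp\sigma_k,\qquad k\ge 0,$$ stays in $K$; (ii) if $\eta\in K$ and $H_j'(\eta)=0$ $\eta$-a.e., then $\eta=\mu$. (A2) $(\gamma_k)_{k\ge 0}\subset[0,1]$ is a sequence with $\sum_{k=0}^\infty\gamma_k=\infty$ and $\sum_{k=0}^\infty\gamma_k^2<\infty$. Let $P_k$, $k\ge 0$, be i.i.d. random matrices distributed according to the Haar probability measure $u_n$ on the orthogonal group $O(n)$, and let $(\sigma_k)_{k\ge0}$ be the (random) sequence generated from $\sigma_0$ by the $j$-slice matching scheme above with these $P_k$ and the step sizes $\gamma_k$ of (A2). Then, almost surely, $$W_2(\sigma_k,\mu)\to 0\quad\text{as } k\to\infty .$$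
   Context: $\mathcal{W}_2(\mathbb{R}^n)$ is the space of Borel probability measures on $\mathbb{R}^n$ with finite second moment, equipped with the quadratic Wasserstein distance $W_2$; $\mathcal{W}_{2,ac}(\mathbb{R}^n)$ is the subset of those absolutely continuous with respect to Lebesgue measure. For $\theta\in S^{n-1}$ and a probability measure $\sigma$ on $\mathbb{R}^n$, $\sigma^\theta$ denotes the pushforward of $\sigma$ under $x\mapsto x\cdot\theta$ (a probability measure on $\mathbb{R}$). $j$-slice matching map (the target $\mu$ is fixed): for $\sigma\in\mathcal{W}_{2,ac}(\mathbb{R}^n)$ and $P=[\theta_1,\dots,\theta_n]\in O(n)$ (columns $\theta_i$), $$T^j_{\sigma,P}(x)=\sum_{i=1}^j T^{\theta_i}(x\cdot\theta_i)\,\theta_i+\sum_{i=j+1}^n (x\cdot\theta_i)\,\theta_i ,$$ where $T^{\theta}=F_{\mu^{\theta}}^{-1}\circ F_{\sigma^{\theta}}$ is the one-dimensional optimal transport map from $\sigma^{\theta}$ to $\mu^{\theta}$; here $F_\nu(x)=\nu((-\infty,x])$ is the CDF and $F_\nu^{-1}(y)=\min\{z:F_\nu(z)\ge y\}$. For $\eta\in\mathcal{W}_{2,ac}(\mathbb{R}^n)$, the function $H_j'(\eta):\mathbb{R}^n\to\mathbb{R}^n$ (the formal Fréchet derivative of $H_j(\sigma)=\frac12\int_{O(n)}\sum_{i=1}^j W_2^2(\sigma^{\theta_i},\mu^{\theta_i})\,du_n(P)$, $P=[\theta_1,\dots,\theta_n]$) is defined by $$H_j'(\eta)(x)=\int_{O(n)}\bigl(x-T^j_{\eta,P}(x)\bigr)\,du_n(P).$$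 If $\sigma_0,\mu\in\mathcal{W}_{2,ac}(\mathbb{R}^n)$, then all iterates $\sigma_k$ are in $\mathcal{W}_{2,ac}(\mathbb{R}^n)$, so the scheme is well defined. *)

theory Defs
  imports "HOL-Probability.Probability"
begin

section \<open>Wasserstein space\<close>

definition couplings ::
    "'a::euclidean_space measure \<Rightarrow> 'a measure \<Rightarrow> ('a \<times> 'a) measure set" where
  "couplings \<mu> \<nu> = {\<pi>. sets \<pi> = sets borel \<and> distr \<pi> borel fst = \<mu> \<and> distr \<pi> borel snd = \<nu>}"

definition W2 :: "'a::euclidean_space measure \<Rightarrow> 'a measure \<Rightarrow> real" where
  "W2 \<mu> \<nu> = sqrt (enn2real (INF \<pi>\<in>couplings \<mu> \<nu>. \<integral>\<^sup>+ p. ennreal ((dist (fst p) (snd p))\<^sup>2) \<partial>\<pi>))"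

definition wasserstein2 :: "'a::euclidean_space measure set" where
  "wasserstein2 = {\<sigma>. prob_space \<sigma> \<and> sets \<sigma> = sets borel \<and> integrable \<sigma> (\<lambda>x. (norm x)\<^sup>2)}"

definition wasserstein2_ac :: "'a::euclidean_space measure set" where
  "wasserstein2_ac = {\<sigma> \<in> wasserstein2. absolutely_continuous lborel \<sigma>}"

text \<open>
  The library's metric topology for the carrier \<^const>\<open>wasserstein2\<close> and the distance \<^const>\<open>W2\<close>:
  a subset of the carrier is open iff it contains a \<^const>\<open>W2\<close>-ball around each of its points.
\<close>
abbreviation W2_topology :: "'a::euclidean_space measure topology" where
  "W2_topology \<equiv> Metric_space.mtopology wasserstein2 W2"


section \<open>Haar probability on the orthogonal group\<close>

definition orthogonal_group :: "(real^'n^'n) set" where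
  "orthogonal_group = {Q. orthogonal_matrix Q}"

text \<open>
  Left invariance together with total mass 1 determines the measure uniquely, and right invariance
  follows because the group is compact.
\<close>
definition haar_prob_orthogonal :: "(real^'n^'n) measure \<Rightarrow> bool" where
  "haar_prob_orthogonal u \<longleftrightarrow>
     prob_space u \<and> sets u = sets (restrict_space borel orthogonal_group) \<and>
     (\<forall>Q\<in>orthogonal_group. distr u u (\<lambda>P. Q ** P) = u)"


section \<open>Slice matching\<close>

definition slice :: "(real^'n) measure \<Rightarrow> real^'n \<Rightarrow> real measure" where
  "slice \<sigma> \<theta> = distr \<sigma> borel (\<lambda>x. x \<bullet> \<theta>)"

text \<open>
  For a probability measure the minimum exists if \<open>0 < y < 1\<close>. Where it does not exist the
  value is unspecified; along the slices of an absolutely continuous measure \<open>\<sigma>\<close> the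
  composite \<open>quantile \<nu> \<circ> cdf \<sigma>\<close> meets such arguments on a \<open>\<sigma>\<close>-null set only.
\<close>
definition quantile :: "real measure \<Rightarrow> real \<Rightarrow> real" where
  "quantile \<nu> y = (LEAST z. cdf \<nu> z \<ge> y)"

definition ot_map :: "real measure \<Rightarrow> real measure \<Rightarrow> real \<Rightarrow> real" where
  "ot_map \<sigma> \<mu> = quantile \<mu> \<circ> cdf \<sigma>"

text \<open>
  The index type \<open>'n\<close> carries no order, so \<open>e\<close> labels the columns by \<open>1, \<dots>, n\<close>:
  the \<open>i\<close>-th column of \<open>P\<close> is \<open>column (e i) P\<close>.
\<close>
definition slice_map ::
    "(nat \<Rightarrow> 'n) \<Rightarrow> nat \<Rightarrow> (real^'n) measure \<Rightarrow> (real^'n) measure \<Rightarrow> real^'n^'n \<Rightarrow> real^'n \<Rightarrow> real^'n"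
  where
  "slice_map e j \<mu> \<sigma> P x =
     (\<Sum>i=1..j. ot_map (slice \<sigma> (column (e i) P)) (slice \<mu> (column (e i) P)) (x \<bullet> column (e i) P)
                  *\<^sub>R column (e i) P)
   + (\<Sum>i=j+1..CARD('n). (x \<bullet> column (e i) P) *\<^sub>R column (e i) P)"

definition H_deriv ::
    "(nat \<Rightarrow> 'n) \<Rightarrow> nat \<Rightarrow> (real^'n^'n) measure \<Rightarrow> (real^'n) measure \<Rightarrow> (real^'n) measure \<Rightarrow> real^'n \<Rightarrow> real^'n"
  where
  "H_deriv e j u \<mu> \<eta> x = (\<integral>P. (x - slice_map e j \<mu> \<eta> P x) \<partial>u)"

definition slice_step ::
    "(nat \<Rightarrow> 'n) \<Rightarrow> nat \<Rightarrow> (real^'n) measure \<Rightarrow> real \<Rightarrow> real^'n^'n \<Rightarrow> (real^'n) measure \<Rightarrow> (real^'n) measure"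
  where
  "slice_step e j \<mu> g P \<sigma> = distr \<sigma> borel (\<lambda>x. (1 - g) *\<^sub>R x + g *\<^sub>R slice_map e j \<mu> \<sigma> P x)"

primrec slice_iter ::
    "(nat \<Rightarrow> 'n) \<Rightarrow> nat \<Rightarrow> (real^'n) measure \<Rightarrow> (real^'n) measure \<Rightarrow> (nat \<Rightarrow> real) \<Rightarrow> (nat \<Rightarrow> real^'n^'n)
      \<Rightarrow> nat \<Rightarrow> (real^'n) measure"
  where
  "slice_iter e j \<mu> \<sigma>0 \<gamma> P 0 = \<sigma>0"
| "slice_iter e j \<mu> \<sigma>0 \<gamma> P (Suc k) = slice_step e j \<mu> (\<gamma> k) (P k) (slice_iter e j \<mu> \<sigma>0 \<gamma> P k)"

end

theory Submission
  imports Defs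
begin

text \<open>
  The energy \<open>E(\<sigma>)\<close>, the integral over \<open>P\<close> of \<open>\<parallel>T\<^sub>P - id\<parallel>\<^sup>2\<close> in \<open>L\<^sup>2(\<sigma>)\<close>, is a Lyapunov function.
  The maps \<open>T\<^sub>P\<close> are assembled from optimal one-dimensional maps, and pushing \<open>\<sigma>\<close> forward along a
  step produces competitors for every other frame \<open>Q\<close>. This yields
  \<open>E(\<sigma>\<^sub>k\<^sub>+\<^sub>1) \<le> E(\<sigma>\<^sub>k) + 2 \<gamma>\<^sub>k \<langle>H'(\<sigma>\<^sub>k), T\<^sub>P - id\<rangle> + C \<gamma>\<^sub>k\<^sup>2\<close> with \<open>P = P\<^sub>k\<close>, where the
  inner product has conditional mean \<open>-\<parallel>H'(\<sigma>\<^sub>k)\<parallel>\<^sup>2\<close>. The noise is a sum of bounded martingale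
  differences weighted by \<open>\<gamma>\<^sub>k\<close> and converges almost surely, so \<open>E(\<sigma>\<^sub>k)\<close> converges and
  \<open>\<Sum> \<gamma>\<^sub>k \<parallel>H'(\<sigma>\<^sub>k)\<parallel>\<^sup>2\<close> is finite. Hence \<open>H'(\<sigma>\<^sub>k) \<rightarrow> 0\<close> along a subsequence. By compactness and
  the stability of one-dimensional transport under \<open>W\<^sub>2\<close>-convergence this subsequence clusters at a
  zero of \<open>H'\<close>, which can only be \<open>\<mu>\<close>. So \<open>E(\<sigma>\<^sub>k) \<rightarrow> 0\<close>, and since \<open>\<parallel>H'\<parallel>\<^sup>2 \<le> E\<close> the same
  argument applies to every subsequence.
\<close>

section \<open>Quantiles\<close>

text \<open>By one-dimensional optimality \<open>cost\<close> at \<open>P\<close> is the sum of the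
  squared distances between the first \<open>j\<close> slices, so the energy is twice
  \<open>H_j\<close>. It is followed instead of the distance to \<mu> because a step can be compared
  in it: after a move in frame P, frame Q may keep its old one-dimensional targets, which still have
  the right laws although x has moved. The resulting cross term is an inner product of two
  displacements, and averaging over Q turns one of them into -H'. The constant C bounds the squared
  distance to \<mu> over K and \<sigma>0, and the same bound makes the martingale differences
  bounded. Square summability of the steps pays both for the quadratic error and for the variance of
  the noise. Two obstacles shape the rest. Quantiles are unspecified at some levels, so the maps T
  are controlled only almost everywhere, by way of slices without atoms. And the iterates are random
  measures, so measurability in the path is obtained by treating them as kernels. Stability is
  proved in L^1 only, which is enough to conclude that H' vanishes almost everywhere at a cluster
  point.\<close>

lemma cdf_ge_iff_Inf_le:
  assumes "real_distribution \<nu>" "0 < y" "y \<le> cdf \<nu> c"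
  defines "m \<equiv> Inf {z. y \<le> cdf \<nu> z}"
  shows "y \<le> cdf \<nu> z \<longleftrightarrow> m \<le> z"
proof -
  interpret real_distribution \<nu> by fact
  interpret cdf_distribution \<nu> by unfold_locales
  let ?F = "{z. y \<le> cdf \<nu> z}"
  obtain l where "cdf \<nu> l < y"
    by (metis eventually_happens' trivial_limit_at_bot_linorder order_tendstoD(2) bot \<open>0 < y\<close>)
  with mono have bdd: "bdd_below ?F"
    by (auto intro!: bdd_belowI[of _ l] elim: mono_invE[OF _ less_le_trans])
  have ne: "?F \<noteq> {}" using assms by auto
  \<comment> \<open>Right continuity makes the infimum attained: the CDF at \<open>m\<close> is the
    infimum of its values on \<open>?F\<close>, all at least \<open>y\<close>.\<close>
  have "y \<le> (INF s\<in>?F. cdf \<nu> s)"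
    by (rule cINF_greatest[OF ne]) auto
  also have "\<dots> = cdf \<nu> m"
    unfolding m_def using continuous_at_Inf_mono[OF mono cont ne bdd] ..
  finally have "y \<le> cdf \<nu> m" .
  then show ?thesis
    using cInf_lower[of z, OF _ bdd] monoD[OF mono, of m z] by (auto simp: m_def)
qed

text \<open>The witness \<open>c\<close>, in place of \<open>y < 1\<close>, also admits
  \<open>y = 1\<close> when the CDF reaches 1. With it the admissible levels are exactly those not
  covered by \<open>quantile_junk\<close>.\<close>

lemma quantile_le_iff:
  assumes "real_distribution \<nu>" "0 < y" "y \<le> cdf \<nu> c"
  shows "quantile \<nu> y \<le> t \<longleftrightarrow> y \<le> cdf \<nu> t"
proof -
  define m where "m = Inf {z. y \<le> cdf \<nu> z}"
  have *: "y \<le> cdf \<nu> z \<longleftrightarrow> m \<le> z" for z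
    unfolding m_def by (rule cdf_ge_iff_Inf_le[OF assms])
  have "quantile \<nu> y = m"
    unfolding quantile_def by (rule Least_equality) (use * in auto)
  then show ?thesis using * by simp
qed

lemma quantile_le_iff_interior:
  assumes "real_distribution \<nu>" "0 < y" "y < 1"
  shows "quantile \<nu> y \<le> t \<longleftrightarrow> y \<le> cdf \<nu> t"
proof -
  interpret real_distribution \<nu> by fact
  obtain c where "y < cdf \<nu> c"
    using order_tendstoD(1)[OF cdf_lim_at_top_prob \<open>y < 1\<close>]
    by (auto dest!: eventually_happens'[OF trivial_limit_at_top_linorder])
  with assms show ?thesis by (intro quantile_le_iff[where c=c]) auto
qed

text \<open>For such levels the superlevel set of the CDF is the whole line or empty, so it has no
  least element and \<open>LEAST\<close> collapses to one fixed unspecified real. That it is the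
  same real for all \<nu> and y keeps the quantile measurable there.\<close>

lemma quantile_junk:
  assumes "real_distribution \<nu>" "y \<le> 0 \<or> (\<forall>z. cdf \<nu> z < y)"
  shows "quantile \<nu> y = (THE z. False)"
proof -
  interpret real_distribution \<nu> by fact
  have "\<not> (\<forall>z'. y \<le> cdf \<nu> z' \<longrightarrow> z \<le> z')" if "y \<le> 0" for z
    using that cdf_nonneg[of "z - 1"] by (auto intro!: exI[of _ "z - 1"])
  then have "(\<lambda>z. y \<le> cdf \<nu> z \<and> (\<forall>z'. y \<le> cdf \<nu> z' \<longrightarrow> z \<le> z')) = (\<lambda>_. False)"
    using assms(2) by (auto simp: fun_eq_iff not_le)
  then show ?thesis unfolding quantile_def Least_def by simp
qed

text \<open>The distribution varies with the parameter as well as the level, as is needed when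
  slices are taken in a random direction. On good levels the sublevel sets come from
  \<open>quantile_le_iff\<close>, elsewhere the quantile is constant.\<close>

lemma borel_measurable_quantile:
  assumes "\<And>l. l \<in> space L \<Longrightarrow> real_distribution (G l)"
    and [measurable]: "\<And>t. (\<lambda>l. cdf (G l) t) \<in> borel_measurable L" "Y \<in> borel_measurable L"
  shows "(\<lambda>l. quantile (G l) (Y l)) \<in> borel_measurable L"
proof (rule borel_measurableI_le)
  fix a
  \<comment> \<open>Monotonicity lets natural numbers replace arbitrary real witnesses, so that
    \<open>good\<close> is a countable union of measurable conditions.\<close>
  define good where "good l \<longleftrightarrow> 0 < Y l \<and> (\<exists>n::nat. Y l \<le> cdf (G l) (real n))" for l
  have [measurable]: "Measurable.pred L good" unfolding good_def by measurable
  have "quantile (G l) (Y l) \<le> a \<longleftrightarrow>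
      (good l \<and> Y l \<le> cdf (G l) a) \<or> (\<not> good l \<and> (THE z. False) \<le> a)" if l: "l \<in> space L" for l
  proof (cases "good l")
    case True
    then show ?thesis using quantile_le_iff[OF assms(1)[OF l]] by (auto simp: good_def)
  next
    case False
    interpret real_distribution "G l" using assms(1) l by auto
    have "cdf (G l) z < Y l" if "0 < Y l" for z
    proof -
      obtain n where "z \<le> real n" using real_arch_simple by auto
      moreover have "cdf (G l) (real n) < Y l" using False that by (auto simp: good_def not_le)
      ultimately show ?thesis using cdf_nondecreasing[of z "real n"] by linarith
    qed
    then have "Y l \<le> 0 \<or> (\<forall>z. cdf (G l) z < Y l)" by (meson not_le)
    from quantile_junk[OF assms(1)[OF l] this] False show ?thesis by (simp only: simp_thms)
  qed
  then have "{l \<in> space L. quantile (G l) (Y l) \<le> a} =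
      {l \<in> space L. (good l \<and> Y l \<le> cdf (G l) a) \<or> (\<not> good l \<and> (THE z. False) \<le> a)}"
    by (intro Collect_cong conj_cong refl)
  also have "\<dots> \<in> sets L" by measurable
  finally show "{l \<in> space L. quantile (G l) (Y l) \<le> a} \<in> sets L" .
qed

section \<open>Monotone transport on the line\<close>

text \<open>The trace that absolute continuity leaves on a slice: the CDF is continuous, so the
  monotone map hits its target law exactly.\<close>

definition atomless :: "real measure \<Rightarrow> bool" where
  "atomless \<alpha> \<longleftrightarrow> real_distribution \<alpha> \<and> (\<forall>x. measure \<alpha> {x} = 0)"

text \<open>The point \<open>q\<close> is the largest p-quantile. Continuity makes the sublevel set
  closed, so its supremum belongs to it, and the intermediate value theorem provides a point of
  value exactly \<open>p\<close>.\<close>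

lemma atomless_sublevel_cdf:
  assumes "atomless \<alpha>" "0 < p" "p < 1"
  obtains q where "{x. cdf \<alpha> x \<le> p} = {..q}" "cdf \<alpha> q = p"
proof -
  interpret real_distribution \<alpha> using assms by (auto simp: atomless_def)
  have cont: "continuous_on UNIV (cdf \<alpha>)"
    using assms(1) by (auto intro!: continuous_at_imp_continuous_on simp: isCont_cdf atomless_def)
  let ?S = "{x. cdf \<alpha> x \<le> p}"
  obtain l where l: "cdf \<alpha> l < p"
    by (metis eventually_happens' trivial_limit_at_bot_linorder order_tendstoD(2) cdf_lim_at_bot \<open>0 < p\<close>)
  obtain r where r: "p < cdf \<alpha> r"
    using order_tendstoD(1)[OF cdf_lim_at_top_prob \<open>p < 1\<close>]
    by (auto dest!: eventually_happens'[OF trivial_limit_at_top_linorder])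
  have bdd: "bdd_above ?S"
    using r cdf_nondecreasing by (auto intro!: bdd_aboveI[of _ r]) (meson le_less_trans linear not_less)
  have closed: "closed ?S" by (intro closed_Collect_le cont continuous_on_const)
  define q where "q = Sup ?S"
  have q: "q \<in> ?S" unfolding q_def by (rule closed_contains_Sup[OF _ bdd closed]) (use l in \<open>auto intro: less_imp_le\<close>)
  have "l \<le> r" using l r cdf_nondecreasing[of r l] by linarith
  then obtain x where x: "cdf \<alpha> x = p"
    using IVT'[of "cdf \<alpha>" l p r] l r continuous_on_subset[OF cont] by auto
  then have "x \<le> q" unfolding q_def by (intro cSup_upper bdd) auto
  then have "cdf \<alpha> q = p" using x q cdf_nondecreasing[of x q] by auto
  moreover have "?S = {..q}"
    using q cdf_nondecreasing cSup_upper[OF _ bdd] by (auto simp: q_def intro: order_trans)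
  ultimately show ?thesis using that by blast
qed

lemma measurable_cdf:
  assumes "real_distribution \<alpha>"
  shows "cdf \<alpha> \<in> borel_measurable borel"
proof -
  interpret real_distribution \<alpha> by fact
  show ?thesis by (intro borel_measurable_mono monoI cdf_nondecreasing)
qed

text \<open>Probability integral transform: a continuous CDF evaluated at its own variable is
  uniform on the unit interval. At \<open>p = 0\<close> the sublevel set can be empty, so it is
  squeezed by small positive levels.\<close>

lemma measure_atomless_sublevel_cdf:
  assumes "atomless \<alpha>" "0 \<le> p" "p \<le> 1"
  shows "measure \<alpha> {x. cdf \<alpha> x \<le> p} = p"
proof -
  interpret real_distribution \<alpha> using assms by (auto simp: atomless_def)
  have rd: "real_distribution \<alpha>" by unfold_locales
  note measurable_cdf[OF rd, measurable]
  have interior: "measure \<alpha> {x. cdf \<alpha> x \<le> p} = p" if p: "0 < p" "p < 1" for p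
    using atomless_sublevel_cdf[OF assms(1) p] by (metis cdf_def2)
  consider "p = 0" | "p = 1" | "0 < p" "p < 1" using assms by fastforce
  then show ?thesis
  proof cases
    case 1
    have "measure \<alpha> {x. cdf \<alpha> x \<le> 0} \<le> 0 + e" if "e > 0" for e :: real
    proof -
      have "measure \<alpha> {x. cdf \<alpha> x \<le> 0} \<le> measure \<alpha> {x. cdf \<alpha> x \<le> min e (1/2)}"
        using that by (intro finite_measure_mono) auto
      then show ?thesis using interior[of "min e (1/2)"] that by auto
    qed
    then have "measure \<alpha> {x. cdf \<alpha> x \<le> 0} \<le> 0" by (rule field_le_epsilon)
    then show ?thesis using 1 by (simp add: measure_le_0_iff)
  next
    case 2
    then have "{x. cdf \<alpha> x \<le> p} = space \<alpha>" using cdf_bounded_prob by auto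
    then show ?thesis using 2 prob_space by simp
  qed (use interior in auto)
qed

text \<open>Hence unspecified quantile values are met on a null set only.\<close>

lemma AE_cdf_interior:
  assumes "atomless \<alpha>"
  shows "AE x in \<alpha>. 0 < cdf \<alpha> x \<and> cdf \<alpha> x < 1"
proof -
  interpret real_distribution \<alpha> using assms by (auto simp: atomless_def)
  have rd: "real_distribution \<alpha>" by unfold_locales
  note measurable_cdf[OF rd, measurable]
  have "prob {x. cdf \<alpha> x < 1} = 1"
  proof (rule antisym[OF prob_le_1], rule field_le_epsilon)
    fix e :: real assume e: "e > 0"
    have "measure \<alpha> {x. cdf \<alpha> x \<le> max 0 (1 - e)} \<le> prob {x. cdf \<alpha> x < 1}"
      using e by (intro finite_measure_mono) auto
    then show "1 \<le> prob {x. cdf \<alpha> x < 1} + e"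
      using measure_atomless_sublevel_cdf[OF assms, of "max 0 (1 - e)"] e by auto
  qed
  then have "AE x in \<alpha>. cdf \<alpha> x < 1"
    by (auto dest: AE_prob_1)
  moreover have "AE x in \<alpha>. \<not> cdf \<alpha> x \<le> 0"
    using measure_atomless_sublevel_cdf[OF assms, of 0] prob_eq_0[of "{x. cdf \<alpha> x \<le> 0}"] by simp
  ultimately show ?thesis by eventually_elim auto
qed

text \<open>One null set serves all \<open>t\<close>, since it depends only on whether the level
  \<open>cdf \<alpha> x\<close> is interior.\<close>

lemma AE_ot_map_le_iff:
  assumes "atomless \<alpha>" "real_distribution \<beta>"
  shows "AE x in \<alpha>. \<forall>t. ot_map \<alpha> \<beta> x \<le> t \<longleftrightarrow> cdf \<alpha> x \<le> cdf \<beta> t"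
  using AE_cdf_interior[OF assms(1)]
  by eventually_elim (auto simp: ot_map_def quantile_le_iff_interior[OF assms(2)])

lemma borel_measurable_ot_map:
  assumes "real_distribution \<alpha>" "real_distribution \<beta>"
  shows "ot_map \<alpha> \<beta> \<in> borel_measurable borel"
  unfolding ot_map_def comp_def
  by (intro borel_measurable_quantile measurable_cdf assms) auto

text \<open>Almost surely both \<open>x \<le> s\<close> and
  \<open>ot_map \<alpha> \<beta> x \<le> t\<close> are sublevel conditions on \<open>x\<close>, so
  they are nested and their intersection is the smaller one. The minimum is the upper Frechet bound
  for a joint CDF with these marginals.\<close>

lemma measure_ot_map_le:
  assumes "atomless \<alpha>" "real_distribution \<beta>"
  shows "measure \<alpha> {x. ot_map \<alpha> \<beta> x \<le> t} = cdf \<beta> t"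
    and "measure \<alpha> {x. x \<le> s \<and> ot_map \<alpha> \<beta> x \<le> t} = min (cdf \<alpha> s) (cdf \<beta> t)"
proof -
  interpret real_distribution \<alpha> using assms by (auto simp: atomless_def)
  interpret \<beta>: real_distribution \<beta> by fact
  have rd: "real_distribution \<alpha>" by unfold_locales
  note measurable_cdf[OF rd, measurable] borel_measurable_ot_map[OF rd assms(2), measurable]
  have p: "measure \<alpha> {x. cdf \<alpha> x \<le> cdf \<beta> t} = cdf \<beta> t"
    by (intro measure_atomless_sublevel_cdf assms \<beta>.cdf_bounded_prob \<beta>.cdf_nonneg)
  have "measure \<alpha> {x. ot_map \<alpha> \<beta> x \<le> t} = measure \<alpha> {x. cdf \<alpha> x \<le> cdf \<beta> t}"
    by (rule finite_measure_eq_AE) (use AE_ot_map_le_iff[OF assms] in auto)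
  with p show "measure \<alpha> {x. ot_map \<alpha> \<beta> x \<le> t} = cdf \<beta> t" by simp
  have *: "measure \<alpha> {x. x \<le> s \<and> ot_map \<alpha> \<beta> x \<le> t} = measure \<alpha> ({..s} \<inter> {x. cdf \<alpha> x \<le> cdf \<beta> t})"
    by (rule finite_measure_eq_AE) (use AE_ot_map_le_iff[OF assms] in auto)
  show "measure \<alpha> {x. x \<le> s \<and> ot_map \<alpha> \<beta> x \<le> t} = min (cdf \<alpha> s) (cdf \<beta> t)"
  proof (cases "cdf \<alpha> s \<le> cdf \<beta> t")
    case True
    then have "{..s} \<inter> {x. cdf \<alpha> x \<le> cdf \<beta> t} = {..s}"
      using cdf_nondecreasing by (auto intro: order_trans)
    then show ?thesis using True * by (simp add: cdf_def2)
  next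
    case False
    then have "{..s} \<inter> {x. cdf \<alpha> x \<le> cdf \<beta> t} = {x. cdf \<alpha> x \<le> cdf \<beta> t}"
      using cdf_nondecreasing by auto (meson le_less_trans linear not_less)
    then show ?thesis using False p * by simp
  qed
qed

lemma distr_ot_map:
  assumes "atomless \<alpha>" "real_distribution \<beta>"
  shows "distr \<alpha> borel (ot_map \<alpha> \<beta>) = \<beta>"
proof -
  interpret real_distribution \<alpha> using assms by (auto simp: atomless_def)
  have rd: "real_distribution \<alpha>" by unfold_locales
  note borel_measurable_ot_map[OF rd assms(2), measurable]
  show ?thesis
  proof (rule cdf_unique)
    show "cdf (distr \<alpha> borel (ot_map \<alpha> \<beta>)) = cdf \<beta>"
      using measure_ot_map_le(1)[OF assms]
      by (auto simp: fun_eq_iff cdf_def2 measure_distr vimage_def)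
    show "real_distribution (distr \<alpha> borel (ot_map \<alpha> \<beta>))" by (rule real_distribution_distr) measurable
  qed (fact assms)
qed

text \<open>For x below y the pairs with x <= s < t < y form a triangle of area half the squared
  difference, hence the factor 2. The second alternative covers the opposite order.\<close>

lemma square_diff_layer_cake:
  fixes x y :: real
  shows "ennreal ((x - y)\<^sup>2) = (\<integral>\<^sup>+t. \<integral>\<^sup>+s. 2 * indicator {(s, t). s < t \<and> (x \<le> s \<and> t < y \<or> y \<le> s \<and> t < x)} (s, t) \<partial>lborel \<partial>lborel)"
proof -
  have *: "ennreal ((x - y)\<^sup>2) = (\<integral>\<^sup>+t. \<integral>\<^sup>+s. 2 * indicator {(s, t). s < t \<and> (x \<le> s \<and> t < y \<or> y \<le> s \<and> t < x)} (s, t) \<partial>lborel \<partial>lborel)"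
    if "x \<le> y" for x y :: real
  proof -
    \<comment> \<open>The point \<open>t = y\<close> is left out because the indicator of the closed
      interval, wanted for the fundamental theorem, differs there from the strict condition.\<close>
    have "(\<integral>\<^sup>+s. 2 * indicator {(s, t). s < t \<and> (x \<le> s \<and> t < y \<or> y \<le> s \<and> t < x)} (s, t) \<partial>lborel)
        = ennreal (2 * (t - x)) * indicator {x..y} t" if "t \<noteq> y" for t
    proof -
      have "(\<integral>\<^sup>+s. 2 * indicator {(s, t). s < t \<and> (x \<le> s \<and> t < y \<or> y \<le> s \<and> t < x)} (s, t) \<partial>lborel)
          = (\<integral>\<^sup>+s. (if x \<le> t \<and> t < y then 2 else 0) * indicator {x..<t} s \<partial>lborel)"
        using \<open>x \<le> y\<close> by (intro nn_integral_cong) (auto split: split_indicator)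
      also have "\<dots> = (if x \<le> t \<and> t < y then 2 else 0) * emeasure lborel {x..<t}"
        by (subst nn_integral_cmult_indicator) auto
      also have "\<dots> = ennreal (2 * (t - x)) * indicator {x..y} t"
        using that by (cases "x \<le> t") (auto simp: ennreal_mult right_diff_distrib[symmetric] simp del: right_diff_distrib_numeral split: split_indicator)
      finally show ?thesis .
    qed
    then have "(\<integral>\<^sup>+t. \<integral>\<^sup>+s. 2 * indicator {(s, t). s < t \<and> (x \<le> s \<and> t < y \<or> y \<le> s \<and> t < x)} (s, t) \<partial>lborel \<partial>lborel)
        = (\<integral>\<^sup>+t. ennreal (2 * (t - x)) * indicator {x..y} t \<partial>lborel)"
      by (intro nn_integral_cong_AE) (use AE_lborel_singleton[of y] in \<open>eventually_elim, simp\<close>)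
    also have "\<dots> = ennreal ((y - x)\<^sup>2 - (x - x)\<^sup>2)"
      using that
      by (intro nn_integral_FTC_Icc) (auto intro!: derivative_eq_intros)
    finally show ?thesis by (simp add: power2_commute)
  qed
  show ?thesis
  proof (cases "x \<le> y")
    case False
    then show ?thesis using *[of y x] by (simp add: power2_commute disj_commute)
  qed (use * in auto)
qed

lemma nn_integral_square_diff_layer_cake:
  assumes "prob_space m" and [measurable]: "X \<in> borel_measurable m" "Y \<in> borel_measurable m"
  shows "(\<integral>\<^sup>+w. ennreal ((X w - Y w)\<^sup>2) \<partial>m) =
    (\<integral>\<^sup>+(s, t). 2 * emeasure m {w\<in>space m. s < t \<and> (X w \<le> s \<and> t < Y w \<or> Y w \<le> s \<and> t < X w)} \<partial>(lborel \<Otimes>\<^sub>M lborel))"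
proof -
  interpret m: prob_space m by fact
  interpret L: sigma_finite_measure "lborel \<Otimes>\<^sub>M lborel :: (real \<times> real) measure"
    by (simp add: lborel_prod sigma_finite_lborel)
  interpret pair_sigma_finite m "lborel \<Otimes>\<^sub>M lborel :: (real \<times> real) measure" ..
  let ?A = "\<lambda>w s t. s < t \<and> (X w \<le> s \<and> t < Y w \<or> Y w \<le> s \<and> t < X w)"
  let ?f = "\<lambda>w p. 2 * (if ?A w (fst p) (snd p) then 1 else 0) :: ennreal"
  have "(\<integral>\<^sup>+w. ennreal ((X w - Y w)\<^sup>2) \<partial>m) = (\<integral>\<^sup>+w. \<integral>\<^sup>+p. ?f w p \<partial>(lborel \<Otimes>\<^sub>M lborel) \<partial>m)"
  proof (rule nn_integral_cong)
    fix w assume "w \<in> space m"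
    show "ennreal ((X w - Y w)\<^sup>2) = (\<integral>\<^sup>+p. ?f w p \<partial>(lborel \<Otimes>\<^sub>M lborel))"
      by (subst lborel_pair.nn_integral_snd[symmetric]) (auto simp: square_diff_layer_cake indicator_def of_bool_def)
  qed
  also have "\<dots> = (\<integral>\<^sup>+p. \<integral>\<^sup>+w. ?f w p \<partial>m \<partial>(lborel \<Otimes>\<^sub>M lborel))"
    by (intro Fubini'[symmetric]) measurable
  also have "\<dots> = (\<integral>\<^sup>+(s, t). 2 * emeasure m {w\<in>space m. ?A w s t} \<partial>(lborel \<Otimes>\<^sub>M lborel))"
  proof (rule nn_integral_cong, clarify, simp only: fst_conv snd_conv prod.case)
    fix s t :: real
    have "(\<integral>\<^sup>+w. 2 * (if ?A w s t then 1 else 0) \<partial>m) = (\<integral>\<^sup>+w. 2 * indicator {w\<in>space m. ?A w s t} w \<partial>m)"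
      by (intro nn_integral_cong) (auto split: split_indicator)
    also have "\<dots> = 2 * emeasure m {w\<in>space m. ?A w s t}"
      by (rule nn_integral_cmult_indicator) measurable
    finally show "(\<integral>\<^sup>+w. 2 * (if ?A w s t then 1 else 0) \<partial>m) = 2 * emeasure m {w\<in>space m. ?A w s t}" .
  qed
  finally show ?thesis .
qed

text \<open>The layer cake formula expresses the cost of a coupling through the probabilities of the
  events \<open>U \<le> s, t < V\<close> and \<open>V \<le> s, t < U\<close>. The marginals bound these from below by
  differences of distribution functions, and the monotone coupling attains each of the bounds.\<close>

theorem ot_map_optimal:
  assumes \<alpha>: "atomless \<alpha>" and \<beta>: "real_distribution \<beta>" and \<pi>: "prob_space \<pi>"
    and UV[measurable]: "U \<in> borel_measurable \<pi>" "V \<in> borel_measurable \<pi>"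
    and law: "distr \<pi> borel U = \<alpha>" "distr \<pi> borel V = \<beta>"
  shows "(\<integral>\<^sup>+x. ennreal ((x - ot_map \<alpha> \<beta> x)\<^sup>2) \<partial>\<alpha>) \<le> (\<integral>\<^sup>+w. ennreal ((U w - V w)\<^sup>2) \<partial>\<pi>)"
proof -
  interpret \<alpha>: real_distribution \<alpha> using \<alpha> by (auto simp: atomless_def)
  interpret \<beta>: real_distribution \<beta> by fact
  interpret \<pi>: prob_space \<pi> by fact
  have rd: "real_distribution \<alpha>" by unfold_locales
  note borel_measurable_ot_map[OF rd \<beta>, measurable]
  let ?T = "ot_map \<alpha> \<beta>"
  have U: "measure \<pi> {w\<in>space \<pi>. U w \<le> s} = cdf \<alpha> s" and V: "measure \<pi> {w\<in>space \<pi>. V w \<le> s} = cdf \<beta> s" for s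
    by (auto simp: law[symmetric] cdf_def2 measure_distr vimage_def intro!: arg_cong[where f="measure \<pi>"])
  have "measure \<alpha> {x. s < t \<and> (x \<le> s \<and> t < ?T x \<or> ?T x \<le> s \<and> t < x)}
      \<le> measure \<pi> {w\<in>space \<pi>. s < t \<and> (U w \<le> s \<and> t < V w \<or> V w \<le> s \<and> t < U w)}" for s t
  proof (cases "s < t")
    case True
    \<comment> \<open>The two crossings are disjoint because \<open>s < t\<close>, and each is a
      marginal event minus a joint event known from \<open>measure_ot_map_le\<close>.\<close>
    have "measure \<alpha> {x. s < t \<and> (x \<le> s \<and> t < ?T x \<or> ?T x \<le> s \<and> t < x)}
        = measure \<alpha> (({..s} - {x. x \<le> s \<and> ?T x \<le> t}) \<union> ({x. ?T x \<le> s} - {x. x \<le> t \<and> ?T x \<le> s}))"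
      using True by (intro arg_cong[where f="measure \<alpha>"]) auto
    also have "\<dots> = measure \<alpha> ({..s} - {x. x \<le> s \<and> ?T x \<le> t}) + measure \<alpha> ({x. ?T x \<le> s} - {x. x \<le> t \<and> ?T x \<le> s})"
      using True by (intro \<alpha>.finite_measure_Union) auto
    also have "\<dots> = (cdf \<alpha> s - min (cdf \<alpha> s) (cdf \<beta> t)) + (cdf \<beta> s - min (cdf \<alpha> t) (cdf \<beta> s))"
      using measure_ot_map_le[OF \<alpha> \<beta>]
      by (subst (1 2) \<alpha>.finite_measure_Diff) (auto simp: cdf_def2)
    \<comment> \<open>Frechet bound: under any coupling the joint probability is at most either
      marginal.\<close>
    also have "cdf \<alpha> s - min (cdf \<alpha> s) (cdf \<beta> t) \<le> measure \<pi> ({w\<in>space \<pi>. U w \<le> s} - {w\<in>space \<pi>. U w \<le> s \<and> V w \<le> t})"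
      using \<pi>.finite_measure_mono[of "{w\<in>space \<pi>. U w \<le> s \<and> V w \<le> t}" "{w\<in>space \<pi>. U w \<le> s}"]
        \<pi>.finite_measure_mono[of "{w\<in>space \<pi>. U w \<le> s \<and> V w \<le> t}" "{w\<in>space \<pi>. V w \<le> t}"]
      by (subst \<pi>.finite_measure_Diff) (auto simp: U V)
    also have "cdf \<beta> s - min (cdf \<alpha> t) (cdf \<beta> s) \<le> measure \<pi> ({w\<in>space \<pi>. V w \<le> s} - {w\<in>space \<pi>. U w \<le> t \<and> V w \<le> s})"
      using \<pi>.finite_measure_mono[of "{w\<in>space \<pi>. U w \<le> t \<and> V w \<le> s}" "{w\<in>space \<pi>. U w \<le> t}"]
        \<pi>.finite_measure_mono[of "{w\<in>space \<pi>. U w \<le> t \<and> V w \<le> s}" "{w\<in>space \<pi>. V w \<le> s}"]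
      by (subst \<pi>.finite_measure_Diff) (auto simp: U V)
    also have "measure \<pi> ({w\<in>space \<pi>. U w \<le> s} - {w\<in>space \<pi>. U w \<le> s \<and> V w \<le> t}) +
        measure \<pi> ({w\<in>space \<pi>. V w \<le> s} - {w\<in>space \<pi>. U w \<le> t \<and> V w \<le> s}) =
        measure \<pi> (({w\<in>space \<pi>. U w \<le> s} - {w\<in>space \<pi>. U w \<le> s \<and> V w \<le> t}) \<union>
          ({w\<in>space \<pi>. V w \<le> s} - {w\<in>space \<pi>. U w \<le> t \<and> V w \<le> s}))"
      using True by (intro \<pi>.finite_measure_Union[symmetric]) auto
    also have "\<dots> = measure \<pi> {w\<in>space \<pi>. s < t \<and> (U w \<le> s \<and> t < V w \<or> V w \<le> s \<and> t < U w)}"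
      using True by (intro arg_cong[where f="measure \<pi>"]) auto
    finally show ?thesis by simp
  qed auto
  then have "(\<integral>\<^sup>+(s, t). 2 * emeasure \<alpha> {x\<in>space \<alpha>. s < t \<and> (x \<le> s \<and> t < ?T x \<or> ?T x \<le> s \<and> t < x)} \<partial>(lborel \<Otimes>\<^sub>M lborel))
     \<le> (\<integral>\<^sup>+(s, t). 2 * emeasure \<pi> {w\<in>space \<pi>. s < t \<and> (U w \<le> s \<and> t < V w \<or> V w \<le> s \<and> t < U w)} \<partial>(lborel \<Otimes>\<^sub>M lborel))"
    by (intro nn_integral_mono)
      (auto simp: \<alpha>.emeasure_eq_measure \<pi>.emeasure_eq_measure intro!: mult_left_mono)
  then show ?thesis
    using rd by (subst (1 2) nn_integral_square_diff_layer_cake) (auto intro: \<pi> \<alpha>.prob_space_axioms)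
qed

section \<open>Stability of monotone transport\<close>

text \<open>The distance of two reals is the length of the set of levels separating them. Stability
  is read off level by level from this first-power formula.\<close>

lemma nn_integral_abs_diff_layer_cake:
  assumes "prob_space m" and [measurable]: "X \<in> borel_measurable m" "Y \<in> borel_measurable m"
  shows "(\<integral>\<^sup>+w. ennreal \<bar>X w - Y w\<bar> \<partial>m) =
    (\<integral>\<^sup>+t. emeasure m {w\<in>space m. X w \<le> t \<and> t < Y w} + emeasure m {w\<in>space m. Y w \<le> t \<and> t < X w} \<partial>lborel)"
proof -
  interpret m: prob_space m by fact
  interpret pair_sigma_finite m "lborel :: real measure" ..
  let ?f = "\<lambda>w t. (if X w \<le> t \<and> t < Y w then 1 else 0) + (if Y w \<le> t \<and> t < X w then 1 else 0) :: ennreal"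
  have "(\<integral>\<^sup>+w. ennreal \<bar>X w - Y w\<bar> \<partial>m) = (\<integral>\<^sup>+w. \<integral>\<^sup>+t. ?f w t \<partial>lborel \<partial>m)"
  proof (rule nn_integral_cong)
    fix w
    have "(\<integral>\<^sup>+t. ?f w t \<partial>lborel) = (\<integral>\<^sup>+t. indicator {min (X w) (Y w)..<max (X w) (Y w)} t \<partial>lborel)"
      by (intro nn_integral_cong) (auto split: split_indicator)
    then show "ennreal \<bar>X w - Y w\<bar> = (\<integral>\<^sup>+t. ?f w t \<partial>lborel)"
      by (auto simp: max_def min_def abs_if)
  qed
  also have "\<dots> = (\<integral>\<^sup>+t. \<integral>\<^sup>+w. ?f w t \<partial>m \<partial>lborel)"
    by (intro Fubini'[symmetric]) measurable
  also have "\<dots> = (\<integral>\<^sup>+t. emeasure m {w\<in>space m. X w \<le> t \<and> t < Y w} + emeasure m {w\<in>space m. Y w \<le> t \<and> t < X w} \<partial>lborel)"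
  proof (rule nn_integral_cong)
    fix t
    have "(\<integral>\<^sup>+w. ?f w t \<partial>m) = (\<integral>\<^sup>+w. indicator {w\<in>space m. X w \<le> t \<and> t < Y w} w + indicator {w\<in>space m. Y w \<le> t \<and> t < X w} w \<partial>m)"
      by (intro nn_integral_cong) (auto split: split_indicator)
    also have "\<dots> = emeasure m {w\<in>space m. X w \<le> t \<and> t < Y w} + emeasure m {w\<in>space m. Y w \<le> t \<and> t < X w}"
      by (subst nn_integral_add) auto
    finally show "(\<integral>\<^sup>+w. ?f w t \<partial>m) = emeasure m {w\<in>space m. X w \<le> t \<and> t < Y w} + emeasure m {w\<in>space m. Y w \<le> t \<and> t < X w}" .
  qed
  finally show ?thesis .
qed

text \<open>With \<open>p\<close> the value of the target distribution function at \<open>t\<close>, the two events compared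
  here are \<open>U \<le> q', q < V\<close> and \<open>V \<le> q, q' < U\<close> for \<open>p\<close>-quantiles \<open>q'\<close> of \<open>U\<close> and \<open>q\<close> of \<open>V\<close>.
  They are equally likely, and depending on the order of \<open>q\<close> and \<open>q'\<close> one of them is controlled
  by \<open>q\<close> alone.\<close>

lemma measure_ot_map_crossing_le:
  assumes \<beta>: "real_distribution \<beta>" and \<pi>: "prob_space \<pi>"
    and UV[measurable]: "U \<in> borel_measurable \<pi>" "V \<in> borel_measurable \<pi>"
    and \<alpha>: "distr \<pi> borel U = \<alpha>" "atomless \<alpha>" and \<alpha>': "distr \<pi> borel V = \<alpha>'" "atomless \<alpha>'"
    and q: "{x. cdf \<alpha>' x \<le> cdf \<beta> t} = {..q}" and p: "0 < cdf \<beta> t" "cdf \<beta> t < 1"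
  defines "X \<equiv> \<lambda>w. ot_map \<alpha> \<beta> (U w)" and "Y \<equiv> \<lambda>w. ot_map \<alpha>' \<beta> (V w)"
  shows "measure \<pi> {w\<in>space \<pi>. X w \<le> t \<and> t < Y w}
      \<le> max (measure \<pi> {w\<in>space \<pi>. U w \<le> q \<and> q < V w}) (measure \<pi> {w\<in>space \<pi>. V w \<le> q \<and> q < U w})"
    and "measure \<pi> {w\<in>space \<pi>. Y w \<le> t \<and> t < X w} = measure \<pi> {w\<in>space \<pi>. X w \<le> t \<and> t < Y w}"
proof -
  interpret \<pi>: prob_space \<pi> by fact
  have rd: "real_distribution \<alpha>" "real_distribution \<alpha>'" using assms by (auto simp: atomless_def)
  note [measurable] = borel_measurable_ot_map[OF rd(1) \<beta>] borel_measurable_ot_map[OF rd(2) \<beta>]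
  have [measurable]: "X \<in> borel_measurable \<pi>" "Y \<in> borel_measurable \<pi>" by (auto simp: X_def Y_def)
  obtain q' where q': "{x. cdf \<alpha> x \<le> cdf \<beta> t} = {..q'}"
    using atomless_sublevel_cdf[OF \<alpha>(2) p] by metis
  have "AE w in \<pi>. \<forall>t. X w \<le> t \<longleftrightarrow> cdf \<alpha> (U w) \<le> cdf \<beta> t"
    unfolding X_def using AE_ot_map_le_iff[OF \<alpha>(2) \<beta>] unfolding \<alpha>(1)[symmetric] by (rule AE_distrD[rotated]) simp
  then have X: "AE w in \<pi>. X w \<le> t \<longleftrightarrow> U w \<le> q'" using q' by (elim AE_mp) (auto simp: set_eq_iff)
  have "AE w in \<pi>. \<forall>t. Y w \<le> t \<longleftrightarrow> cdf \<alpha>' (V w) \<le> cdf \<beta> t"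
    unfolding Y_def using AE_ot_map_le_iff[OF \<alpha>'(2) \<beta>] unfolding \<alpha>'(1)[symmetric] by (rule AE_distrD[rotated]) simp
  then have Y: "AE w in \<pi>. Y w \<le> t \<longleftrightarrow> V w \<le> q" using q by (elim AE_mp) (auto simp: set_eq_iff)
  have pX: "measure \<pi> {w\<in>space \<pi>. X w \<le> t} = cdf \<beta> t"
    using measure_ot_map_le(1)[OF \<alpha>(2) \<beta>, of t] unfolding \<alpha>(1)[symmetric]
    by (subst (asm) measure_distr) (auto simp: X_def \<alpha> vimage_def Int_def conj_commute)
  have pY: "measure \<pi> {w\<in>space \<pi>. Y w \<le> t} = cdf \<beta> t"
    using measure_ot_map_le(1)[OF \<alpha>'(2) \<beta>, of t] unfolding \<alpha>'(1)[symmetric]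
    by (subst (asm) measure_distr) (auto simp: Y_def \<alpha>' vimage_def Int_def conj_commute)
  \<comment> \<open>\<open>X\<close> and \<open>Y\<close> have the common law \<beta>, so removing
    their joint event from two events of equal probability leaves equal remainders.\<close>
  have "measure \<pi> {w\<in>space \<pi>. X w \<le> t \<and> t < Y w} = measure \<pi> ({w\<in>space \<pi>. X w \<le> t} - {w\<in>space \<pi>. X w \<le> t \<and> Y w \<le> t})"
    by (intro arg_cong[where f="measure \<pi>"]) auto
  also have "\<dots> = measure \<pi> {w\<in>space \<pi>. X w \<le> t} - measure \<pi> {w\<in>space \<pi>. X w \<le> t \<and> Y w \<le> t}"
    by (intro \<pi>.finite_measure_Diff) auto
  also have "\<dots> = measure \<pi> {w\<in>space \<pi>. Y w \<le> t} - measure \<pi> {w\<in>space \<pi>. X w \<le> t \<and> Y w \<le> t}"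
    by (simp add: pX pY)
  also have "\<dots> = measure \<pi> ({w\<in>space \<pi>. Y w \<le> t} - {w\<in>space \<pi>. X w \<le> t \<and> Y w \<le> t})"
    by (intro \<pi>.finite_measure_Diff[symmetric]) auto
  also have "\<dots> = measure \<pi> {w\<in>space \<pi>. Y w \<le> t \<and> t < X w}"
    by (intro arg_cong[where f="measure \<pi>"]) auto
  finally show eq: "measure \<pi> {w\<in>space \<pi>. Y w \<le> t \<and> t < X w} = measure \<pi> {w\<in>space \<pi>. X w \<le> t \<and> t < Y w}" ..
  show "measure \<pi> {w\<in>space \<pi>. X w \<le> t \<and> t < Y w}
      \<le> max (measure \<pi> {w\<in>space \<pi>. U w \<le> q \<and> q < V w}) (measure \<pi> {w\<in>space \<pi>. V w \<le> q \<and> q < U w})"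
  \<comment> \<open>If \<open>q' \<le> q\<close>, then \<open>X w \<le> t\<close> gives
    \<open>U w \<le> q\<close> and \<open>t < Y w\<close> gives \<open>q < V w\<close>. Otherwise
    the mirror event is included in the same way. The bound mentions only \<open>q\<close>, which
    belongs to the fixed law \<alpha>' even when \<alpha> varies.\<close>
  proof (cases "q' \<le> q")
    case True
    then have "measure \<pi> {w\<in>space \<pi>. X w \<le> t \<and> t < Y w} \<le> measure \<pi> {w\<in>space \<pi>. U w \<le> q \<and> q < V w}"
      using X Y by (intro \<pi>.finite_measure_mono_AE) (auto elim!: AE_mp)
    then show ?thesis by simp
  next
    case False
    then have "measure \<pi> {w\<in>space \<pi>. Y w \<le> t \<and> t < X w} \<le> measure \<pi> {w\<in>space \<pi>. V w \<le> q \<and> q < U w}"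
      using X Y by (intro \<pi>.finite_measure_mono_AE) (auto elim!: AE_mp)
    then show ?thesis using eq by simp
  qed
qed

text \<open>If \<open>U\<close> and \<open>V\<close> lie on opposite sides of \<open>q\<close> and
  are closer than \<delta>, then \<open>V\<close> is near \<open>q\<close>; otherwise Markov's
  inequality for the squared distance applies. The interval is half open so that its mass is a
  difference of CDF values.\<close>

lemma measure_crossing_le:
  assumes \<pi>: "prob_space \<pi>" and [measurable]: "U \<in> borel_measurable \<pi>" "V \<in> borel_measurable \<pi>"
    and \<alpha>': "distr \<pi> borel V = \<alpha>'" and "0 < \<delta>"
  shows "max (emeasure \<pi> {w\<in>space \<pi>. U w \<le> q \<and> q < V w}) (emeasure \<pi> {w\<in>space \<pi>. V w \<le> q \<and> q < U w})
    \<le> emeasure \<alpha>' {q - \<delta><..q + \<delta>} + (\<integral>\<^sup>+w. ennreal ((U w - V w)\<^sup>2) \<partial>\<pi>) / ennreal (\<delta>\<^sup>2)"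
proof -
  have markov: "emeasure \<pi> {w\<in>space \<pi>. \<delta> \<le> \<bar>U w - V w\<bar>} \<le> (\<integral>\<^sup>+w. ennreal ((U w - V w)\<^sup>2) \<partial>\<pi>) / ennreal (\<delta>\<^sup>2)"
  proof -
    have sub: "{w\<in>space \<pi>. \<delta> \<le> \<bar>U w - V w\<bar>} \<subseteq> {w\<in>space \<pi>. 1 \<le> ennreal (1 / \<delta>\<^sup>2) * ennreal ((U w - V w)\<^sup>2)}"
    proof (clarsimp simp: ennreal_mult[symmetric] simp flip: ennreal_1)
      fix w assume "\<delta> \<le> \<bar>U w - V w\<bar>"
      then have "\<delta>\<^sup>2 \<le> (U w - V w)\<^sup>2" using \<open>0 < \<delta>\<close> by (metis abs_of_pos abs_le_square_iff)
      then show "1 \<le> (U w - V w)\<^sup>2 / \<delta>\<^sup>2" using \<open>0 < \<delta>\<close> by simp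
    qed
    have "emeasure \<pi> {w\<in>space \<pi>. \<delta> \<le> \<bar>U w - V w\<bar>} \<le> emeasure \<pi> {w\<in>space \<pi>. 1 \<le> ennreal (1 / \<delta>\<^sup>2) * ennreal ((U w - V w)\<^sup>2)}"
      by (intro emeasure_mono sub) auto
    also have "\<dots> \<le> ennreal (1 / \<delta>\<^sup>2) * (\<integral>\<^sup>+w. ennreal ((U w - V w)\<^sup>2) \<partial>\<pi>)"
      using nn_integral_Markov_inequality[of "\<lambda>w. ennreal ((U w - V w)\<^sup>2)" "space \<pi>" \<pi> "ennreal (1 / \<delta>\<^sup>2)"]
      by (auto simp: Int_def cong: nn_integral_cong)
    also have "\<dots> = (\<integral>\<^sup>+w. ennreal ((U w - V w)\<^sup>2) \<partial>\<pi>) / ennreal (\<delta>\<^sup>2)"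
      using \<open>0 < \<delta>\<close> by (simp add: divide_ennreal_def inverse_ennreal mult.commute divide_inverse)
    finally show ?thesis .
  qed
  have *: "emeasure \<alpha>' {q - \<delta><..q + \<delta>} = emeasure \<pi> {w\<in>space \<pi>. V w \<in> {q - \<delta><..q + \<delta>}}"
    unfolding \<alpha>'[symmetric] by (subst emeasure_distr) (auto intro!: arg_cong[where f="emeasure \<pi>"])
  have le: "emeasure \<pi> A \<le> emeasure \<pi> {w\<in>space \<pi>. V w \<in> {q - \<delta><..q + \<delta>}} + emeasure \<pi> {w\<in>space \<pi>. \<delta> \<le> \<bar>U w - V w\<bar>}"
    if "A \<subseteq> {w\<in>space \<pi>. V w \<in> {q - \<delta><..q + \<delta>}} \<union> {w\<in>space \<pi>. \<delta> \<le> \<bar>U w - V w\<bar>}" for A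
    by (rule order_trans[OF emeasure_mono[OF that] emeasure_subadditive]) auto
  have "max (emeasure \<pi> {w\<in>space \<pi>. U w \<le> q \<and> q < V w}) (emeasure \<pi> {w\<in>space \<pi>. V w \<le> q \<and> q < U w})
      \<le> emeasure \<pi> {w\<in>space \<pi>. V w \<in> {q - \<delta><..q + \<delta>}} + emeasure \<pi> {w\<in>space \<pi>. \<delta> \<le> \<bar>U w - V w\<bar>}"
    using \<open>0 < \<delta>\<close> by (intro max.boundedI le) auto
  also have "\<dots> \<le> emeasure \<alpha>' {q - \<delta><..q + \<delta>} + (\<integral>\<^sup>+w. ennreal ((U w - V w)\<^sup>2) \<partial>\<pi>) / ennreal (\<delta>\<^sup>2)"
    unfolding * by (intro add_left_mono markov)
  finally show ?thesis .
qed

text \<open>For each level the crossing probability tends to 0, by continuity of the limit CDF at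
  one quantile. Since the transported variables all have law \<beta>, the tails of \<beta> dominate
  uniformly in k, and dominated convergence in the level finishes.\<close>

theorem ot_map_stability:
  assumes \<beta>: "real_distribution \<beta>" "(\<integral>\<^sup>+y. ennreal \<bar>y\<bar> \<partial>\<beta>) < \<infinity>"
    and \<pi>: "\<And>k. prob_space (\<pi> k)"
    and UV[measurable]: "\<And>k. U k \<in> borel_measurable (\<pi> k)" "\<And>k. V k \<in> borel_measurable (\<pi> k)"
    and \<alpha>: "\<And>k. distr (\<pi> k) borel (U k) = \<alpha> k" "\<And>k. atomless (\<alpha> k)"
    and \<alpha>': "\<And>k. distr (\<pi> k) borel (V k) = \<alpha>'" "atomless \<alpha>'"
    and lim: "(\<lambda>k. \<integral>\<^sup>+w. ennreal ((U k w - V k w)\<^sup>2) \<partial>\<pi> k) \<longlonglongrightarrow> 0"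
  shows "(\<lambda>k. \<integral>\<^sup>+w. ennreal \<bar>ot_map (\<alpha> k) \<beta> (U k w) - ot_map \<alpha>' \<beta> (V k w)\<bar> \<partial>\<pi> k) \<longlonglongrightarrow> 0"
proof -
  interpret \<beta>: real_distribution \<beta> by fact
  interpret \<alpha>': real_distribution \<alpha>' using \<alpha>' by (auto simp: atomless_def)
  interpret \<pi>: prob_space "\<pi> k" for k by (rule \<pi>)
  have rd: "real_distribution (\<alpha> k)" "real_distribution \<alpha>'" for k using \<alpha>(2)[of k] \<alpha>' by (auto simp: atomless_def)
  note [measurable] = borel_measurable_ot_map[OF rd(1) \<beta>(1)] borel_measurable_ot_map[OF rd(2) \<beta>(1)]
  define X where "X k = (\<lambda>w. ot_map (\<alpha> k) \<beta> (U k w))" for k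
  define Y where "Y k = (\<lambda>w. ot_map \<alpha>' \<beta> (V k w))" for k
  have [measurable]: "X k \<in> borel_measurable (\<pi> k)" "Y k \<in> borel_measurable (\<pi> k)" for k by (auto simp: X_def Y_def)
  define f where "f k t = emeasure (\<pi> k) {w\<in>space (\<pi> k). X k w \<le> t \<and> t < Y k w} +
    emeasure (\<pi> k) {w\<in>space (\<pi> k). Y k w \<le> t \<and> t < X k w}" for k t
  \<comment> \<open>The tail of \<beta> beyond \<open>t\<close> on the side away from 0; its
    integral over \<open>t\<close> is the first absolute moment of \<beta>. A crossing of
    \<open>t\<close> puts one of \<open>X k\<close>, \<open>Y k\<close> in that tail, whence the
    factor 2 in \<open>f_le\<close>.\<close>
  define h where "h t = emeasure \<beta> {y\<in>space \<beta>. y \<le> t \<and> t < 0} + emeasure \<beta> {y\<in>space \<beta>. 0 \<le> t \<and> t < y}" for t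
  have "distr (\<alpha> k) borel (ot_map (\<alpha> k) \<beta>) = \<beta>" "distr \<alpha>' borel (ot_map \<alpha>' \<beta>) = \<beta>" for k
    by (intro distr_ot_map \<alpha> \<alpha>' \<beta>)+
  moreover have "distr (\<pi> k) borel (X k) = distr (distr (\<pi> k) borel (U k)) borel (ot_map (\<alpha> k) \<beta>)"
    "distr (\<pi> k) borel (Y k) = distr (distr (\<pi> k) borel (V k)) borel (ot_map \<alpha>' \<beta>)" for k
    by (simp_all add: distr_distr comp_def X_def Y_def)
  ultimately have lawXY: "distr (\<pi> k) borel (X k) = \<beta>" "distr (\<pi> k) borel (Y k) = \<beta>" for k
    by (simp_all add: \<alpha> \<alpha>')
  have X: "emeasure (\<pi> k) {w\<in>space (\<pi> k). X k w \<in> A} = emeasure \<beta> A"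
    and Y: "emeasure (\<pi> k) {w\<in>space (\<pi> k). Y k w \<in> A} = emeasure \<beta> A" if [measurable]: "A \<in> sets borel" for A k
    by (subst lawXY[of k, symmetric], subst emeasure_distr; auto intro!: arg_cong[where f="emeasure (\<pi> k)"])+
  have f_le: "f k t \<le> 2 * h t" for k t
  proof (cases "t < 0")
    case True
    have "f k t \<le> emeasure (\<pi> k) {w\<in>space (\<pi> k). X k w \<in> {..t}} + emeasure (\<pi> k) {w\<in>space (\<pi> k). Y k w \<in> {..t}}"
      unfolding f_def by (intro add_mono emeasure_mono) auto
    also have "\<dots> = 2 * h t" using True X[of "{..t}" k] Y[of "{..t}" k] by (simp add: h_def mult_2 atMost_def)
    finally show ?thesis .
  next
    case False
    have "f k t \<le> emeasure (\<pi> k) {w\<in>space (\<pi> k). Y k w \<in> {t<..}} + emeasure (\<pi> k) {w\<in>space (\<pi> k). X k w \<in> {t<..}}"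
      unfolding f_def by (intro add_mono emeasure_mono) auto
    also have "\<dots> = 2 * h t" using False X[of "{t<..}" k] Y[of "{t<..}" k] by (simp add: h_def mult_2 greaterThan_def)
    finally show ?thesis .
  qed
  have f_lim: "(\<lambda>k. f k t) \<longlonglongrightarrow> 0" for t
  proof -
    \<comment> \<open>At levels 0 and 1 there need be no quantile \<open>q\<close>, but then \<beta>
      has no mass on one side of \<open>t\<close> and crossings are null.\<close>
    consider "cdf \<beta> t = 0" | "cdf \<beta> t = 1" | "0 < cdf \<beta> t" "cdf \<beta> t < 1"
      using \<beta>.cdf_nonneg[of t] \<beta>.cdf_bounded_prob[of t] by fastforce
    then show ?thesis
    proof cases
      case 1
      have le: "f k t \<le> emeasure (\<pi> k) {w\<in>space (\<pi> k). X k w \<in> {..t}} + emeasure (\<pi> k) {w\<in>space (\<pi> k). Y k w \<in> {..t}}" for k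
        unfolding f_def by (intro add_mono emeasure_mono) auto
      have "f k t = 0" for k using le[of k] 1 X[of "{..t}" k] Y[of "{..t}" k] by (simp add: cdf_def2 \<beta>.emeasure_eq_measure)
      then show ?thesis by simp
    next
      case 2
      have m: "measure \<beta> {t<..} = 1 - cdf \<beta> t"
        using \<beta>.prob_compl[of "{..t}"] by (simp add: cdf_def2 Compl_eq_Diff_UNIV[symmetric])
      have le: "f k t \<le> emeasure (\<pi> k) {w\<in>space (\<pi> k). Y k w \<in> {t<..}} + emeasure (\<pi> k) {w\<in>space (\<pi> k). X k w \<in> {t<..}}" for k
        unfolding f_def by (intro add_mono emeasure_mono) auto
      have "f k t = 0" for k using m le[of k] 2 X[of "{t<..}" k] Y[of "{t<..}" k] by (simp add: \<beta>.emeasure_eq_measure)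
      then show ?thesis by simp
    next
      case 3
      obtain q where q: "{x. cdf \<alpha>' x \<le> cdf \<beta> t} = {..q}"
        using atomless_sublevel_cdf[OF \<alpha>'(2) 3] by metis
      define c where "c k = (\<integral>\<^sup>+w. ennreal ((U k w - V k w)\<^sup>2) \<partial>\<pi> k)" for k
      have f_c: "f k t \<le> 2 * (emeasure \<alpha>' {q - \<delta><..q + \<delta>} + c k / ennreal (\<delta>\<^sup>2))" if "0 < \<delta>" for k \<delta>
      proof -
        have max_le: "ennreal m \<le> max (ennreal a) (ennreal b)" if "m \<le> max a b" for m a b
          using that by (auto simp: le_max_iff_disj intro: ennreal_leI)
        note cr = measure_ot_map_crossing_le[OF \<beta>(1) \<pi> UV \<alpha> \<alpha>' q 3, of k]
        have "f k t = 2 * ennreal (measure (\<pi> k) {w\<in>space (\<pi> k). X k w \<le> t \<and> t < Y k w})"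
          using cr(2) by (simp add: f_def X_def Y_def \<pi>.emeasure_eq_measure mult_2)
        also have "\<dots> \<le> 2 * (max (emeasure (\<pi> k) {w\<in>space (\<pi> k). U k w \<le> q \<and> q < V k w}) (emeasure (\<pi> k) {w\<in>space (\<pi> k). V k w \<le> q \<and> q < U k w}))"
          unfolding \<pi>.emeasure_eq_measure
          by (intro mult_left_mono max_le) (use cr(1) in \<open>simp_all add: X_def Y_def\<close>)
        also have "\<dots> \<le> 2 * (emeasure \<alpha>' {q - \<delta><..q + \<delta>} + c k / ennreal (\<delta>\<^sup>2))"
          unfolding c_def by (intro mult_left_mono measure_crossing_le \<pi> UV \<alpha>' that) auto
        finally show ?thesis .
      qed
      show ?thesis
      proof (rule order_tendstoI)
        fix e :: ennreal assume "0 < e"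
        \<comment> \<open>The bound \<open>e\<close> may be infinite; a positive real
          \<open>r\<close> below it is extracted first.\<close>
        then obtain s where s: "0 < s" "s < e" using dense by blast
        then have "s \<noteq> top" by auto
        with s obtain r where r: "0 < r" "ennreal r < e" by (cases s) (auto simp: ennreal_less_zero_iff)
        \<comment> \<open>Two errors of \<open>r / 8\<close> give an interval of mass below
          \<open>r / 4\<close>; Markov's term adds another \<open>r / 4\<close>, and
          \<open>f_c\<close> doubles the sum to \<open>r\<close>.\<close>
        have "isCont (cdf \<alpha>') q" using \<alpha>'(2) by (simp add: \<alpha>'.isCont_cdf atomless_def)
        then obtain d where d: "d > 0" "\<And>x. dist x q < d \<Longrightarrow> dist (cdf \<alpha>' x) (cdf \<alpha>' q) < r / 8"
          using r by (metis continuous_at_eps_delta divide_pos_pos zero_less_numeral)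
        define \<delta> where "\<delta> = d / 2"
        have "\<delta> > 0" using d by (simp add: \<delta>_def)
        have "measure \<alpha>' {q - \<delta><..q + \<delta>} = cdf \<alpha>' (q + \<delta>) - cdf \<alpha>' (q - \<delta>)"
          using \<open>\<delta> > 0\<close> by (intro \<alpha>'.cdf_diff_eq[symmetric]) simp
        also have "\<dots> < r / 4"
          using d(2)[of "q + \<delta>"] d(2)[of "q - \<delta>"] d(1)
          by (auto simp: \<delta>_def dist_real_def abs_if split: if_splits)
        finally have m: "emeasure \<alpha>' {q - \<delta><..q + \<delta>} \<le> ennreal (r / 4)"
          by (simp add: \<alpha>'.emeasure_eq_measure ennreal_leI)
        have "(\<lambda>k. c k * inverse (ennreal (\<delta>\<^sup>2))) \<longlonglongrightarrow> 0 * inverse (ennreal (\<delta>\<^sup>2))"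
          using lim \<open>\<delta> > 0\<close> unfolding c_def by (intro tendsto_mult_ennreal tendsto_const) (auto simp: inverse_ennreal)
        then have "(\<lambda>k. c k / ennreal (\<delta>\<^sup>2)) \<longlonglongrightarrow> 0" by (simp add: divide_ennreal_def)
        then have "eventually (\<lambda>k. c k / ennreal (\<delta>\<^sup>2) < ennreal (r / 4)) sequentially"
          using r by (intro order_tendstoD(2)) auto
        then show "eventually (\<lambda>k. f k t < e) sequentially"
        proof eventually_elim
          case (elim k)
          have "f k t \<le> 2 * (ennreal (r / 4) + ennreal (r / 4))"
            using elim m by (intro order_trans[OF f_c[OF \<open>\<delta> > 0\<close>]] mult_left_mono add_mono) auto
          also have "\<dots> = ennreal (2 * (r / 4 + r / 4))"
            using r by (subst ennreal_mult, auto simp: ennreal_plus[symmetric] simp del: ennreal_plus)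
          also have "\<dots> < e" using r by simp
          finally show ?case .
        qed
      qed simp
    qed
  qed
  have "(\<lambda>k. \<integral>\<^sup>+t. f k t \<partial>lborel) \<longlonglongrightarrow> (\<integral>\<^sup>+(t::real). 0 \<partial>lborel)"
  proof (rule nn_integral_dominated_convergence[where w="\<lambda>t. 2 * h t"])
    have [measurable]: "h \<in> borel_measurable lborel" unfolding h_def by measurable
    have "(\<integral>\<^sup>+t. 2 * h t \<partial>lborel) = 2 * (\<integral>\<^sup>+t. h t \<partial>lborel)"
      by (rule nn_integral_cmult) measurable
    also have "(\<integral>\<^sup>+t. h t \<partial>lborel) = (\<integral>\<^sup>+y. ennreal \<bar>y - 0\<bar> \<partial>\<beta>)"
      unfolding h_def by (rule nn_integral_abs_diff_layer_cake[symmetric]) (auto intro: \<beta>.prob_space_axioms)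
    finally show "(\<integral>\<^sup>+t. 2 * h t \<partial>lborel) < \<infinity>"
      using \<beta>(2) by (simp add: ennreal_mult_less_top)
  qed (use f_le f_lim in \<open>auto simp: f_def h_def\<close>)
  moreover have "(\<integral>\<^sup>+w. ennreal \<bar>X k w - Y k w\<bar> \<partial>\<pi> k) = (\<integral>\<^sup>+t. f k t \<partial>lborel)" for k
    unfolding f_def by (rule nn_integral_abs_diff_layer_cake[OF \<pi>]) measurable
  ultimately show ?thesis by (simp add: X_def Y_def)
qed

section \<open>The Wasserstein metric\<close>

lemma wasserstein2D:
  assumes "\<sigma> \<in> wasserstein2"
  shows "prob_space \<sigma>" "sets \<sigma> = sets borel" "space \<sigma> = UNIV" "integrable \<sigma> (\<lambda>x. (norm x)\<^sup>2)"
  using assms sets_eq_imp_space_eq[of \<sigma> borel] by (auto simp: wasserstein2_def)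

lemma borel_measurable_fst_snd [measurable]:
  "fst \<in> (borel :: ('a::second_countable_topology \<times> 'b::second_countable_topology) measure) \<rightarrow>\<^sub>M borel"
  "snd \<in> (borel :: ('a::second_countable_topology \<times> 'b::second_countable_topology) measure) \<rightarrow>\<^sub>M borel"
  by (simp_all add: borel_prod[symmetric])

lemma couplingsD:
  assumes "\<pi> \<in> couplings \<mu> \<nu>"
  shows "sets \<pi> = sets borel" "distr \<pi> borel fst = \<mu>" "distr \<pi> borel snd = \<nu>"
    "fst \<in> \<pi> \<rightarrow>\<^sub>M borel" "snd \<in> \<pi> \<rightarrow>\<^sub>M borel" "space \<pi> = UNIV"
  using assms sets_eq_imp_space_eq[of \<pi> borel] measurable_cong_sets[of \<pi> borel borel borel]
  by (auto simp: couplings_def intro: borel_measurable_fst_snd)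

lemma couplings_prob_space:
  assumes "\<pi> \<in> couplings \<mu> \<nu>" "prob_space \<mu>"
  shows "prob_space \<pi>"
  using assms(2) prob_space_distrD[of fst \<pi> borel] couplingsD[OF assms(1)] by simp

lemma couplings_swap:
  assumes "\<pi> \<in> couplings \<mu> \<nu>"
  shows "distr \<pi> borel prod.swap \<in> couplings \<nu> \<mu>"
proof -
  note [measurable] = couplingsD(4,5)[OF assms]
  have "prod.swap \<in> \<pi> \<rightarrow>\<^sub>M borel \<Otimes>\<^sub>M borel" unfolding prod.swap_def by measurable
  then have [measurable]: "prod.swap \<in> \<pi> \<rightarrow>\<^sub>M borel" by (simp add: borel_prod)
  show ?thesis using couplingsD[OF assms]
    by (auto simp: couplings_def distr_distr comp_def)
qed

section \<open>Symmetry, finiteness and near-optimal couplings\<close>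

lemma W2_nonneg: "0 \<le> W2 \<mu> \<nu>"
  by (simp add: W2_def)

lemma W2_commute: "W2 \<mu> \<nu> = W2 \<nu> \<mu>"
proof -
  have "(INF \<pi>\<in>couplings \<nu> \<mu>. \<integral>\<^sup>+ p. ennreal ((dist (fst p) (snd p))\<^sup>2) \<partial>\<pi>)
      \<le> (INF \<pi>\<in>couplings \<mu> \<nu>. \<integral>\<^sup>+ p. ennreal ((dist (fst p) (snd p))\<^sup>2) \<partial>\<pi>)" for \<mu> \<nu> :: "'a measure"
  proof (rule INF_greatest)
    fix \<pi> assume \<pi>: "\<pi> \<in> couplings \<mu> \<nu>"
    note [measurable] = couplingsD(4,5)[OF \<pi>]
    have "prod.swap \<in> \<pi> \<rightarrow>\<^sub>M borel \<Otimes>\<^sub>M borel" unfolding prod.swap_def by measurable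
    then have [measurable]: "prod.swap \<in> \<pi> \<rightarrow>\<^sub>M borel" by (simp add: borel_prod)
    have "(\<integral>\<^sup>+ p. ennreal ((dist (fst p) (snd p))\<^sup>2) \<partial>distr \<pi> borel prod.swap) = (\<integral>\<^sup>+ p. ennreal ((dist (fst p) (snd p))\<^sup>2) \<partial>\<pi>)"
      by (subst nn_integral_distr) (auto simp: dist_commute)
    with couplings_swap[OF \<pi>]
    show "(INF \<pi>\<in>couplings \<nu> \<mu>. \<integral>\<^sup>+ p. ennreal ((dist (fst p) (snd p))\<^sup>2) \<partial>\<pi>) \<le> (\<integral>\<^sup>+ p. ennreal ((dist (fst p) (snd p))\<^sup>2) \<partial>\<pi>)"
      by (metis (lifting) INF_lower)
  qed
  then show ?thesis unfolding W2_def by (intro arg_cong[where f=sqrt] arg_cong[where f=enn2real] antisym)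
qed

lemma W2_le:
  assumes "\<pi> \<in> couplings \<mu> \<nu>" "(\<integral>\<^sup>+ p. ennreal ((dist (fst p) (snd p))\<^sup>2) \<partial>\<pi>) \<le> ennreal (c\<^sup>2)" "0 \<le> c"
  shows "W2 \<mu> \<nu> \<le> c"
proof -
  have "(INF \<pi>\<in>couplings \<mu> \<nu>. \<integral>\<^sup>+ p. ennreal ((dist (fst p) (snd p))\<^sup>2) \<partial>\<pi>) \<le> ennreal (c\<^sup>2)"
    using assms(1,2) by (rule INF_lower2)
  then have "enn2real (INF \<pi>\<in>couplings \<mu> \<nu>. \<integral>\<^sup>+ p. ennreal ((dist (fst p) (snd p))\<^sup>2) \<partial>\<pi>) \<le> c\<^sup>2"
    by (intro enn2real_leI) auto
  then show ?thesis unfolding W2_def using assms(3) by (simp add: real_le_lsqrt)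
qed

text \<open>The product coupling shows that the infimum defining \<open>W2\<close> is finite, so
  \<open>enn2real\<close> loses nothing on \<open>wasserstein2\<close>.\<close>

lemma pair_measure_in_couplings:
  assumes "\<mu> \<in> wasserstein2" "\<nu> \<in> wasserstein2"
  shows "\<mu> \<Otimes>\<^sub>M \<nu> \<in> couplings \<mu> \<nu>"
    and "(\<integral>\<^sup>+ p. ennreal ((dist (fst p) (snd p))\<^sup>2) \<partial>(\<mu> \<Otimes>\<^sub>M \<nu>)) < \<infinity>"
proof -
  interpret \<mu>: prob_space \<mu> using wasserstein2D[OF assms(1)] by simp
  interpret \<nu>: prob_space \<nu> using wasserstein2D[OF assms(2)] by simp
  interpret pair_prob_space \<mu> \<nu> ..
  note sets[measurable_cong] = wasserstein2D(2)[OF assms(1)] wasserstein2D(2)[OF assms(2)]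
  have s: "sets (\<mu> \<Otimes>\<^sub>M \<nu>) = sets borel"
    using sets_pair_measure_cong[OF sets] by (simp only: borel_prod)
  have "distr (\<mu> \<Otimes>\<^sub>M \<nu>) borel fst = distr (\<mu> \<Otimes>\<^sub>M \<nu>) \<mu> fst" "distr (\<mu> \<Otimes>\<^sub>M \<nu>) borel snd = distr (\<mu> \<Otimes>\<^sub>M \<nu>) \<nu> snd"
    by (auto intro!: distr_cong simp: sets)
  moreover have "distr (\<mu> \<Otimes>\<^sub>M \<nu>) \<mu> fst = \<mu>"
    by (simp add: \<nu>.distr_pair_fst)
  moreover have "distr (\<mu> \<Otimes>\<^sub>M \<nu>) \<nu> snd = \<nu>"
  proof (rule measure_eqI)
    fix A assume "A \<in> sets (distr (\<mu> \<Otimes>\<^sub>M \<nu>) \<nu> snd)"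
    then have [measurable]: "A \<in> sets \<nu>" by simp
    have "snd -` A \<inter> space (\<mu> \<Otimes>\<^sub>M \<nu>) = space \<mu> \<times> A"
      using sets.sets_into_space[of A \<nu>] by (auto simp: space_pair_measure)
    then show "emeasure (distr (\<mu> \<Otimes>\<^sub>M \<nu>) \<nu> snd) A = emeasure \<nu> A"
      by (simp add: emeasure_distr \<nu>.emeasure_pair_measure_Times \<mu>.emeasure_space_1)
  qed simp
  ultimately show "\<mu> \<Otimes>\<^sub>M \<nu> \<in> couplings \<mu> \<nu>"
    using s by (simp add: couplings_def)
  have "(\<integral>\<^sup>+ p. ennreal ((dist (fst p) (snd p))\<^sup>2) \<partial>(\<mu> \<Otimes>\<^sub>M \<nu>)) \<le> (\<integral>\<^sup>+ p. 2 * ennreal ((norm (fst p))\<^sup>2) + 2 * ennreal ((norm (snd p))\<^sup>2) \<partial>(\<mu> \<Otimes>\<^sub>M \<nu>))"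
  proof (rule nn_integral_mono)
    fix p :: "'a \<times> 'a"
    have "(dist (fst p) (snd p))\<^sup>2 \<le> (norm (fst p) + norm (snd p))\<^sup>2"
      by (intro power_mono) (auto simp: dist_norm norm_triangle_ineq4)
    also have "\<dots> \<le> 2 * (norm (fst p))\<^sup>2 + 2 * (norm (snd p))\<^sup>2"
      using sum_squares_bound[of "norm (fst p)" "norm (snd p)"] by (simp add: power2_sum)
    finally show "ennreal ((dist (fst p) (snd p))\<^sup>2) \<le> 2 * ennreal ((norm (fst p))\<^sup>2) + 2 * ennreal ((norm (snd p))\<^sup>2)"
      by (simp add: ennreal_leI flip: ennreal_plus ennreal_mult' ennreal_numeral)
  qed
  also have "\<dots> = 2 * (\<integral>\<^sup>+ p. ennreal ((norm (fst p))\<^sup>2) \<partial>(\<mu> \<Otimes>\<^sub>M \<nu>)) + 2 * (\<integral>\<^sup>+ p. ennreal ((norm (snd p))\<^sup>2) \<partial>(\<mu> \<Otimes>\<^sub>M \<nu>))"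
    by (simp add: nn_integral_add nn_integral_cmult)
  also have "(\<integral>\<^sup>+ p. ennreal ((norm (fst p))\<^sup>2) \<partial>(\<mu> \<Otimes>\<^sub>M \<nu>)) = (\<integral>\<^sup>+ x. ennreal ((norm x)\<^sup>2) \<partial>\<mu>)"
    by (subst \<nu>.nn_integral_fst[symmetric]) (auto simp: \<nu>.emeasure_space_1)
  also have "(\<integral>\<^sup>+ p. ennreal ((norm (snd p))\<^sup>2) \<partial>(\<mu> \<Otimes>\<^sub>M \<nu>)) = (\<integral>\<^sup>+ x. ennreal ((norm x)\<^sup>2) \<partial>\<nu>)"
    by (subst nn_integral_snd[symmetric]) (auto simp: \<mu>.emeasure_space_1)
  also have "2 * (\<integral>\<^sup>+ x. ennreal ((norm x)\<^sup>2) \<partial>\<mu>) + 2 * (\<integral>\<^sup>+ x. ennreal ((norm x)\<^sup>2) \<partial>\<nu>) < \<infinity>"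
    using wasserstein2D(4)[OF assms(1)] wasserstein2D(4)[OF assms(2)]
    by (auto simp: integrable_iff_bounded ennreal_mult_less_top)
  finally show "(\<integral>\<^sup>+ p. ennreal ((dist (fst p) (snd p))\<^sup>2) \<partial>(\<mu> \<Otimes>\<^sub>M \<nu>)) < \<infinity>" .
qed

lemma W2_less_imp_coupling:
  assumes "\<mu> \<in> wasserstein2" "\<nu> \<in> wasserstein2" "W2 \<mu> \<nu> < c"
  obtains \<pi> where "\<pi> \<in> couplings \<mu> \<nu>" "(\<integral>\<^sup>+ p. ennreal ((dist (fst p) (snd p))\<^sup>2) \<partial>\<pi>) < ennreal (c\<^sup>2)"
proof -
  let ?I = "INF \<pi>\<in>couplings \<mu> \<nu>. \<integral>\<^sup>+ p. ennreal ((dist (fst p) (snd p))\<^sup>2) \<partial>\<pi>"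
  have "0 < c" using W2_nonneg[of \<mu> \<nu>] assms(3) by linarith
  have "?I < top"
    using pair_measure_in_couplings[OF assms(1,2)] by (auto simp: INF_less_iff)
  then have "?I = ennreal ((W2 \<mu> \<nu>)\<^sup>2)" by (simp add: W2_def)
  also have "\<dots> < ennreal (c\<^sup>2)"
    using assms(3) \<open>0 < c\<close> W2_nonneg[of \<mu> \<nu>] by (intro ennreal_lessI power_strict_mono) auto
  finally show ?thesis using that unfolding INF_less_iff by blast
qed

lemma W2_self: "\<mu> \<in> wasserstein2 \<Longrightarrow> W2 \<mu> \<mu> = 0"
proof -
  assume \<mu>: "\<mu> \<in> wasserstein2"
  note [measurable_cong] = wasserstein2D(2)[OF \<mu>]
  have [measurable]: "(\<lambda>x. (x, x)) \<in> \<mu> \<rightarrow>\<^sub>M borel"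
    by (simp add: borel_prod[symmetric])
  have "distr \<mu> borel (\<lambda>x. (x, x)) \<in> couplings \<mu> \<mu>"
    using wasserstein2D[OF \<mu>] by (simp add: couplings_def distr_distr comp_def distr_id2)
  then have "W2 \<mu> \<mu> \<le> 0"
    by (rule W2_le) (auto simp: nn_integral_distr)
  then show ?thesis using W2_nonneg[of \<mu> \<mu>] by linarith
qed

text \<open>A coupling of tiny cost moves almost all mass of \<open>C\<close> into its closed
  d-neighbourhood. Letting first the error and then d tend to 0 recovers \<open>C\<close>, because
  \<open>C\<close> is closed.\<close>

lemma W2_zero_imp_closed_le:
  assumes \<mu>: "\<mu> \<in> wasserstein2" and \<nu>: "\<nu> \<in> wasserstein2" and "W2 \<mu> \<nu> = 0" and C: "closed C" "C \<noteq> {}"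
  shows "measure \<mu> C \<le> measure \<nu> C"
proof -
  interpret \<mu>: prob_space \<mu> using wasserstein2D[OF \<mu>] by simp
  interpret \<nu>: prob_space \<nu> using wasserstein2D[OF \<nu>] by simp
  note [measurable_cong] = wasserstein2D(2)[OF \<mu>] wasserstein2D(2)[OF \<nu>]
  have [measurable]: "C \<in> sets borel" using C by auto
  have [measurable]: "{y. infdist y C \<le> d} \<in> sets borel" for d
    by (intro borel_closed closed_Collect_le continuous_intros)
  have *: "measure \<mu> C \<le> measure \<nu> {y. infdist y C \<le> d} + e" if d: "0 < d" and e: "0 < e" for d e
  proof -
    \<comment> \<open>Chosen so that Markov's bound, the square of \<open>c / d\<close>, is exactly
      \<open>e\<close>.\<close>
    define c where "c = sqrt e * d"
    have "W2 \<mu> \<nu> < c" using d e assms(3) by (simp add: c_def)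
    from W2_less_imp_coupling[OF \<mu> \<nu> this] obtain \<pi> where \<pi>: "\<pi> \<in> couplings \<mu> \<nu>"
      and cost: "(\<integral>\<^sup>+ p. ennreal ((dist (fst p) (snd p))\<^sup>2) \<partial>\<pi>) < ennreal (c\<^sup>2)" by blast
    interpret \<pi>: prob_space \<pi> using couplings_prob_space[OF \<pi>] \<mu>.prob_space_axioms by simp
    note [measurable] = couplingsD(4,5)[OF \<pi>]
    have "{p\<in>space \<pi>. d \<le> dist (fst p) (snd p)} \<subseteq> {p\<in>space \<pi>. 1 \<le> ennreal (1 / d\<^sup>2) * ennreal ((dist (fst p) (snd p))\<^sup>2)}"
    proof (clarsimp simp: ennreal_mult[symmetric] simp flip: ennreal_1)
      fix x y :: 'a assume "d \<le> dist x y"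
      then have "d\<^sup>2 \<le> (dist x y)\<^sup>2" using d by (intro power_mono) auto
      then show "1 \<le> (dist x y)\<^sup>2 / d\<^sup>2" using d by simp
    qed
    then have "emeasure \<pi> {p\<in>space \<pi>. d \<le> dist (fst p) (snd p)} \<le> emeasure \<pi> {p\<in>space \<pi>. 1 \<le> ennreal (1 / d\<^sup>2) * ennreal ((dist (fst p) (snd p))\<^sup>2)}"
      by (intro emeasure_mono) auto
    also have "\<dots> \<le> ennreal (1 / d\<^sup>2) * (\<integral>\<^sup>+ p. ennreal ((dist (fst p) (snd p))\<^sup>2) \<partial>\<pi>)"
      using nn_integral_Markov_inequality[of "\<lambda>p. ennreal ((dist (fst p) (snd p))\<^sup>2)" "space \<pi>" \<pi> "ennreal (1 / d\<^sup>2)"]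
      by (auto simp: Int_def cong: nn_integral_cong)
    also have "\<dots> \<le> ennreal (1 / d\<^sup>2) * ennreal (c\<^sup>2)"
      using cost by (intro mult_left_mono) auto
    also have "\<dots> = ennreal e"
      using d e by (simp add: ennreal_mult[symmetric] c_def power_mult_distrib)
    finally have m: "measure \<pi> {p\<in>space \<pi>. d \<le> dist (fst p) (snd p)} \<le> e"
      using e by (simp add: \<pi>.emeasure_eq_measure)
    have sub: "{p\<in>space \<pi>. fst p \<in> C} \<subseteq> {p\<in>space \<pi>. snd p \<in> {y. infdist y C \<le> d}} \<union> {p\<in>space \<pi>. d \<le> dist (fst p) (snd p)}"
      using C by (auto simp: not_le dist_commute dest: infdist_le intro: order_trans[OF infdist_le] less_imp_le)
    have "measure \<mu> C = measure \<pi> {p\<in>space \<pi>. fst p \<in> C}"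
      by (subst couplingsD(2)[OF \<pi>, symmetric], subst measure_distr) (auto intro!: arg_cong[where f="measure \<pi>"])
    also have "\<dots> \<le> measure \<pi> {p\<in>space \<pi>. snd p \<in> {y. infdist y C \<le> d}} + measure \<pi> {p\<in>space \<pi>. d \<le> dist (fst p) (snd p)}"
      by (rule order_trans[OF \<pi>.finite_measure_mono[OF sub] measure_Un_le]) measurable
    also have "measure \<pi> {p\<in>space \<pi>. snd p \<in> {y. infdist y C \<le> d}} = measure \<nu> {y. infdist y C \<le> d}"
      by (subst couplingsD(3)[OF \<pi>, symmetric], subst measure_distr) (auto intro!: arg_cong[where f="measure \<pi>"])
    finally show ?thesis using m by linarith
  qed
  have le: "measure \<mu> C \<le> measure \<nu> {y. infdist y C \<le> d}" if "0 < d" for d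
    by (rule field_le_epsilon, rule *[OF that])
  have "(\<lambda>n. measure \<nu> {y. infdist y C \<le> 1 / real (Suc n)}) \<longlonglongrightarrow> measure \<nu> (\<Inter>n. {y. infdist y C \<le> 1 / real (Suc n)})"
  proof (rule \<nu>.finite_Lim_measure_decseq)
    have "1 / real (Suc n) \<le> 1 / real (Suc m)" if "m \<le> n" for m n
      using that by (simp add: field_simps)
    then show "decseq (\<lambda>n. {y. infdist y C \<le> 1 / real (Suc n)})"
      by (auto simp: decseq_def intro: order_trans)
  qed auto
  moreover have "(\<Inter>n. {y. infdist y C \<le> 1 / real (Suc n)}) = C"
  proof (intro equalityI subsetI)
    fix y assume y: "y \<in> (\<Inter>n. {y. infdist y C \<le> 1 / real (Suc n)})"
    have "infdist y C \<le> 0"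
    proof (rule ccontr)
      assume "\<not> infdist y C \<le> 0"
      then obtain n where "inverse (of_nat (Suc n)) < infdist y C" using reals_Archimedean[of "infdist y C"] by auto
      moreover have "infdist y C \<le> 1 / real (Suc n)" using y by blast
      ultimately show False by (simp add: inverse_eq_divide)
    qed
    then show "y \<in> C" using C in_closed_iff_infdist_zero[OF C, of y] infdist_nonneg[of y C] by auto
  qed auto
  ultimately show ?thesis
    using le by (intro LIMSEQ_le_const) auto
qed

lemma W2_zero_imp_eq:
  assumes \<mu>: "\<mu> \<in> wasserstein2" and \<nu>: "\<nu> \<in> wasserstein2" and "W2 \<mu> \<nu> = 0"
  shows "\<mu> = \<nu>"
proof -
  interpret \<mu>: prob_space \<mu> using wasserstein2D[OF \<mu>] by simp
  interpret \<nu>: prob_space \<nu> using wasserstein2D[OF \<nu>] by simp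
  show ?thesis
  proof (rule measure_eqI_generator_eq[where E="Collect closed" and \<Omega>=UNIV and A="\<lambda>_. UNIV"])
    fix C :: "'a set" assume "C \<in> Collect closed"
    then show "emeasure \<mu> C = emeasure \<nu> C"
      using W2_zero_imp_closed_le[OF \<mu> \<nu>] W2_zero_imp_closed_le[OF \<nu> \<mu>] assms(3) W2_commute[of \<mu> \<nu>]
      by (cases "C = {}") (auto simp: \<mu>.emeasure_eq_measure \<nu>.emeasure_eq_measure intro: antisym)
  qed (use wasserstein2D[OF \<mu>] wasserstein2D[OF \<nu>] in \<open>auto simp: Int_stable_def borel_eq_closed\<close>)
qed

subsection \<open>Gluing couplings\<close>

text \<open>The label of a point is the first member of a dense sequence within half of \<delta>, so
  points with equal labels are closer than \<delta>.\<close>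

lemma ex_countable_partition_small:
  assumes "0 < \<delta>"
  obtains c :: "'a::{metric_space, second_countable_topology} \<Rightarrow> nat"
  where "c \<in> borel \<rightarrow>\<^sub>M count_space UNIV" "\<And>x y. c x = c y \<Longrightarrow> dist x y < \<delta>"
proof -
  obtain D :: "'a set" where D: "countable D" "\<And>X. open X \<Longrightarrow> X \<noteq> {} \<Longrightarrow> \<exists>d\<in>D. d \<in> X"
    by (rule countable_dense_setE) blast
  have "D \<noteq> {}" using D(2)[of UNIV] by auto
  define d where "d = from_nat_into D"
  define c where "c x = (LEAST n. dist x (d n) < \<delta> / 2)" for x
  have near: "dist x (d (c x)) < \<delta> / 2" for x
  proof -
    obtain y where "y \<in> D" "y \<in> ball x (\<delta> / 2)" using D(2)[of "ball x (\<delta> / 2)"] assms by auto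
    then have "\<exists>n. dist x (d n) < \<delta> / 2" by (metis D(1) d_def from_nat_into_surj mem_ball)
    then show ?thesis unfolding c_def by (rule LeastI_ex)
  qed
  have "c \<in> borel \<rightarrow>\<^sub>M count_space UNIV" unfolding c_def by measurable
  moreover have "dist x y < \<delta>" if "c x = c y" for x y
    using near[of x] near[of y] that dist_triangle_half_r[of "d (c x)" x \<delta> y] by (simp add: dist_commute)
  ultimately show ?thesis using that by blast
qed

text \<open>Two couplings with common marginal \<open>\<nu>\<close> are glued without disintegration: their product is
  conditioned on the two middle coordinates lying in the same cell of a fine countable partition,
  which is achieved by the density \<open>f\<close>.\<close>

lemma glue_couplings:
  fixes \<mu> \<nu> \<rho> :: "'a::euclidean_space measure"
  assumes \<mu>: "\<mu> \<in> wasserstein2" and \<nu>: "\<nu> \<in> wasserstein2" and \<rho>: "\<rho> \<in> wasserstein2"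
    and \<pi>1: "\<pi>1 \<in> couplings \<mu> \<nu>" and \<pi>2: "\<pi>2 \<in> couplings \<nu> \<rho>"
    and cost1: "(\<integral>\<^sup>+ p. ennreal ((dist (fst p) (snd p))\<^sup>2) \<partial>\<pi>1) \<le> ennreal (a\<^sup>2)" "0 < a"
    and cost2: "(\<integral>\<^sup>+ p. ennreal ((dist (fst p) (snd p))\<^sup>2) \<partial>\<pi>2) \<le> ennreal (b\<^sup>2)" "0 < b"
    and \<delta>: "0 < \<delta>"
  shows "W2 \<mu> \<rho> \<le> a + b + \<delta>"
proof -
  interpret \<nu>: prob_space \<nu> using wasserstein2D[OF \<nu>] by simp
  interpret \<pi>1: prob_space \<pi>1 using couplings_prob_space[OF \<pi>1] wasserstein2D[OF \<mu>] by simp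
  interpret \<pi>2: prob_space \<pi>2 using couplings_prob_space[OF \<pi>2] wasserstein2D[OF \<nu>] by simp
  interpret pair_sigma_finite \<pi>1 \<pi>2 ..
  note [measurable_cong] = wasserstein2D(2)[OF \<nu>] couplingsD(1)[OF \<pi>1] couplingsD(1)[OF \<pi>2]
  obtain c :: "'a \<Rightarrow> nat" where c[measurable]: "c \<in> borel \<rightarrow>\<^sub>M count_space UNIV"
    and small: "\<And>x y. c x = c y \<Longrightarrow> dist x y < \<delta>" using ex_countable_partition_small[OF \<delta>] by metis
  define g where "g n = inverse (emeasure \<nu> {y. c y = n})" for n
  define f where "f y y' = (if c y = c y' then g (c y) else 0)" for y y'
  have [measurable]: "{y. c y = n} \<in> sets borel" for n
    using measurable_sets[OF c, of "{n}"] by (simp add: vimage_def)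
  have [measurable]: "g \<in> count_space UNIV \<rightarrow>\<^sub>M borel" by simp
  \<comment> \<open>A real-valued copy of the label, for which the set of pairs with equal labels is
    measurable as a comparison of Borel functions.\<close>
  define cr where "cr y = real (c y)" for y
  have [measurable]: "cr \<in> borel \<rightarrow>\<^sub>M borel"
    unfolding cr_def by (rule measurable_compose[OF c]) simp
  have "Measurable.pred (borel \<Otimes>\<^sub>M borel) (\<lambda>p :: 'a \<times> 'a. cr (fst p) = cr (snd p))"
    by measurable
  then have P: "{p \<in> space (borel \<Otimes>\<^sub>M borel :: ('a \<times> 'a) measure). c (fst p) = c (snd p)} \<in> sets (borel \<Otimes>\<^sub>M borel)"
    by (simp add: pred_def cr_def)
  have f[measurable]: "(\<lambda>(y, y'). f y y') \<in> borel_measurable (borel \<Otimes>\<^sub>M borel)"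
    unfolding f_def split_beta' by (intro measurable_If[OF _ _ P] measurable_const measurable_compose[OF measurable_fst]
      measurable_compose[OF c]) simp_all
  have f_commute: "f y y' = f y' y" for y y' by (simp add: f_def)
  \<comment> \<open>On a cell of mass zero the inverse \<open>g\<close> is infinite, but countably
    many such cells form a null set.\<close>
  have f_1: "AE y in \<nu>. (\<integral>\<^sup>+y'. f y y' \<partial>\<nu>) = 1"
  proof -
    have "AE y in \<nu>. \<not> (emeasure \<nu> {y. c y = n} = 0 \<and> c y = n)" for n
    proof (cases "emeasure \<nu> {y. c y = n} = 0")
      case True
      then have "{y. c y = n} \<in> null_sets \<nu>" by (auto intro!: null_setsI)
      then show ?thesis by (rule AE_I') (use True in auto)
    qed auto
    then have "AE y in \<nu>. \<forall>n. \<not> (emeasure \<nu> {y. c y = n} = 0 \<and> c y = n)" by (simp add: AE_all_countable)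
    then show ?thesis
    proof eventually_elim
      case (elim y)
      have "(\<integral>\<^sup>+y'. f y y' \<partial>\<nu>) = (\<integral>\<^sup>+y'. g (c y) * indicator {y'. c y' = c y} y' \<partial>\<nu>)"
        by (intro nn_integral_cong) (auto simp: f_def)
      also have "\<dots> = g (c y) * emeasure \<nu> {y'. c y' = c y}"
        by (rule nn_integral_cmult_indicator) measurable
      also have "\<dots> = 1"
        using elim ennreal_divide_self[of "emeasure \<nu> {y'. c y' = c y}"]
        by (auto simp: g_def divide_ennreal_def mult.commute less_top[symmetric])
      finally show ?case .
    qed
  qed
  \<comment> \<open>By \<open>f_1\<close> the density integrates to 1 against either factor, so
    \<open>G\<close> retains \<open>\<pi>1\<close> and \<open>\<pi>2\<close> as marginals; this is
    \<open>int1\<close> and \<open>int2\<close>.\<close>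
  define G where "G = density (\<pi>1 \<Otimes>\<^sub>M \<pi>2) (\<lambda>r. f (snd (fst r)) (fst (snd r)))"
  have [measurable_cong]: "sets G = sets (\<pi>1 \<Otimes>\<^sub>M \<pi>2)" by (simp add: G_def)
  note [measurable] = couplingsD(4,5)[OF \<pi>1] couplingsD(4,5)[OF \<pi>2]
  have int1: "(\<integral>\<^sup>+r. h (fst r) \<partial>G) = (\<integral>\<^sup>+p. h p \<partial>\<pi>1)" if [measurable]: "h \<in> borel_measurable \<pi>1" for h
  proof -
    have "AE p in \<pi>1. (\<integral>\<^sup>+y'. f (snd p) y' \<partial>\<nu>) = 1"
      using f_1 unfolding couplingsD(3)[OF \<pi>1, symmetric] by (rule AE_distrD[rotated]) simp
    moreover have "(\<integral>\<^sup>+y'. f y y' \<partial>\<nu>) = (\<integral>\<^sup>+q. f y (fst q) \<partial>\<pi>2)" for y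
      by (subst couplingsD(2)[OF \<pi>2, symmetric]) (simp add: nn_integral_distr)
    ultimately have *: "AE p in \<pi>1. (\<integral>\<^sup>+q. f (snd p) (fst q) \<partial>\<pi>2) = 1" by simp
    have "(\<integral>\<^sup>+r. h (fst r) \<partial>G) = (\<integral>\<^sup>+r. h (fst r) * f (snd (fst r)) (fst (snd r)) \<partial>(\<pi>1 \<Otimes>\<^sub>M \<pi>2))"
      unfolding G_def by (subst nn_integral_density) (auto simp: mult.commute)
    also have "\<dots> = (\<integral>\<^sup>+p. \<integral>\<^sup>+q. h p * f (snd p) (fst q) \<partial>\<pi>2 \<partial>\<pi>1)"
      by (subst \<pi>2.nn_integral_fst[symmetric]) auto
    also have "\<dots> = (\<integral>\<^sup>+p. h p * (\<integral>\<^sup>+q. f (snd p) (fst q) \<partial>\<pi>2) \<partial>\<pi>1)"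
      by (intro nn_integral_cong nn_integral_cmult) measurable
    also have "\<dots> = (\<integral>\<^sup>+p. h p \<partial>\<pi>1)"
      using * by (intro nn_integral_cong_AE) auto
    finally show ?thesis .
  qed
  have int2: "(\<integral>\<^sup>+r. h (snd r) \<partial>G) = (\<integral>\<^sup>+q. h q \<partial>\<pi>2)" if [measurable]: "h \<in> borel_measurable \<pi>2" for h
  proof -
    have "AE q in \<pi>2. (\<integral>\<^sup>+y. f (fst q) y \<partial>\<nu>) = 1"
      using f_1 unfolding couplingsD(2)[OF \<pi>2, symmetric] by (rule AE_distrD[rotated]) simp
    moreover have "(\<integral>\<^sup>+y. f y' y \<partial>\<nu>) = (\<integral>\<^sup>+p. f (snd p) y' \<partial>\<pi>1)" for y'
      by (subst couplingsD(3)[OF \<pi>1, symmetric]) (simp add: nn_integral_distr f_commute)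
    ultimately have *: "AE q in \<pi>2. (\<integral>\<^sup>+p. f (snd p) (fst q) \<partial>\<pi>1) = 1" by simp
    have "(\<integral>\<^sup>+r. h (snd r) \<partial>G) = (\<integral>\<^sup>+r. h (snd r) * f (snd (fst r)) (fst (snd r)) \<partial>(\<pi>1 \<Otimes>\<^sub>M \<pi>2))"
      unfolding G_def by (subst nn_integral_density) (auto simp: mult.commute)
    also have "\<dots> = (\<integral>\<^sup>+q. \<integral>\<^sup>+p. h q * f (snd p) (fst q) \<partial>\<pi>1 \<partial>\<pi>2)"
      by (subst nn_integral_snd[symmetric]) auto
    also have "\<dots> = (\<integral>\<^sup>+q. h q * (\<integral>\<^sup>+p. f (snd p) (fst q) \<partial>\<pi>1) \<partial>\<pi>2)"
      by (intro nn_integral_cong nn_integral_cmult) measurable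
    also have "\<dots> = (\<integral>\<^sup>+q. h q \<partial>\<pi>2)"
      using * by (intro nn_integral_cong_AE) auto
    finally show ?thesis .
  qed
  have AE_close: "AE r in G. dist (snd (fst r)) (fst (snd r)) < \<delta>"
  proof -
    have F: "(\<lambda>r. f (snd (fst r)) (fst (snd r))) \<in> borel_measurable (\<pi>1 \<Otimes>\<^sub>M \<pi>2)" by measurable
    show ?thesis unfolding G_def AE_density[OF F] by (auto simp: f_def small)
  qed
  have "(\<lambda>r. (fst (fst r), snd (snd r))) \<in> G \<rightarrow>\<^sub>M borel \<Otimes>\<^sub>M borel" by measurable
  then have [measurable]: "(\<lambda>r. (fst (fst r), snd (snd r))) \<in> G \<rightarrow>\<^sub>M borel" by (simp add: borel_prod)
  define \<pi> where "\<pi> = distr G borel (\<lambda>r. (fst (fst r), snd (snd r)))"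
  have "distr G borel (\<lambda>r. fst (fst r)) = \<mu>"
  proof (rule measure_eqI)
    fix A assume "A \<in> sets (distr G borel (\<lambda>r. fst (fst r)))"
    then have [measurable]: "A \<in> sets borel" by simp
    have "emeasure (distr G borel (\<lambda>r. fst (fst r))) A = (\<integral>\<^sup>+r. indicator A (fst (fst r)) \<partial>G)"
      by (subst nn_integral_indicator[symmetric], simp, subst nn_integral_distr) auto
    also have "\<dots> = (\<integral>\<^sup>+p. indicator A (fst p) \<partial>\<pi>1)" by (rule int1) measurable
    also have "\<dots> = emeasure (distr \<pi>1 borel fst) A"
      by (subst nn_integral_indicator[symmetric], simp, subst nn_integral_distr) auto
    finally show "emeasure (distr G borel (\<lambda>r. fst (fst r))) A = emeasure \<mu> A"
      by (simp add: couplingsD[OF \<pi>1])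
  qed (simp add: wasserstein2D[OF \<mu>])
  moreover have "distr G borel (\<lambda>r. snd (snd r)) = \<rho>"
  proof (rule measure_eqI)
    fix A assume "A \<in> sets (distr G borel (\<lambda>r. snd (snd r)))"
    then have [measurable]: "A \<in> sets borel" by simp
    have "emeasure (distr G borel (\<lambda>r. snd (snd r))) A = (\<integral>\<^sup>+r. indicator A (snd (snd r)) \<partial>G)"
      by (subst nn_integral_indicator[symmetric], simp, subst nn_integral_distr) auto
    also have "\<dots> = (\<integral>\<^sup>+p. indicator A (snd p) \<partial>\<pi>2)" by (rule int2) measurable
    also have "\<dots> = emeasure (distr \<pi>2 borel snd) A"
      by (subst nn_integral_indicator[symmetric], simp, subst nn_integral_distr) auto
    finally show "emeasure (distr G borel (\<lambda>r. snd (snd r))) A = emeasure \<rho> A"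
      by (simp add: couplingsD[OF \<pi>2])
  qed (simp add: wasserstein2D[OF \<rho>])
  ultimately have \<pi>: "\<pi> \<in> couplings \<mu> \<rho>"
    by (simp add: couplings_def \<pi>_def distr_distr comp_def)
  let ?A = "\<lambda>r. dist (fst (fst r)) (snd (fst r))" and ?B = "\<lambda>r. dist (fst (snd r)) (snd (snd r))"
  let ?s = "a + b + \<delta>"
  have "(\<integral>\<^sup>+ p. ennreal ((dist (fst p) (snd p))\<^sup>2) \<partial>\<pi>) = (\<integral>\<^sup>+ r. ennreal ((dist (fst (fst r)) (snd (snd r)))\<^sup>2) \<partial>G)"
    unfolding \<pi>_def by (subst nn_integral_distr) auto
  \<comment> \<open>Weighted Cauchy-Schwarz with weights a, b and \<delta> summing to
    \<open>?s\<close>: the defect is a sum of squares. Inserting the costs \<open>a\<^sup>2\<close>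
    and \<open>b\<^sup>2\<close> then returns exactly \<open>?s\<^sup>2\<close>, so distances add
    without loss.\<close>
  also have "\<dots> \<le> (\<integral>\<^sup>+ r. ennreal (?s / a) * ennreal ((?A r)\<^sup>2) + ennreal (?s / b) * ennreal ((?B r)\<^sup>2) + ennreal (?s * \<delta>) \<partial>G)"
  proof (rule nn_integral_mono_AE, use AE_close in eventually_elim)
    fix r :: "('a \<times> 'a) \<times> 'a \<times> 'a"
    assume "dist (snd (fst r)) (fst (snd r)) < \<delta>"
    moreover have "dist (fst (fst r)) (snd (snd r)) \<le> ?A r + (dist (snd (fst r)) (fst (snd r)) + ?B r)"
      by (meson add_left_mono dist_triangle order_trans)
    ultimately have "dist (fst (fst r)) (snd (snd r)) \<le> ?A r + ?B r + \<delta>" by linarith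
    then have "(dist (fst (fst r)) (snd (snd r)))\<^sup>2 \<le> (?A r + ?B r + \<delta>)\<^sup>2"
      by (intro power_mono) auto
    also have "\<dots> \<le> ?s / a * (?A r)\<^sup>2 + ?s / b * (?B r)\<^sup>2 + ?s * \<delta>"
    proof -
      have "(x + y + \<delta>)\<^sup>2 + (b * x - a * y)\<^sup>2 / (a * b) + \<delta> * (x - a)\<^sup>2 / a + \<delta> * (y - b)\<^sup>2 / b
          = ?s / a * x\<^sup>2 + ?s / b * y\<^sup>2 + ?s * \<delta>" for x y :: real
        using \<open>0 < a\<close> \<open>0 < b\<close> by (simp add: field_simps power2_eq_square)
      moreover have "0 \<le> (b * x - a * y)\<^sup>2 / (a * b)" "0 \<le> \<delta> * (x - a)\<^sup>2 / a" "0 \<le> \<delta> * (y - b)\<^sup>2 / b" for x y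
        using \<open>0 < a\<close> \<open>0 < b\<close> \<delta> by auto
      ultimately show ?thesis by (smt (verit, best))
    qed
    finally show "ennreal ((dist (fst (fst r)) (snd (snd r)))\<^sup>2)
        \<le> ennreal (?s / a) * ennreal ((?A r)\<^sup>2) + ennreal (?s / b) * ennreal ((?B r)\<^sup>2) + ennreal (?s * \<delta>)"
      using \<open>0 < a\<close> \<open>0 < b\<close> \<delta> by (simp add: ennreal_leI flip: ennreal_plus ennreal_mult)
  qed
  also have "\<dots> = ennreal (?s / a) * (\<integral>\<^sup>+r. ennreal ((?A r)\<^sup>2) \<partial>G) + ennreal (?s / b) * (\<integral>\<^sup>+r. ennreal ((?B r)\<^sup>2) \<partial>G) + (\<integral>\<^sup>+r. ennreal (?s * \<delta>) \<partial>G)"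
    by (simp add: nn_integral_add nn_integral_cmult)
  also have "(\<integral>\<^sup>+r. ennreal ((?A r)\<^sup>2) \<partial>G) = (\<integral>\<^sup>+ p. ennreal ((dist (fst p) (snd p))\<^sup>2) \<partial>\<pi>1)"
    by (rule int1) measurable
  also have "(\<integral>\<^sup>+r. ennreal ((?B r)\<^sup>2) \<partial>G) = (\<integral>\<^sup>+ p. ennreal ((dist (fst p) (snd p))\<^sup>2) \<partial>\<pi>2)"
    by (rule int2) measurable
  also have "(\<integral>\<^sup>+r. ennreal (?s * \<delta>) \<partial>G) = ennreal (?s * \<delta>)"
    using int1[of "\<lambda>_. ennreal (?s * \<delta>)"] by (simp add: \<pi>1.emeasure_space_1)
  also have "ennreal (?s / a) * (\<integral>\<^sup>+ p. ennreal ((dist (fst p) (snd p))\<^sup>2) \<partial>\<pi>1)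
      + ennreal (?s / b) * (\<integral>\<^sup>+ p. ennreal ((dist (fst p) (snd p))\<^sup>2) \<partial>\<pi>2) + ennreal (?s * \<delta>)
      \<le> ennreal (?s / a) * ennreal (a\<^sup>2) + ennreal (?s / b) * ennreal (b\<^sup>2) + ennreal (?s * \<delta>)"
    by (intro add_mono mult_left_mono cost1 cost2) auto
  also have "\<dots> = ennreal (?s / a * a\<^sup>2 + ?s / b * b\<^sup>2 + ?s * \<delta>)"
    using \<open>0 < a\<close> \<open>0 < b\<close> \<delta> by (simp flip: ennreal_plus ennreal_mult)
  also have "?s / a * a\<^sup>2 + ?s / b * b\<^sup>2 + ?s * \<delta> = ?s\<^sup>2"
    using \<open>0 < a\<close> \<open>0 < b\<close> by (simp add: field_simps power2_eq_square)
  finally show ?thesis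
    using \<open>0 < a\<close> \<open>0 < b\<close> \<delta> by (intro W2_le[OF \<pi>]) auto
qed

lemma W2_triangle:
  assumes "\<mu> \<in> wasserstein2" "\<nu> \<in> wasserstein2" "\<rho> \<in> wasserstein2"
  shows "W2 \<mu> \<rho> \<le> W2 \<mu> \<nu> + W2 \<nu> \<rho>"
proof (rule field_le_epsilon)
  fix e :: real assume "0 < e"
  define a b where "a = W2 \<mu> \<nu> + e / 3" and "b = W2 \<nu> \<rho> + e / 3"
  have "W2 \<mu> \<nu> < a" "W2 \<nu> \<rho> < b" "0 < a" "0 < b"
    using \<open>0 < e\<close> W2_nonneg[of \<mu> \<nu>] W2_nonneg[of \<nu> \<rho>] by (auto simp: a_def b_def)
  obtain \<pi>1 where \<pi>1: "\<pi>1 \<in> couplings \<mu> \<nu>"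
    "(\<integral>\<^sup>+ p. ennreal ((dist (fst p) (snd p))\<^sup>2) \<partial>\<pi>1) < ennreal (a\<^sup>2)"
    using W2_less_imp_coupling[OF assms(1,2) \<open>W2 \<mu> \<nu> < a\<close>] .
  obtain \<pi>2 where \<pi>2: "\<pi>2 \<in> couplings \<nu> \<rho>"
    "(\<integral>\<^sup>+ p. ennreal ((dist (fst p) (snd p))\<^sup>2) \<partial>\<pi>2) < ennreal (b\<^sup>2)"
    using W2_less_imp_coupling[OF assms(2,3) \<open>W2 \<nu> \<rho> < b\<close>] .
  have "W2 \<mu> \<rho> \<le> a + b + e / 3"
    using \<pi>1 \<pi>2 \<open>0 < e\<close> \<open>0 < a\<close> \<open>0 < b\<close> by (intro glue_couplings[OF assms]) auto
  then show "W2 \<mu> \<rho> \<le> W2 \<mu> \<nu> + W2 \<nu> \<rho> + e" by (simp add: a_def b_def)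
qed

lemma Metric_space_W2: "Metric_space wasserstein2 W2"
  by unfold_locales
    (auto simp: W2_nonneg W2_commute W2_triangle W2_self dest: W2_zero_imp_eq)

section \<open>Bounded martingale differences on a product space\<close>

text \<open>Martingale differences in coordinates: \<open>g k\<close> reads the coordinates up to k,
  and integrating out coordinate k gives 0. On a product space this is vanishing conditional
  expectation given the earlier coordinates.\<close>

locale martingale_differences =
  fixes u :: "'b measure" and g :: "nat \<Rightarrow> (nat \<Rightarrow> 'b) \<Rightarrow> real" and c :: "nat \<Rightarrow> real"
  assumes prob_space_u: "prob_space u"
    and measurable_g [measurable]: "\<And>k. g k \<in> borel_measurable (\<Pi>\<^sub>M i\<in>UNIV. u)"
    and bound_g: "\<And>k p. p \<in> space (\<Pi>\<^sub>M i\<in>UNIV. u) \<Longrightarrow> \<bar>g k p\<bar> \<le> c k"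
    and adapted_g: "\<And>k p q. (\<And>i. i \<le> k \<Longrightarrow> p i = q i) \<Longrightarrow> g k p = g k q"
    and mean_g: "\<And>k p. p \<in> space (\<Pi>\<^sub>M i\<in>UNIV. u) \<Longrightarrow> (\<integral>Q. g k (p(k := Q)) \<partial>u) = 0"
    and summable_c: "summable (\<lambda>k. (c k)\<^sup>2)"
begin

abbreviation "N \<equiv> (\<Pi>\<^sub>M i\<in>(UNIV :: nat set). u)"

sublocale u: prob_space u by (rule prob_space_u)
sublocale N: prob_space N by (intro prob_space_PiM prob_space_u)

text \<open>Coordinate k is split off the product measure. The multiplier does not see it, so the
  inner integral is a constant times the mean in \<open>mean_g\<close>.\<close>

lemma orthogonal:
  assumes [measurable]: "m \<in> borel_measurable N"
    and bdd: "\<And>p. p \<in> space N \<Longrightarrow> \<bar>m p\<bar> \<le> B"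
    and dep: "\<And>p q. (\<And>i. i < k \<Longrightarrow> p i = q i) \<Longrightarrow> m p = m q"
  shows "(\<integral>p. m p * g k p \<partial>N) = 0"
proof -
  define R where "R = (\<Pi>\<^sub>M i\<in>UNIV - {k}. u)"
  interpret R: prob_space R unfolding R_def by (intro prob_space_PiM prob_space_u)
  interpret pair_sigma_finite u R ..
  have N_eq: "distr (u \<Otimes>\<^sub>M R) N (\<lambda>(x, X). X(k := x)) = N"
    using distr_pair_PiM_eq_PiM[of "UNIV - {k}" "\<lambda>_. u" k] prob_space_u
    by (simp add: R_def insert_Diff_single)
  have upd: "(\<lambda>(x, X). X(k := x)) \<in> u \<Otimes>\<^sub>M R \<rightarrow>\<^sub>M N"
    using measurable_compose[OF measurable_pair_swap' measurable_add_dim[of k "UNIV - {k}" "\<lambda>_. u"]]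
    by (simp add: R_def insert_Diff_single split_beta')
  have "integrable N (\<lambda>p. m p * g k p)"
  proof (rule N.integrable_const_bound[where B="B * c k"])
    show "AE p in N. norm (m p * g k p) \<le> B * c k"
      using bdd bound_g by (intro AE_I2) (auto simp: abs_mult intro!: mult_mono intro: order_trans[OF abs_ge_zero])
  qed measurable
  then have int: "integrable (u \<Otimes>\<^sub>M R) (\<lambda>(x, X). m (X(k := x)) * g k (X(k := x)))"
    by (subst (asm) N_eq[symmetric], subst (asm) integrable_distr_eq[OF upd]) (auto simp: split_beta')
  have "(\<integral>p. m p * g k p \<partial>N) = (\<integral>(x, X). m (X(k := x)) * g k (X(k := x)) \<partial>(u \<Otimes>\<^sub>M R))"
    by (subst N_eq[symmetric], subst integral_distr[OF upd]) (auto simp: split_beta')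
  also have "\<dots> = (\<integral>X. (\<integral>x. m (X(k := x)) * g k (X(k := x)) \<partial>u) \<partial>R)"
    using integral_snd[OF int] by simp
  also have "\<dots> = (\<integral>X. 0 \<partial>R)"
  proof (rule Bochner_Integration.integral_cong[OF refl])
    fix X assume X: "X \<in> space R"
    \<comment> \<open>\<open>X\<close> is undefined at k; the dummy value completes it to a point of
      \<open>N\<close>, to which \<open>mean_g\<close> applies.\<close>
    obtain x0 where x0: "x0 \<in> space u" using u.not_empty by blast
    have sp: "X(k := x0) \<in> space N"
      using measurable_space[OF upd, of "(x0, X)"] X x0 by (simp add: space_pair_measure)
    define b where "b = m (X(k := x0))"
    have "m (X(k := x)) = b" for x unfolding b_def by (intro dep) auto
    then have "(\<integral>x. m (X(k := x)) * g k (X(k := x)) \<partial>u) = b * (\<integral>x. g k ((X(k := x0))(k := x)) \<partial>u)"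
      by simp
    then show "(\<integral>x. m (X(k := x)) * g k (X(k := x)) \<partial>u) = 0"
      using mean_g[OF sp, of k] by simp
  qed
  finally show ?thesis by simp
qed

lemma c_nonneg: "0 \<le> c k"
proof -
  obtain p where "p \<in> space N" using N.not_empty by blast
  from bound_g[OF this, of k] show ?thesis by linarith
qed

text \<open>A martingale transform: the weight \<open>m k\<close> sees only coordinates before k, so
  the partial sum times the next weight is an admissible multiplier in \<open>orthogonal\<close> and
  all cross terms vanish. The weights serve to stop the sum.\<close>

lemma second_moment_le:
  assumes [measurable]: "\<And>k. m k \<in> borel_measurable N"
    and bdd: "\<And>k p. p \<in> space N \<Longrightarrow> \<bar>m k p\<bar> \<le> 1"
    and dep: "\<And>k p q. (\<And>i. i < k \<Longrightarrow> p i = q i) \<Longrightarrow> m k p = m k q"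
    and "a \<le> n"
  shows "(\<integral>p. (\<Sum>k=a..<n. m k p * g k p)\<^sup>2 \<partial>N) \<le> (\<Sum>k=a..<n. (c k)\<^sup>2)"
  using \<open>a \<le> n\<close>
proof (induction n rule: dec_induct)
  case (step n)
  define V where "V p = (\<Sum>k=a..<n. m k p * g k p)" for p
  have [measurable]: "V \<in> borel_measurable N" unfolding V_def by measurable
  have mg: "\<bar>m k p * g k p\<bar> \<le> c k" if "p \<in> space N" for k p
    using mult_mono[OF bdd[OF that, of k] bound_g[OF that, of k]] by (simp add: abs_mult)
  have V_bdd: "\<bar>V p\<bar> \<le> (\<Sum>k=a..<n. c k)" if "p \<in> space N" for p
    unfolding V_def by (rule order_trans[OF sum_abs sum_mono]) (rule mg[OF that])
  have Vm_bdd: "\<bar>V p * m n p\<bar> \<le> (\<Sum>k=a..<n. c k) * 1" if "p \<in> space N" for p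
    unfolding abs_mult using V_bdd[OF that] bdd[OF that, of n] by (intro mult_mono) (auto intro: sum_nonneg c_nonneg)
  have orth: "(\<integral>p. (V p * m n p) * g n p \<partial>N) = 0"
  proof (rule orthogonal)
    show "V p * m n p = V q * m n q" if "\<And>i. i < n \<Longrightarrow> p i = q i" for p q
    proof -
      have "m k p = m k q" "g k p = g k q" if "k < n" for k
        using \<open>\<And>i. i < n \<Longrightarrow> p i = q i\<close> that by (auto intro!: dep adapted_g)
      moreover have "m n p = m n q" by (intro dep that)
      ultimately show ?thesis unfolding V_def by (auto intro!: arg_cong2[where f="(*)"] sum.cong)
    qed
  qed (use Vm_bdd in auto)
  have i1: "integrable N (\<lambda>p. (V p)\<^sup>2)"
    using V_bdd by (intro N.integrable_const_bound[where B="(\<Sum>k=a..<n. c k)\<^sup>2"] AE_I2)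
      (auto simp: abs_le_square_iff[symmetric] intro: order_trans[OF _ abs_ge_self])
  have i2: "integrable N (\<lambda>p. 2 * (V p * m n p * g n p))"
  proof (rule N.integrable_const_bound[where B="2 * ((\<Sum>k=a..<n. c k) * c n)"])
    show "AE p in N. norm (2 * (V p * m n p * g n p)) \<le> 2 * ((\<Sum>k=a..<n. c k) * c n)"
    proof (rule AE_I2)
      fix p assume p: "p \<in> space N"
      have "\<bar>V p\<bar> * \<bar>m n p * g n p\<bar> \<le> (\<Sum>k=a..<n. c k) * c n"
        using V_bdd[OF p] mg[OF p, of n] by (intro mult_mono) (auto intro: sum_nonneg c_nonneg)
      then show "norm (2 * (V p * m n p * g n p)) \<le> 2 * ((\<Sum>k=a..<n. c k) * c n)"
        by (simp add: abs_mult mult.assoc)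
    qed
  qed measurable
  have i3: "integrable N (\<lambda>p. (m n p * g n p)\<^sup>2)"
    using mg[of _ n] c_nonneg[of n] by (intro N.integrable_const_bound[where B="(c n)\<^sup>2"] AE_I2)
      (auto simp: abs_le_square_iff[symmetric])
  have "(\<integral>p. (\<Sum>k=a..<Suc n. m k p * g k p)\<^sup>2 \<partial>N) = (\<integral>p. (V p)\<^sup>2 + 2 * (V p * m n p * g n p) + (m n p * g n p)\<^sup>2 \<partial>N)"
    using step.hyps by (simp add: V_def power2_sum mult.assoc algebra_simps)
  also have "\<dots> = (\<integral>p. (V p)\<^sup>2 \<partial>N) + (\<integral>p. 2 * (V p * m n p * g n p) \<partial>N) + (\<integral>p. (m n p * g n p)\<^sup>2 \<partial>N)"
    using i1 i2 i3 by simp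
  also have "(\<integral>p. 2 * (V p * m n p * g n p) \<partial>N) = 0" using orth by (simp add: integral_mult_right_zero)
  also have "(\<integral>p. (m n p * g n p)\<^sup>2 \<partial>N) \<le> (\<integral>p. (c n)\<^sup>2 \<partial>N)"
    using mg[of _ n] c_nonneg[of n] by (intro integral_mono i3) (auto simp: abs_le_square_iff[symmetric])
  also have "(\<integral>p. (V p)\<^sup>2 \<partial>N) \<le> (\<Sum>k=a..<n. (c k)\<^sup>2)" using step.IH by (simp add: V_def)
  finally show ?case using step.hyps by (simp add: N.prob_space)
qed simp

text \<open>Multiplying the differences by the indicator that no partial sum has reached \<open>\<epsilon>\<close> so far
  stops the sum at the first such partial sum.\<close>

lemma maximal_inequality:
  assumes "0 < \<epsilon>" "a \<le> n"
  shows "measure N {p\<in>space N. \<exists>i\<in>{a..n}. \<epsilon> \<le> \<bar>\<Sum>l=a..<i. g l p\<bar>} \<le> (\<Sum>k=a..<n. (c k)\<^sup>2) / \<epsilon>\<^sup>2"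
proof -
  \<comment> \<open>The sums inspected by \<open>m k\<close> end before index k, so
    \<open>m k\<close> depends on coordinates strictly below k, as \<open>second_moment_le\<close>
    demands.\<close>
  define m :: "nat \<Rightarrow> (nat \<Rightarrow> 'b) \<Rightarrow> real"
    where "m k p = (if \<forall>i\<in>{a..k}. \<bar>\<Sum>l=a..<i. g l p\<bar> < \<epsilon> then 1 else 0)" for k p
  have [measurable]: "m k \<in> borel_measurable N" for k unfolding m_def by measurable
  have dep: "m k p = m k q" if "\<And>i. i < k \<Longrightarrow> p i = q i" for k p q
  proof -
    have "g l p = g l q" if "l < k" for l using \<open>\<And>i. i < k \<Longrightarrow> p i = q i\<close> that by (intro adapted_g) auto
    then have "(\<Sum>l=a..<i. g l p) = (\<Sum>l=a..<i. g l q)" if "i \<in> {a..k}" for i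
      using that by (intro sum.cong) auto
    then show ?thesis unfolding m_def by (intro if_cong ball_cong) auto
  qed
  define V where "V p = (\<Sum>k=a..<n. m k p * g k p)" for p
  have [measurable]: "V \<in> borel_measurable N" unfolding V_def by measurable
  have "\<epsilon> \<le> \<bar>V p\<bar>" if ex: "\<exists>i\<in>{a..n}. \<epsilon> \<le> \<bar>\<Sum>l=a..<i. g l p\<bar>" for p
  proof -
    define i where "i = (LEAST i. i \<in> {a..n} \<and> \<epsilon> \<le> \<bar>\<Sum>l=a..<i. g l p\<bar>)"
    have i: "i \<in> {a..n}" "\<epsilon> \<le> \<bar>\<Sum>l=a..<i. g l p\<bar>"
      using LeastI_ex[of "\<lambda>i. i \<in> {a..n} \<and> \<epsilon> \<le> \<bar>\<Sum>l=a..<i. g l p\<bar>"] ex unfolding i_def by blast+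
    have min: "\<bar>\<Sum>l=a..<i'. g l p\<bar> < \<epsilon>" if "i' \<in> {a..n}" "i' < i" for i'
      using not_less_Least[of i' "\<lambda>i. i \<in> {a..n} \<and> \<epsilon> \<le> \<bar>\<Sum>l=a..<i. g l p\<bar>"] that by (auto simp: i_def)
    have "V p = (\<Sum>k=a..<i. m k p * g k p) + (\<Sum>k=i..<n. m k p * g k p)"
      unfolding V_def using i by (intro sum.atLeastLessThan_concat[symmetric]) auto
    also have "(\<Sum>k=i..<n. m k p * g k p) = 0"
    proof (intro sum.neutral ballI)
      fix k assume "k \<in> {i..<n}"
      then have "i \<in> {a..k}" using i by auto
      then have "m k p = 0" using i by (auto simp: m_def not_less intro!: bexI[of _ i])
      then show "m k p * g k p = 0" by simp
    qed
    also have "(\<Sum>k=a..<i. m k p * g k p) = (\<Sum>k=a..<i. g k p)"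
      using i min by (intro sum.cong) (auto simp: m_def)
    finally show ?thesis using i by simp
  qed
  then have "measure N {p\<in>space N. \<exists>i\<in>{a..n}. \<epsilon> \<le> \<bar>\<Sum>l=a..<i. g l p\<bar>} \<le> measure N {p\<in>space N. \<epsilon>\<^sup>2 \<le> (V p)\<^sup>2}"
    using \<open>0 < \<epsilon>\<close> by (intro N.finite_measure_mono) (auto simp: abs_le_square_iff[symmetric])
  also have "\<dots> \<le> (\<integral>p. (V p)\<^sup>2 \<partial>N) / \<epsilon>\<^sup>2"
  proof (rule integral_Markov_inequality_measure[where A="{}"])
    have mg: "\<bar>m k p * g k p\<bar> \<le> c k" if "p \<in> space N" for k p
      using bound_g[OF that, of k] c_nonneg[of k] by (auto simp: m_def)
    have "\<bar>V p\<bar> \<le> (\<Sum>k=a..<n. c k)" if "p \<in> space N" for p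
      unfolding V_def by (rule order_trans[OF sum_abs sum_mono]) (rule mg[OF that])
    then show "integrable N (\<lambda>p. (V p)\<^sup>2)"
      by (intro N.integrable_const_bound[where B="(\<Sum>k=a..<n. c k)\<^sup>2"] AE_I2)
        (auto simp: abs_le_square_iff[symmetric] intro: order_trans[OF _ abs_ge_self])
  qed (use \<open>0 < \<epsilon>\<close> in auto)
  also have "(\<integral>p. (V p)\<^sup>2 \<partial>N) \<le> (\<Sum>k=a..<n. (c k)\<^sup>2)"
    unfolding V_def
  proof (rule second_moment_le)
    show "\<bar>m k p\<bar> \<le> 1" for k p by (simp add: m_def)
    show "m k p = m k q" if "\<And>i. i < k \<Longrightarrow> p i = q i" for k p q using that by (rule dep)
  qed (use \<open>a \<le> n\<close> in measurable)
  finally show ?thesis using \<open>0 < \<epsilon>\<close> by (simp add: divide_right_mono)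
qed

text \<open>The tail sums of \<open>(c k)\<^sup>2\<close> vanish, so by the maximal inequality late
  partial sums almost surely oscillate by less than any given \<epsilon>. Running over reciprocals
  of integers makes them Cauchy.\<close>

theorem AE_summable: "AE p in N. summable (\<lambda>k. g k p)"
proof -
  have eps: "AE p in N. \<exists>a. \<forall>i\<ge>a. \<bar>\<Sum>l=a..<i. g l p\<bar> < \<epsilon>" if "0 < \<epsilon>" for \<epsilon>
  proof -
    define Bad where "Bad a = {p\<in>space N. \<exists>i\<ge>a. \<epsilon> \<le> \<bar>\<Sum>l=a..<i. g l p\<bar>}" for a
    have [measurable]: "Bad a \<in> sets N" for a unfolding Bad_def by measurable
    have tail: "(\<lambda>a. (\<Sum>k. (c (k + a))\<^sup>2) / \<epsilon>\<^sup>2) \<longlonglongrightarrow> 0 / \<epsilon>\<^sup>2"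
      by (intro tendsto_divide tendsto_const suminf_exist_split2 summable_c) (use that in auto)
    \<comment> \<open>The maximal inequality has a finite horizon; continuity from below removes
      it.\<close>
    have Bad_le: "measure N (Bad a) \<le> (\<Sum>k. (c (k + a))\<^sup>2) / \<epsilon>\<^sup>2" for a
    proof (rule LIMSEQ_le_const2)
      let ?A = "\<lambda>n. {p\<in>space N. \<exists>i\<in>{a..a+n}. \<epsilon> \<le> \<bar>\<Sum>l=a..<i. g l p\<bar>}"
      have "(\<Union>n. ?A n) = Bad a"
      proof (intro equalityI subsetI)
        fix p assume "p \<in> Bad a"
        then obtain i where "p \<in> space N" "a \<le> i" "\<epsilon> \<le> \<bar>\<Sum>l=a..<i. g l p\<bar>" by (auto simp: Bad_def)
        then have "p \<in> ?A (i - a)" by auto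
        then show "p \<in> (\<Union>n. ?A n)" by blast
      qed (auto simp: Bad_def)
      moreover have "(\<lambda>n. measure N (?A n)) \<longlonglongrightarrow> measure N (\<Union>n. ?A n)"
        by (rule N.finite_Lim_measure_incseq) (auto simp: incseq_def)
      ultimately show "(\<lambda>n. measure N (?A n)) \<longlonglongrightarrow> measure N (Bad a)" by simp
      have "measure N (?A n) \<le> (\<Sum>k. (c (k + a))\<^sup>2) / \<epsilon>\<^sup>2" for n
      proof -
        have "measure N (?A n) \<le> (\<Sum>k=a..<a+n. (c k)\<^sup>2) / \<epsilon>\<^sup>2"
          by (rule maximal_inequality[OF that]) simp
        also have "(\<Sum>k=a..<a+n. (c k)\<^sup>2) = (\<Sum>k<n. (c (k + a))\<^sup>2)"
          using sum.shift_bounds_nat_ivl[of "\<lambda>k. (c k)\<^sup>2" 0 a n] by (simp add: atLeast0LessThan add.commute)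
        also have "\<dots> \<le> (\<Sum>k. (c (k + a))\<^sup>2)"
          using summable_c summable_iff_shift[of "\<lambda>k. (c k)\<^sup>2" a] by (intro sum_le_suminf) auto
        finally show ?thesis by (simp add: divide_right_mono)
      qed
      then show "\<exists>n0. \<forall>n\<ge>n0. measure N (?A n) \<le> (\<Sum>k. (c (k + a))\<^sup>2) / \<epsilon>\<^sup>2" by blast
    qed
    have "measure N (\<Inter>a. Bad a) \<le> (\<Sum>k. (c (k + a))\<^sup>2) / \<epsilon>\<^sup>2" for a
      by (rule order_trans[OF N.finite_measure_mono Bad_le[of a]]) auto
    then have "measure N (\<Inter>a. Bad a) \<le> 0"
      using tail by (intro LIMSEQ_le_const[where X="\<lambda>a. (\<Sum>k. (c (k + a))\<^sup>2) / \<epsilon>\<^sup>2"]) auto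
    then have "measure N (\<Inter>a. Bad a) = 0" by (simp add: measure_le_0_iff)
    then have "AE p in N. p \<notin> (\<Inter>a. Bad a)" by (subst (asm) N.prob_eq_0) auto
    with AE_space show ?thesis
      by eventually_elim (auto simp: Bad_def, meson not_le)
  qed
  have "AE p in N. \<forall>n. \<exists>a. \<forall>i\<ge>a. \<bar>\<Sum>l=a..<i. g l p\<bar> < inverse (real (Suc n))"
    unfolding AE_all_countable by (intro allI eps) auto
  then show ?thesis
  proof eventually_elim
    case (elim p)
    show ?case unfolding summable_Cauchy
    proof (intro allI impI)
      fix e :: real assume "0 < e"
      then obtain n where n: "inverse (real (Suc n)) < e / 2" using reals_Archimedean[of "e / 2"] by auto
      obtain a where a: "\<And>i. a \<le> i \<Longrightarrow> \<bar>\<Sum>l=a..<i. g l p\<bar> < inverse (real (Suc n))" using elim by blast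
      have "norm (sum (\<lambda>k. g k p) {i..<j}) < e" if "a \<le> i" for i j
      proof (cases "i \<le> j")
        case True
        have "sum (\<lambda>k. g k p) {i..<j} = (\<Sum>l=a..<j. g l p) - (\<Sum>l=a..<i. g l p)"
          using True that by (simp add: sum.atLeastLessThan_concat[of a i j, symmetric])
        then show ?thesis using a[of i] a[of j] True that n by simp
      qed (use \<open>0 < e\<close> in auto)
      then show "\<exists>N. \<forall>m\<ge>N. \<forall>n. norm (sum (\<lambda>k. g k p) {m..<n}) < e" by blast
    qed
  qed
qed

end

section \<open>Slice matching\<close>

lemma real_distribution_slice:
  assumes "prob_space \<sigma>" "sets \<sigma> = sets borel"
  shows "real_distribution (slice \<sigma> \<theta>)"
proof -
  interpret prob_space \<sigma> by fact
  note [measurable_cong] = assms(2)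
  show ?thesis unfolding slice_def by (rule real_distribution_distr) measurable
qed

text \<open>The preimage of a point under the projection is a hyperplane, hence Lebesgue null and so
  null for \<sigma>.\<close>

lemma atomless_slice:
  assumes "\<sigma> \<in> wasserstein2_ac" "\<theta> \<noteq> 0"
  shows "atomless (slice \<sigma> \<theta>)"
proof -
  have \<sigma>: "prob_space \<sigma>" "sets \<sigma> = sets borel" "absolutely_continuous lborel \<sigma>"
    using assms(1) by (auto simp: wasserstein2_ac_def wasserstein2_def)
  note [measurable_cong] = \<sigma>(2)
  have sp: "space \<sigma> = UNIV" using sets_eq_imp_space_eq[OF \<sigma>(2)] by simp
  have "measure (slice \<sigma> \<theta>) {t} = 0" for t
  proof -
    have "negligible {x. \<theta> \<bullet> x = t}" using assms(2) by (intro negligible_hyperplane) auto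
    then have "{x. x \<bullet> \<theta> = t} \<in> null_sets lborel"
      by (simp add: negligible_iff_null_sets null_sets_completion_iff inner_commute)
    then have "{x. x \<bullet> \<theta> = t} \<in> null_sets \<sigma>" using \<sigma>(3) by (auto simp: absolutely_continuous_def)
    then have "measure \<sigma> {x. x \<bullet> \<theta> = t} = 0" by (simp add: null_sets_def measure_def)
    then show ?thesis unfolding slice_def
      by (subst measure_distr) (auto simp: sp vimage_def)
  qed
  then show ?thesis using real_distribution_slice[OF \<sigma>(1,2)] by (auto simp: atomless_def)
qed

lemma wasserstein2_acD: "\<sigma> \<in> wasserstein2_ac \<Longrightarrow> \<sigma> \<in> wasserstein2"
  by (simp add: wasserstein2_ac_def)

text \<open>Pushing the kernel forward by the integrand reduces the claim to the integral of the
  identity over a kernel on the reals. It makes \<open>drift\<close> and \<open>slope\<close> of a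
  random iterate random variables.\<close>

lemma measurable_kernel_integral:
  fixes f :: "'l \<Rightarrow> 'x \<Rightarrow> real"
  assumes [measurable]: "(\<lambda>(l, x). f l x) \<in> borel_measurable (L \<Otimes>\<^sub>M S)" "\<kappa> \<in> L \<rightarrow>\<^sub>M subprob_algebra S"
  shows "(\<lambda>l. \<integral>x. f l x \<partial>\<kappa> l) \<in> borel_measurable L"
proof -
  have "(\<lambda>l. distr (\<kappa> l) borel (f l)) \<in> L \<rightarrow>\<^sub>M subprob_algebra borel"
    by (rule measurable_distr2) measurable
  then have "(\<lambda>l. \<integral>y. y \<partial>distr (\<kappa> l) borel (f l)) \<in> borel_measurable L"
    by (rule measurable_compose) (rule integral_measurable_subprob_algebra, simp)
  moreover have "(\<integral>y. y \<partial>distr (\<kappa> l) borel (f l)) = (\<integral>x. f l x \<partial>\<kappa> l)" if "l \<in> space L" for l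
  proof (rule integral_distr)
    have "f l \<in> borel_measurable S" using measurable_Pair2[OF assms(1) that] by simp
    then show "f l \<in> borel_measurable (\<kappa> l)"
      using measurable_cong_sets[OF sets_kernel[OF assms(2) that] refl] by blast
  qed simp
  ultimately show ?thesis by (simp cong: measurable_cong)
qed

locale slice_matching =
  fixes e :: "nat \<Rightarrow> 'n::finite" and j :: nat and \<mu> :: "(real^'n) measure" and u :: "(real^'n^'n) measure"
  assumes labelling: "bij_betw e {1..CARD('n)} UNIV"
    and j_le: "j \<le> CARD('n)"
    and \<mu>: "\<mu> \<in> wasserstein2"
    and haar: "haar_prob_orthogonal u"
begin

sublocale u: prob_space u using haar by (simp add: haar_prob_orthogonal_def)
sublocale \<mu>: prob_space \<mu> using wasserstein2D[OF \<mu>] by simp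

lemma sets_u [measurable_cong]: "sets u = sets (restrict_space borel orthogonal_group)"
  using haar by (simp add: haar_prob_orthogonal_def)

lemma space_u: "space u = orthogonal_group"
  using sets_eq_imp_space_eq[OF sets_u] by (simp add: space_restrict_space)

abbreviation "dir P i \<equiv> column (e i) P"
abbreviation "disp \<sigma> P x \<equiv> slice_map e j \<mu> \<sigma> P x - x"

subsection \<open>Orthonormal columns\<close>

lemma dir_orthonormal:
  assumes "P \<in> orthogonal_group" "i \<in> {1..CARD('n)}" "k \<in> {1..CARD('n)}"
  shows "dir P i \<bullet> dir P k = (if i = k then 1 else 0)"
proof -
  have "norm (dir P i) = 1" "a \<noteq> b \<Longrightarrow> orthogonal (column a P) (column b P)" for a b
    using assms(1) by (auto simp: orthogonal_group_def orthogonal_matrix_orthonormal_columns)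
  moreover have "e i = e k \<longleftrightarrow> i = k"
    using labelling assms(2,3) by (auto simp: bij_betw_def dest: inj_onD)
  ultimately show ?thesis by (auto simp: orthogonal_def norm_eq_1)
qed

lemma dir_nonzero: "P \<in> orthogonal_group \<Longrightarrow> i \<in> {1..CARD('n)} \<Longrightarrow> dir P i \<noteq> 0"
  using dir_orthonormal[of P i i] by auto

lemma dir_expansion:
  assumes "P \<in> orthogonal_group"
  shows "(\<Sum>i=1..CARD('n). (x \<bullet> dir P i) *\<^sub>R dir P i) = x"
proof -
  have "P ** transpose P = mat 1"
    using assms by (simp add: orthogonal_group_def orthogonal_matrix_def)
  moreover have comp: "(transpose P *v x) $ k = x \<bullet> column k P" for k
    by (simp add: matrix_vector_mult_def transpose_def column_def inner_vec_def mult.commute)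
  ultimately have "x = P *v (transpose P *v x)" by (simp add: matrix_vector_mul_assoc del: transpose_matrix_vector)
  also have "\<dots> = (\<Sum>k\<in>UNIV. (x \<bullet> column k P) *\<^sub>R column k P)"
    by (simp add: matrix_mult_sum[of P] scalar_mult_eq_scaleR comp del: transpose_matrix_vector)
  also have "\<dots> = (\<Sum>i=1..CARD('n). (x \<bullet> dir P i) *\<^sub>R dir P i)"
    using sum.reindex_bij_betw[OF labelling, of "\<lambda>k. (x \<bullet> column k P) *\<^sub>R column k P"] by simp
  finally show ?thesis ..
qed

lemma inner_sum_dir:
  assumes "P \<in> orthogonal_group"
  shows "(\<Sum>i=1..j. a i *\<^sub>R dir P i) \<bullet> (\<Sum>i=1..j. b i *\<^sub>R dir P i) = (\<Sum>i=1..j. a i * b i)"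
proof -
  have "(\<Sum>i=1..j. a i *\<^sub>R dir P i) \<bullet> (\<Sum>i=1..j. b i *\<^sub>R dir P i) =
      (\<Sum>i=1..j. \<Sum>k=1..j. if k = i then a i * b k else 0)"
    unfolding inner_sum_left inner_sum_right
    using j_le by (intro sum.cong refl) (auto simp: dir_orthonormal[OF assms])
  then show ?thesis by simp
qed

lemma bessel:
  assumes "P \<in> orthogonal_group"
  shows "(\<Sum>i=1..j. (v \<bullet> dir P i)\<^sup>2) \<le> (norm v)\<^sup>2"
proof -
  define w where "w = (\<Sum>i=1..j. (v \<bullet> dir P i) *\<^sub>R dir P i)"
  have "w \<bullet> w = (\<Sum>i=1..j. (v \<bullet> dir P i)\<^sup>2)"
    unfolding w_def inner_sum_dir[OF assms] by (simp add: power2_eq_square)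
  moreover have "v \<bullet> w = (\<Sum>i=1..j. (v \<bullet> dir P i)\<^sup>2)"
    unfolding w_def by (simp add: inner_sum_right power2_eq_square)
  moreover have "0 \<le> (v - w) \<bullet> (v - w)" by simp
  ultimately show ?thesis
    by (simp add: inner_diff_left inner_diff_right inner_commute power2_norm_eq_inner)
qed

text \<open>The coordinates beyond \<open>j\<close> are left fixed and cancel against the expansion
  of \<open>x\<close> in the orthonormal columns.\<close>

lemma disp_eq:
  assumes "P \<in> orthogonal_group"
  shows "disp \<sigma> P x = (\<Sum>i=1..j. (ot_map (slice \<sigma> (dir P i)) (slice \<mu> (dir P i)) (x \<bullet> dir P i) - x \<bullet> dir P i) *\<^sub>R dir P i)"
proof -
  have "x = (\<Sum>i=1..j. (x \<bullet> dir P i) *\<^sub>R dir P i) + (\<Sum>i=j+1..CARD('n). (x \<bullet> dir P i) *\<^sub>R dir P i)"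
    using sum.ub_add_nat[of 1 j "\<lambda>i. (x \<bullet> dir P i) *\<^sub>R dir P i" "CARD('n) - j"] j_le dir_expansion[OF assms, of x]
    by simp
  then have "disp \<sigma> P x = slice_map e j \<mu> \<sigma> P x - ((\<Sum>i=1..j. (x \<bullet> dir P i) *\<^sub>R dir P i) + (\<Sum>i=j+1..CARD('n). (x \<bullet> dir P i) *\<^sub>R dir P i))"
    by simp
  then show ?thesis
    by (simp add: slice_map_def scaleR_diff_left sum_subtractf)
qed

lemma norm_disp:
  assumes "P \<in> orthogonal_group"
  shows "(norm (disp \<sigma> P x))\<^sup>2 = (\<Sum>i=1..j. (x \<bullet> dir P i - ot_map (slice \<sigma> (dir P i)) (slice \<mu> (dir P i)) (x \<bullet> dir P i))\<^sup>2)"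
  unfolding disp_eq[OF assms] power2_norm_eq_inner inner_sum_dir[OF assms]
  by (simp add: power2_eq_square[symmetric] power2_commute)

lemma inner_disp_dir:
  assumes "P \<in> orthogonal_group" "i \<in> {1..j}"
  shows "disp \<sigma> P x \<bullet> dir P i = ot_map (slice \<sigma> (dir P i)) (slice \<mu> (dir P i)) (x \<bullet> dir P i) - x \<bullet> dir P i"
proof -
  have "disp \<sigma> P x \<bullet> dir P i = (\<Sum>k=1..j. if k = i then ot_map (slice \<sigma> (dir P i)) (slice \<mu> (dir P i)) (x \<bullet> dir P i) - x \<bullet> dir P i else 0)"
    unfolding disp_eq[OF assms(1)] inner_sum_left
    using assms(2) j_le by (intro sum.cong refl) (auto simp: dir_orthonormal[OF assms(1)])
  then show ?thesis using assms(2) by simp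
qed

subsection \<open>Measurability\<close>

lemma measurable_column [measurable]: "(\<lambda>P. column i P) \<in> u \<rightarrow>\<^sub>M borel"
proof -
  have "continuous_on UNIV (\<lambda>P :: real^'n^'n. column i P)"
    unfolding column_def by (intro continuous_intros)
  then have "(\<lambda>P. column i P) \<in> borel_measurable (borel :: (real^'n^'n) measure)"
    by (rule borel_measurable_continuous_onI)
  then have "(\<lambda>P. column i P) \<in> borel_measurable (restrict_space borel orthogonal_group)"
    by (rule measurable_restrict_space1)
  then show ?thesis using measurable_cong_sets[OF sets_u refl] by blast
qed

lemma measurable_cdf_slice:
  assumes [measurable]: "\<kappa> \<in> L \<rightarrow>\<^sub>M subprob_algebra borel" "\<Theta> \<in> L \<rightarrow>\<^sub>M borel" "t \<in> L \<rightarrow>\<^sub>M borel"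
  shows "(\<lambda>l. cdf (slice (\<kappa> l) (\<Theta> l)) (t l)) \<in> borel_measurable L"
proof -
  have "{p \<in> space (L \<Otimes>\<^sub>M borel). snd p \<bullet> \<Theta> (fst p) \<le> t (fst p)} \<in> sets (L \<Otimes>\<^sub>M borel)"
    by measurable
  also have "{p \<in> space (L \<Otimes>\<^sub>M borel). snd p \<bullet> \<Theta> (fst p) \<le> t (fst p)} = (SIGMA l:space L. {x. x \<bullet> \<Theta> l \<le> t l})"
    by (auto simp: space_pair_measure)
  finally have "(\<lambda>l. measure (\<kappa> l) {x. x \<bullet> \<Theta> l \<le> t l}) \<in> borel_measurable L"
    by (rule measure_measurable_subprob_algebra2) measurable
  moreover have "cdf (slice (\<kappa> l) (\<Theta> l)) (t l) = measure (\<kappa> l) {x. x \<bullet> \<Theta> l \<le> t l}" if "l \<in> space L" for l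
  proof -
    have "(\<lambda>x. x \<bullet> \<Theta> l) \<in> borel_measurable borel" by measurable
    then have "(\<lambda>x. x \<bullet> \<Theta> l) \<in> borel_measurable (\<kappa> l)"
      using measurable_cong_sets[OF sets_kernel[OF assms(1) that] refl] by blast
    moreover have "space (\<kappa> l) = UNIV" using sets_eq_imp_space_eq[OF sets_kernel[OF assms(1) that]] by simp
    ultimately show ?thesis unfolding cdf_def2 slice_def
      by (subst measure_distr) (auto simp: vimage_def)
  qed
  ultimately show ?thesis by (simp cong: measurable_cong)
qed

lemma const_kernel: "\<sigma> \<in> wasserstein2 \<Longrightarrow> (\<lambda>_. \<sigma>) \<in> L \<rightarrow>\<^sub>M subprob_algebra borel"
  by (auto simp: space_subprob_algebra wasserstein2_def intro!: measurable_const prob_space_imp_subprob_space)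

text \<open>Measure, frame and point all vary with the parameter, since the measure will be a random
  iterate.\<close>

lemma measurable_slice_map:
  assumes [measurable]: "\<kappa> \<in> L \<rightarrow>\<^sub>M subprob_algebra borel" "P \<in> L \<rightarrow>\<^sub>M u" "X \<in> L \<rightarrow>\<^sub>M borel"
  shows "(\<lambda>l. slice_map e j \<mu> (\<kappa> l) (P l) (X l)) \<in> borel_measurable L"
proof -
  have [measurable]: "(\<lambda>l. ot_map (slice (\<kappa> l) (dir (P l) i)) (slice \<mu> (dir (P l) i)) (X l \<bullet> dir (P l) i)) \<in> borel_measurable L" for i
    unfolding ot_map_def comp_def
  proof (rule borel_measurable_quantile)
    show "real_distribution (slice \<mu> (dir (P l) i))" for l
      using wasserstein2D[OF \<mu>] by (intro real_distribution_slice) auto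
    show "(\<lambda>l. cdf (slice \<mu> (dir (P l) i)) t) \<in> borel_measurable L" for t
      by (rule measurable_cdf_slice[OF const_kernel[OF \<mu>]]) measurable
    show "(\<lambda>l. cdf (slice (\<kappa> l) (dir (P l) i)) (X l \<bullet> dir (P l) i)) \<in> borel_measurable L"
      by (rule measurable_cdf_slice) measurable
  qed
  show ?thesis unfolding slice_map_def by measurable
qed

lemma measurable_slice_step:
  assumes [measurable]: "\<kappa> \<in> L \<rightarrow>\<^sub>M subprob_algebra borel" "P \<in> L \<rightarrow>\<^sub>M u"
  shows "(\<lambda>l. slice_step e j \<mu> c (P l) (\<kappa> l)) \<in> L \<rightarrow>\<^sub>M subprob_algebra borel"
  unfolding slice_step_def
proof (rule measurable_distr2[OF _ assms(1)])
  have [measurable]: "(\<lambda>q. slice_map e j \<mu> (\<kappa> (fst q)) (P (fst q)) (snd q)) \<in> borel_measurable (L \<Otimes>\<^sub>M borel)"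
    by (rule measurable_slice_map) measurable
  show "(\<lambda>(l, x). (1 - c) *\<^sub>R x + c *\<^sub>R slice_map e j \<mu> (\<kappa> l) (P l) x) \<in> borel_measurable (L \<Otimes>\<^sub>M borel)"
    unfolding split_beta' by measurable
qed

text \<open>Each step pushes a kernel forward by a map jointly measurable in path and point, so the
  iterates form kernels on path space.\<close>

lemma measurable_slice_iter:
  assumes "\<sigma>0 \<in> wasserstein2"
  shows "(\<lambda>p. slice_iter e j \<mu> \<sigma>0 \<gamma> p k) \<in> (\<Pi>\<^sub>M i\<in>UNIV. u) \<rightarrow>\<^sub>M subprob_algebra borel"
proof (induction k)
  case 0
  show ?case using const_kernel[OF assms] by simp
next
  case (Suc k)
  show ?case unfolding slice_iter.simps
    by (rule measurable_slice_step[OF Suc]) (rule measurable_component_singleton, simp)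
qed

lemma slice_iter_cong:
  "(\<And>i. i < k \<Longrightarrow> p i = q i) \<Longrightarrow> slice_iter e j \<mu> \<sigma>0 \<gamma> p k = slice_iter e j \<mu> \<sigma>0 \<gamma> q k"
  by (induction k) auto

lemma measurable_H_deriv:
  assumes [measurable]: "\<kappa> \<in> L \<rightarrow>\<^sub>M subprob_algebra borel" "X \<in> L \<rightarrow>\<^sub>M borel"
  shows "(\<lambda>l. H_deriv e j u \<mu> (\<kappa> l) (X l)) \<in> borel_measurable L"
proof -
  have [measurable]: "(\<lambda>q. slice_map e j \<mu> (\<kappa> (fst q)) (snd q) (X (fst q))) \<in> borel_measurable (L \<Otimes>\<^sub>M u)"
    by (rule measurable_slice_map) measurable
  show ?thesis unfolding H_deriv_def
    by (rule u.borel_measurable_lebesgue_integral) (simp add: split_beta')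
qed

end

section \<open>Square integrable random fields\<close>

lemma (in prob_space) integrable_of_integrable_norm_sq:
  fixes f :: "'a \<Rightarrow> 'v::{banach, second_countable_topology}"
  assumes [measurable]: "f \<in> borel_measurable M" and "integrable M (\<lambda>x. (norm (f x))\<^sup>2)"
  shows "integrable M f"
proof (rule Bochner_Integration.integrable_bound)
  show "integrable M (\<lambda>x. 1 + (norm (f x))\<^sup>2)" using assms(2) by simp
  have "norm (f x) \<le> 1 + (norm (f x))\<^sup>2" for x
    using sum_squares_bound[of "norm (f x)" 1] norm_ge_zero[of "f x"] unfolding one_power2 by linarith
  then show "AE x in M. norm (f x) \<le> norm (1 + (norm (f x))\<^sup>2)" by simp
qed simp

text \<open>Jensen for the squared norm, by integrating the nonnegative squared distance of
  \<open>f x\<close> to its mean.\<close>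

lemma (in prob_space) norm_integral_sq_le:
  fixes f :: "'a \<Rightarrow> 'v::euclidean_space"
  assumes f: "integrable M f" "integrable M (\<lambda>x. (norm (f x))\<^sup>2)"
  shows "(norm (\<integral>x. f x \<partial>M))\<^sup>2 \<le> (\<integral>x. (norm (f x))\<^sup>2 \<partial>M)"
proof -
  define c where "c = (\<integral>x. f x \<partial>M)"
  have "(\<integral>x. 2 * (f x \<bullet> c) - (norm c)\<^sup>2 \<partial>M) \<le> (\<integral>x. (norm (f x))\<^sup>2 \<partial>M)"
  proof (intro integral_mono f)
    fix x
    have "0 \<le> (f x - c) \<bullet> (f x - c)" by simp
    then show "2 * (f x \<bullet> c) - (norm c)\<^sup>2 \<le> (norm (f x))\<^sup>2"
      by (simp add: inner_diff_left inner_diff_right inner_commute power2_norm_eq_inner)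
  qed (use f in simp)
  moreover have "(\<integral>x. 2 * (f x \<bullet> c) - (norm c)\<^sup>2 \<partial>M) = (norm c)\<^sup>2"
    using f by (simp add: c_def prob_space power2_norm_eq_inner)
  ultimately show ?thesis by (simp add: c_def)
qed

lemma abs_inner_le_sum_squares:
  fixes a b :: "'v::real_inner"
  shows "\<bar>a \<bullet> b\<bar> \<le> ((norm a)\<^sup>2 + (norm b)\<^sup>2) / 2"
  using Cauchy_Schwarz_ineq2[of a b] sum_squares_bound[of "norm a" "norm b"] by simp

lemma integrable_inner_of_norm_sq:
  fixes f g :: "'a \<Rightarrow> 'v::euclidean_space"
  assumes [measurable]: "f \<in> borel_measurable M" "g \<in> borel_measurable M"
    and "integrable M (\<lambda>x. (norm (f x))\<^sup>2)" "integrable M (\<lambda>x. (norm (g x))\<^sup>2)"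
  shows "integrable M (\<lambda>x. f x \<bullet> g x)"
proof (rule Bochner_Integration.integrable_bound)
  show "integrable M (\<lambda>x. ((norm (f x))\<^sup>2 + (norm (g x))\<^sup>2) / 2)" using assms by simp
qed (use abs_inner_le_sum_squares in auto)

text \<open>Pointwise \<open>\<bar>f x\<bar> \<le> c / 2 + (f x)\<^sup>2 / (2 * c)\<close>, tuned so
  that the assumed second moment makes each half contribute \<open>c / 2\<close>.\<close>

lemma nn_integral_abs_first_moment_le:
  assumes "prob_space m" and [measurable]: "f \<in> borel_measurable m" and "0 < c"
    and "(\<integral>\<^sup>+x. ennreal ((f x)\<^sup>2) \<partial>m) \<le> ennreal (c\<^sup>2)"
  shows "(\<integral>\<^sup>+x. ennreal \<bar>f x\<bar> \<partial>m) \<le> ennreal c"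
proof -
  interpret m: prob_space m by fact
  have "(\<integral>\<^sup>+x. ennreal \<bar>f x\<bar> \<partial>m) \<le> (\<integral>\<^sup>+x. ennreal (c / 2) + ennreal (1 / (2 * c)) * ennreal ((f x)\<^sup>2) \<partial>m)"
  proof (rule nn_integral_mono)
    fix x
    have "\<bar>f x\<bar> = (2 * c * \<bar>f x\<bar>) / (2 * c)" using \<open>0 < c\<close> by simp
    also have "\<dots> \<le> (c\<^sup>2 + (f x)\<^sup>2) / (2 * c)"
      using sum_squares_bound[of c "\<bar>f x\<bar>"] \<open>0 < c\<close> by (intro divide_right_mono) auto
    also have "\<dots> = c / 2 + 1 / (2 * c) * (f x)\<^sup>2"
      using \<open>0 < c\<close> by (simp add: field_simps power2_eq_square)
    finally show "ennreal \<bar>f x\<bar> \<le> ennreal (c / 2) + ennreal (1 / (2 * c)) * ennreal ((f x)\<^sup>2)"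
      using \<open>0 < c\<close> by (simp add: ennreal_leI flip: ennreal_plus ennreal_mult)
  qed
  also have "\<dots> = ennreal (c / 2) + ennreal (1 / (2 * c)) * (\<integral>\<^sup>+x. ennreal ((f x)\<^sup>2) \<partial>m)"
    by (simp add: nn_integral_add nn_integral_cmult m.emeasure_space_1)
  also have "\<dots> \<le> ennreal (c / 2) + ennreal (1 / (2 * c)) * ennreal (c\<^sup>2)"
    using assms by (intro add_left_mono mult_left_mono) auto
  also have "\<dots> = ennreal c"
    using \<open>0 < c\<close> by (simp add: power2_eq_square flip: ennreal_plus ennreal_mult)
  finally show ?thesis .
qed

text \<open>A random element of L^2(\<sigma>) indexed by u. With the displacement as field,
  \<open>mean\<close> is minus the derivative \<open>H_deriv\<close>.\<close>

locale L2_field = u: prob_space u + \<sigma>: prob_space \<sigma>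
  for u :: "'q measure" and \<sigma> :: "'x measure" +
  fixes f :: "'q \<Rightarrow> 'x \<Rightarrow> 'v::euclidean_space"
  assumes measurable_f [measurable]: "(\<lambda>(q, x). f q x) \<in> borel_measurable (u \<Otimes>\<^sub>M \<sigma>)"
    and finite_norm: "(\<integral>\<^sup>+q. \<integral>\<^sup>+x. ennreal ((norm (f q x))\<^sup>2) \<partial>\<sigma> \<partial>u) < \<infinity>"
begin

sublocale pair: pair_prob_space u \<sigma> ..

definition mean :: "'x \<Rightarrow> 'v" where "mean x = (\<integral>q. f q x \<partial>u)"

lemma measurable_mean [measurable]: "mean \<in> borel_measurable \<sigma>"
  unfolding mean_def[abs_def] by measurable

lemma integrable_norm_sq: "integrable (u \<Otimes>\<^sub>M \<sigma>) (\<lambda>(q, x). (norm (f q x))\<^sup>2)"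
proof (rule integrableI_bounded)
  have "(\<integral>\<^sup>+p. ennreal (norm ((\<lambda>(q, x). (norm (f q x))\<^sup>2) p)) \<partial>(u \<Otimes>\<^sub>M \<sigma>)) = (\<integral>\<^sup>+q. \<integral>\<^sup>+x. ennreal ((norm (f q x))\<^sup>2) \<partial>\<sigma> \<partial>u)"
    by (subst \<sigma>.nn_integral_fst[symmetric]) auto
  then show "(\<integral>\<^sup>+p. ennreal (norm ((\<lambda>(q, x). (norm (f q x))\<^sup>2) p)) \<partial>(u \<Otimes>\<^sub>M \<sigma>)) < \<infinity>"
    using finite_norm by simp
qed measurable

lemma AE_integrable_norm_sq: "AE x in \<sigma>. integrable u (\<lambda>q. (norm (f q x))\<^sup>2)"
  using pair.AE_integrable_snd[OF integrable_norm_sq] .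

lemma AE_integrable: "AE x in \<sigma>. integrable u (\<lambda>q. f q x)"
  using AE_integrable_norm_sq AE_space
  by eventually_elim (rule u.integrable_of_integrable_norm_sq, measurable)

lemma integrable_second_moment: "integrable u (\<lambda>q. \<integral>x. (norm (f q x))\<^sup>2 \<partial>\<sigma>)"
  using pair.integrable_fst[OF integrable_norm_sq] by simp

lemma mean_norm_sq:
  shows "integrable \<sigma> (\<lambda>x. (norm (mean x))\<^sup>2)"
    and "(\<integral>x. (norm (mean x))\<^sup>2 \<partial>\<sigma>) \<le> (\<integral>q. \<integral>x. (norm (f q x))\<^sup>2 \<partial>\<sigma> \<partial>u)"
proof -
  have le: "AE x in \<sigma>. (norm (mean x))\<^sup>2 \<le> (\<integral>q. (norm (f q x))\<^sup>2 \<partial>u)"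
    using AE_integrable AE_integrable_norm_sq
    by eventually_elim (auto simp: mean_def intro: u.norm_integral_sq_le)
  have int: "integrable \<sigma> (\<lambda>x. \<integral>q. (norm (f q x))\<^sup>2 \<partial>u)"
    using pair.integrable_snd[OF integrable_norm_sq] by simp
  show *: "integrable \<sigma> (\<lambda>x. (norm (mean x))\<^sup>2)"
    by (rule Bochner_Integration.integrable_bound[OF int]) (use le in \<open>auto elim!: AE_mp\<close>)
  have "(\<integral>x. (norm (mean x))\<^sup>2 \<partial>\<sigma>) \<le> (\<integral>x. \<integral>q. (norm (f q x))\<^sup>2 \<partial>u \<partial>\<sigma>)"
    by (rule integral_mono_AE[OF * int le])
  also have "\<dots> = (\<integral>q. \<integral>x. (norm (f q x))\<^sup>2 \<partial>\<sigma> \<partial>u)"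
    using pair.Fubini_integral[OF integrable_norm_sq] by simp
  finally show "(\<integral>x. (norm (mean x))\<^sup>2 \<partial>\<sigma>) \<le> (\<integral>q. \<integral>x. (norm (f q x))\<^sup>2 \<partial>\<sigma> \<partial>u)" .
qed

text \<open>Fubini lets the average pass into the inner product. With \<open>v\<close> the negative
  mean it gives the expected drift; with \<open>v\<close> a displacement it gives the cross term of
  the descent.\<close>

lemma integral_inner_mean:
  assumes [measurable]: "v \<in> borel_measurable \<sigma>" and v: "integrable \<sigma> (\<lambda>x. (norm (v x))\<^sup>2)"
  shows "integrable u (\<lambda>q. \<integral>x. v x \<bullet> f q x \<partial>\<sigma>)"
    and "(\<integral>q. \<integral>x. v x \<bullet> f q x \<partial>\<sigma> \<partial>u) = (\<integral>x. v x \<bullet> mean x \<partial>\<sigma>)"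
proof -
  have v': "integrable (u \<Otimes>\<^sub>M \<sigma>) (\<lambda>(q, x). (norm (v x))\<^sup>2)"
  proof (rule integrableI_bounded)
    have "(\<integral>\<^sup>+p. ennreal (norm ((\<lambda>(q, x). (norm (v x))\<^sup>2) p)) \<partial>(u \<Otimes>\<^sub>M \<sigma>)) = (\<integral>\<^sup>+x. ennreal ((norm (v x))\<^sup>2) \<partial>\<sigma>)"
      by (subst \<sigma>.nn_integral_fst[symmetric]) (auto simp: u.emeasure_space_1)
    then show "(\<integral>\<^sup>+p. ennreal (norm ((\<lambda>(q, x). (norm (v x))\<^sup>2) p)) \<partial>(u \<Otimes>\<^sub>M \<sigma>)) < \<infinity>"
      using v by (simp add: integrable_iff_bounded)
  qed measurable
  have int: "integrable (u \<Otimes>\<^sub>M \<sigma>) (\<lambda>(q, x). v x \<bullet> f q x)"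
    using v' integrable_norm_sq unfolding split_beta'
    by (intro integrable_inner_of_norm_sq) (use measurable_f in \<open>simp_all add: split_beta'\<close>)
  show "integrable u (\<lambda>q. \<integral>x. v x \<bullet> f q x \<partial>\<sigma>)"
    using pair.integrable_fst[OF int] by simp
  have "(\<integral>q. \<integral>x. v x \<bullet> f q x \<partial>\<sigma> \<partial>u) = (\<integral>x. \<integral>q. v x \<bullet> f q x \<partial>u \<partial>\<sigma>)"
    using pair.Fubini_integral[OF int] by simp
  also have "\<dots> = (\<integral>x. v x \<bullet> mean x \<partial>\<sigma>)"
  proof (rule integral_cong_AE)
    show "AE x in \<sigma>. (\<integral>q. v x \<bullet> f q x \<partial>u) = v x \<bullet> mean x"
      using AE_integrable by eventually_elim (simp add: mean_def)
  qed measurable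
  finally show "(\<integral>q. \<integral>x. v x \<bullet> f q x \<partial>\<sigma> \<partial>u) = (\<integral>x. v x \<bullet> mean x \<partial>\<sigma>)" .
qed

end

context slice_matching
begin

section \<open>The energy and its descent\<close>

definition cost :: "(real^'n) measure \<Rightarrow> real^'n^'n \<Rightarrow> real" where
  "cost \<sigma> P = (\<integral>x. (norm (disp \<sigma> P x))\<^sup>2 \<partial>\<sigma>)"

definition energy :: "(real^'n) measure \<Rightarrow> real" where
  "energy \<sigma> = (\<integral>P. cost \<sigma> P \<partial>u)"

definition slope :: "(real^'n) measure \<Rightarrow> real" where
  "slope \<sigma> = (\<integral>x. (norm (H_deriv e j u \<mu> \<sigma> x))\<^sup>2 \<partial>\<sigma>)"

definition drift :: "(real^'n) measure \<Rightarrow> real^'n^'n \<Rightarrow> real" where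
  "drift \<sigma> P = (\<integral>x. H_deriv e j u \<mu> \<sigma> x \<bullet> disp \<sigma> P x \<partial>\<sigma>)"

section \<open>Displacement bounds and the averages of \<open>cost\<close> and
  \<open>drift\<close>\<close>

lemma measurable_disp_pair:
  assumes "\<sigma> \<in> wasserstein2"
  shows "(\<lambda>(P, x). disp \<sigma> P x) \<in> borel_measurable (u \<Otimes>\<^sub>M \<sigma>)"
proof -
  note [measurable_cong] = wasserstein2D(2)[OF assms]
  have [measurable]: "(\<lambda>q. slice_map e j \<mu> \<sigma> (fst q) (snd q)) \<in> borel_measurable (u \<Otimes>\<^sub>M \<sigma>)"
    by (rule measurable_slice_map[OF const_kernel[OF assms]]) measurable
  show ?thesis unfolding split_beta' by measurable
qed

lemma measurable_disp:
  assumes "\<sigma> \<in> wasserstein2" "P \<in> orthogonal_group"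
  shows "disp \<sigma> P \<in> borel_measurable \<sigma>" "disp \<sigma> P \<in> borel_measurable borel"
proof -
  show "disp \<sigma> P \<in> borel_measurable \<sigma>"
    using measurable_Pair2[OF measurable_disp_pair[OF assms(1)], of P] assms(2) by (simp add: space_u)
  then show "disp \<sigma> P \<in> borel_measurable borel"
    using measurable_cong_sets[OF wasserstein2D(2)[OF assms(1)] refl] by blast
qed

text \<open>One-dimensional optimality summed over the first \<open>j\<close> columns. The
  competitors \<open>Y i\<close> may be chosen separately in each direction and need not be
  projections of one vector, a freedom exploited in \<open>cost_slice_step_le\<close>.\<close>

lemma disp_cost_le:
  assumes \<sigma>: "\<sigma> \<in> wasserstein2_ac" and P: "P \<in> orthogonal_group" and \<pi>: "prob_space \<pi>"
    and X[measurable]: "X \<in> borel_measurable \<pi>" and Y[measurable]: "\<And>i. Y i \<in> borel_measurable \<pi>"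
    and law: "distr \<pi> borel X = \<sigma>" "\<And>i. i \<in> {1..j} \<Longrightarrow> distr \<pi> borel (Y i) = slice \<mu> (dir P i)"
  shows "(\<integral>\<^sup>+x. ennreal ((norm (disp \<sigma> P x))\<^sup>2) \<partial>\<sigma>) \<le> (\<integral>\<^sup>+w. ennreal (\<Sum>i=1..j. (X w \<bullet> dir P i - Y i w)\<^sup>2) \<partial>\<pi>)"
proof -
  note \<sigma>' = wasserstein2_acD[OF \<sigma>]
  note [measurable_cong] = wasserstein2D(2)[OF \<sigma>']
  let ?T = "\<lambda>i. ot_map (slice \<sigma> (dir P i)) (slice \<mu> (dir P i))"
  have rd: "real_distribution (slice \<sigma> \<theta>)" "real_distribution (slice \<mu> \<theta>)" for \<theta>
    using wasserstein2D[OF \<sigma>'] wasserstein2D[OF \<mu>] by (auto intro: real_distribution_slice)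
  have [measurable]: "?T i \<in> borel_measurable borel" for i
    by (rule borel_measurable_ot_map[OF rd(1) rd(2)])
  have slice_int: "(\<integral>\<^sup>+x. F (x \<bullet> \<theta>) \<partial>\<sigma>) = (\<integral>\<^sup>+s. F s \<partial>slice \<sigma> \<theta>)"
    if [measurable]: "F \<in> borel_measurable borel" for F :: "real \<Rightarrow> ennreal" and \<theta>
    unfolding slice_def by (subst nn_integral_distr) auto
  have "(\<integral>\<^sup>+x. ennreal ((norm (disp \<sigma> P x))\<^sup>2) \<partial>\<sigma>) = (\<integral>\<^sup>+x. (\<Sum>i=1..j. ennreal ((x \<bullet> dir P i - ?T i (x \<bullet> dir P i))\<^sup>2)) \<partial>\<sigma>)"
    unfolding norm_disp[OF P] by (intro nn_integral_cong) (simp add: sum_ennreal)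
  also have "\<dots> = (\<Sum>i=1..j. \<integral>\<^sup>+x. ennreal ((x \<bullet> dir P i - ?T i (x \<bullet> dir P i))\<^sup>2) \<partial>\<sigma>)"
    by (rule nn_integral_sum) measurable
  also have "\<dots> \<le> (\<Sum>i=1..j. \<integral>\<^sup>+w. ennreal ((X w \<bullet> dir P i - Y i w)\<^sup>2) \<partial>\<pi>)"
  proof (rule sum_mono)
    fix i assume i: "i \<in> {1..j}"
    have "(\<integral>\<^sup>+x. ennreal ((x \<bullet> dir P i - ?T i (x \<bullet> dir P i))\<^sup>2) \<partial>\<sigma>) = (\<integral>\<^sup>+s. ennreal ((s - ?T i s)\<^sup>2) \<partial>slice \<sigma> (dir P i))"
      by (rule slice_int) measurable
    also have "\<dots> \<le> (\<integral>\<^sup>+w. ennreal ((X w \<bullet> dir P i - Y i w)\<^sup>2) \<partial>\<pi>)"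
    proof (rule ot_map_optimal)
      show "atomless (slice \<sigma> (dir P i))"
        using i j_le by (intro atomless_slice[OF \<sigma>] dir_nonzero[OF P]) auto
      show "distr \<pi> borel (\<lambda>w. X w \<bullet> dir P i) = slice \<sigma> (dir P i)"
        unfolding law(1)[symmetric] slice_def by (subst distr_distr) (auto simp: comp_def)
    qed (use \<pi> rd law(2)[OF i] in auto)
    finally show "(\<integral>\<^sup>+x. ennreal ((x \<bullet> dir P i - ?T i (x \<bullet> dir P i))\<^sup>2) \<partial>\<sigma>) \<le> (\<integral>\<^sup>+w. ennreal ((X w \<bullet> dir P i - Y i w)\<^sup>2) \<partial>\<pi>)" .
  qed
  also have "\<dots> = (\<integral>\<^sup>+w. (\<Sum>i=1..j. ennreal ((X w \<bullet> dir P i - Y i w)\<^sup>2)) \<partial>\<pi>)"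
    by (rule nn_integral_sum[symmetric]) measurable
  also have "\<dots> = (\<integral>\<^sup>+w. ennreal (\<Sum>i=1..j. (X w \<bullet> dir P i - Y i w)\<^sup>2) \<partial>\<pi>)"
    by (intro nn_integral_cong) (simp add: sum_ennreal)
  finally show ?thesis .
qed

text \<open>A near-optimal coupling of \<sigma> and \<mu>, projected to the columns, supplies
  competitors, and by Bessel's inequality these cost no more than the coupling. Then
  \<open>c\<close> decreases to the distance.\<close>

lemma disp_norm_sq_le_W2:
  assumes \<sigma>: "\<sigma> \<in> wasserstein2_ac" and P: "P \<in> orthogonal_group"
  shows "(\<integral>\<^sup>+x. ennreal ((norm (disp \<sigma> P x))\<^sup>2) \<partial>\<sigma>) \<le> ennreal ((W2 \<sigma> \<mu>)\<^sup>2)"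
proof (rule tendsto_lowerbound)
  show "((\<lambda>c. ennreal (c\<^sup>2)) \<longlongrightarrow> ennreal ((W2 \<sigma> \<mu>)\<^sup>2)) (at_right (W2 \<sigma> \<mu>))"
    by (intro tendsto_ennrealI tendsto_intros)
  have "(\<integral>\<^sup>+x. ennreal ((norm (disp \<sigma> P x))\<^sup>2) \<partial>\<sigma>) \<le> ennreal (c\<^sup>2)" if c_gt: "W2 \<sigma> \<mu> < c" for c
  proof -
    obtain \<pi> where \<pi>: "\<pi> \<in> couplings \<sigma> \<mu>" and c: "(\<integral>\<^sup>+ p. ennreal ((dist (fst p) (snd p))\<^sup>2) \<partial>\<pi>) < ennreal (c\<^sup>2)"
      using W2_less_imp_coupling[OF wasserstein2_acD[OF \<sigma>] \<mu> c_gt] .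
    note [measurable] = couplingsD(4,5)[OF \<pi>]
    have "(\<integral>\<^sup>+x. ennreal ((norm (disp \<sigma> P x))\<^sup>2) \<partial>\<sigma>) \<le> (\<integral>\<^sup>+p. ennreal (\<Sum>i=1..j. (fst p \<bullet> dir P i - snd p \<bullet> dir P i)\<^sup>2) \<partial>\<pi>)"
    proof (rule disp_cost_le[OF \<sigma> P])
      show "prob_space \<pi>" using couplings_prob_space[OF \<pi>] wasserstein2D[OF wasserstein2_acD[OF \<sigma>]] by simp
      show "distr \<pi> borel (\<lambda>p. snd p \<bullet> dir P i) = slice \<mu> (dir P i)" for i
        unfolding couplingsD(3)[OF \<pi>, symmetric] slice_def by (subst distr_distr) (auto simp: comp_def)
    qed (use couplingsD[OF \<pi>] in measurable)
    also have "\<dots> \<le> (\<integral>\<^sup>+ p. ennreal ((dist (fst p) (snd p))\<^sup>2) \<partial>\<pi>)"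
    proof (intro nn_integral_mono ennreal_leI)
      fix p :: "(real^'n) \<times> (real^'n)"
      show "(\<Sum>i=1..j. (fst p \<bullet> dir P i - snd p \<bullet> dir P i)\<^sup>2) \<le> (dist (fst p) (snd p))\<^sup>2"
        using bessel[OF P, of "fst p - snd p"] by (simp add: inner_diff_left dist_norm)
    qed
    finally show ?thesis using c by simp
  qed
  then show "\<forall>\<^sub>F c in at_right (W2 \<sigma> \<mu>). (\<integral>\<^sup>+x. ennreal ((norm (disp \<sigma> P x))\<^sup>2) \<partial>\<sigma>) \<le> ennreal (c\<^sup>2)"
    by (simp add: eventually_at_right_less eventually_at_filter)
qed simp

lemma integrable_disp_norm_sq:
  assumes \<sigma>: "\<sigma> \<in> wasserstein2_ac" and P: "P \<in> orthogonal_group"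
  shows "integrable \<sigma> (\<lambda>x. (norm (disp \<sigma> P x))\<^sup>2)"
proof (rule integrableI_bounded)
  show "(\<integral>\<^sup>+x. ennreal (norm ((norm (disp \<sigma> P x))\<^sup>2)) \<partial>\<sigma>) < \<infinity>"
    using disp_norm_sq_le_W2[OF assms] by (auto intro: le_less_trans)
qed (use measurable_disp(1)[OF wasserstein2_acD[OF \<sigma>] P] in measurable)

lemma cost_nonneg: "0 \<le> cost \<sigma> P"
  by (simp add: cost_def)

lemma cost_le_W2:
  assumes "\<sigma> \<in> wasserstein2_ac" "P \<in> orthogonal_group"
  shows "cost \<sigma> P \<le> (W2 \<sigma> \<mu>)\<^sup>2"
  using disp_norm_sq_le_W2[OF assms] nn_integral_eq_integral[OF integrable_disp_norm_sq[OF assms]]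
  by (simp add: cost_def)

lemma L2_field_disp:
  assumes \<sigma>: "\<sigma> \<in> wasserstein2_ac"
  shows "L2_field u \<sigma> (disp \<sigma>)"
proof -
  note \<sigma>' = wasserstein2_acD[OF \<sigma>]
  interpret \<sigma>: prob_space \<sigma> using wasserstein2D[OF \<sigma>'] by simp
  show ?thesis
  proof unfold_locales
    show "(\<lambda>(q, x). disp \<sigma> q x) \<in> borel_measurable (u \<Otimes>\<^sub>M \<sigma>)" by (rule measurable_disp_pair[OF \<sigma>'])
    have "(\<integral>\<^sup>+q. \<integral>\<^sup>+x. ennreal ((norm (disp \<sigma> q x))\<^sup>2) \<partial>\<sigma> \<partial>u) \<le> (\<integral>\<^sup>+q. ennreal ((W2 \<sigma> \<mu>)\<^sup>2) \<partial>u)"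
      by (intro nn_integral_mono disp_norm_sq_le_W2[OF \<sigma>]) (simp add: space_u)
    also have "\<dots> < \<infinity>" by (simp add: u.emeasure_space_1)
    finally show "(\<integral>\<^sup>+q. \<integral>\<^sup>+x. ennreal ((norm (disp \<sigma> q x))\<^sup>2) \<partial>\<sigma> \<partial>u) < \<infinity>" .
  qed
qed

lemma H_deriv_eq_mean:
  assumes "\<sigma> \<in> wasserstein2_ac"
  shows "H_deriv e j u \<mu> \<sigma> x = - L2_field.mean u (disp \<sigma>) x"
proof -
  interpret L2_field u \<sigma> "disp \<sigma>" by (rule L2_field_disp[OF assms])
  show ?thesis unfolding mean_def by (subst integral_minus[symmetric]) (simp add: H_deriv_def)
qed

text \<open>All six facts are read off from \<open>L2_field\<close>. Jensen gives
  \<open>slope_le_energy\<close>; Fubini gives \<open>integral_drift\<close>, which centres the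
  noise.\<close>

lemma
  assumes \<sigma>: "\<sigma> \<in> wasserstein2_ac"
  shows measurable_H: "H_deriv e j u \<mu> \<sigma> \<in> borel_measurable \<sigma>"
    and integrable_H_norm_sq: "integrable \<sigma> (\<lambda>x. (norm (H_deriv e j u \<mu> \<sigma> x))\<^sup>2)"
    and slope_le_energy: "slope \<sigma> \<le> energy \<sigma>"
    and integrable_cost: "integrable u (cost \<sigma>)"
    and integrable_drift: "integrable u (drift \<sigma>)"
    and integral_drift: "(\<integral>P. drift \<sigma> P \<partial>u) = - slope \<sigma>"
proof -
  interpret L2_field u \<sigma> "disp \<sigma>" by (rule L2_field_disp[OF assms])
  have H: "H_deriv e j u \<mu> \<sigma> = (\<lambda>x. - mean x)" using H_deriv_eq_mean[OF \<sigma>] by auto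
  show "H_deriv e j u \<mu> \<sigma> \<in> borel_measurable \<sigma>" unfolding H by measurable
  show "integrable \<sigma> (\<lambda>x. (norm (H_deriv e j u \<mu> \<sigma> x))\<^sup>2)"
    "slope \<sigma> \<le> energy \<sigma>" "integrable u (cost \<sigma>)"
    using mean_norm_sq integrable_second_moment by (simp_all add: H slope_def energy_def cost_def[abs_def])
  have v: "(\<lambda>x. - mean x) \<in> borel_measurable \<sigma>" "integrable \<sigma> (\<lambda>x. (norm (- mean x))\<^sup>2)"
    using mean_norm_sq(1) by auto
  show "integrable u (drift \<sigma>)" "(\<integral>P. drift \<sigma> P \<partial>u) = - slope \<sigma>"
    using integral_inner_mean[OF v] by (simp_all add: H drift_def[abs_def] slope_def power2_norm_eq_inner)
qed

lemma slope_nonneg: "0 \<le> slope \<sigma>"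
  by (simp add: slope_def)

lemma energy_le_W2:
  assumes "\<sigma> \<in> wasserstein2_ac"
  shows "energy \<sigma> \<le> (W2 \<sigma> \<mu>)\<^sup>2"
proof -
  have "energy \<sigma> \<le> (\<integral>P. (W2 \<sigma> \<mu>)\<^sup>2 \<partial>u)"
    unfolding energy_def by (intro integral_mono integrable_cost assms cost_le_W2) (auto simp: space_u)
  then show ?thesis by (simp add: u.prob_space)
qed

lemma abs_drift_le:
  assumes \<sigma>: "\<sigma> \<in> wasserstein2_ac" and P: "P \<in> orthogonal_group"
  shows "\<bar>drift \<sigma> P\<bar> \<le> (W2 \<sigma> \<mu>)\<^sup>2"
proof -
  note int = integrable_H_norm_sq[OF \<sigma>] integrable_disp_norm_sq[OF assms]
  have "\<bar>drift \<sigma> P\<bar> \<le> (\<integral>x. \<bar>H_deriv e j u \<mu> \<sigma> x \<bullet> disp \<sigma> P x\<bar> \<partial>\<sigma>)"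
    unfolding drift_def by (rule integral_abs_bound)
  also have "\<dots> \<le> (\<integral>x. ((norm (H_deriv e j u \<mu> \<sigma> x))\<^sup>2 + (norm (disp \<sigma> P x))\<^sup>2) / 2 \<partial>\<sigma>)"
    using int by (intro integral_mono abs_inner_le_sum_squares integrable_abs integrable_inner_of_norm_sq
      measurable_H[OF \<sigma>] measurable_disp(1)[OF wasserstein2_acD[OF \<sigma>] P]) auto
  also have "\<dots> = (slope \<sigma> + cost \<sigma> P) / 2"
    using int by (simp add: slope_def cost_def)
  also have "\<dots> \<le> (W2 \<sigma> \<mu>)\<^sup>2"
    using slope_le_energy[OF \<sigma>] energy_le_W2[OF \<sigma>] cost_le_W2[OF assms] by simp
  finally show ?thesis .
qed

text \<open>The moved point \<open>x + c *\<^sub>R disp \<sigma> P x\<close> is matched with the old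
  targets, the images of the projections of \<open>x\<close> under the maps for \<sigma>. Their laws
  are still the slices of \<mu>, so the new cost is at most that of a difference of two
  displacements, whose square is expanded.\<close>

lemma cost_slice_step_le:
  assumes \<sigma>: "\<sigma> \<in> wasserstein2_ac" and P: "P \<in> orthogonal_group" and Q: "Q \<in> orthogonal_group"
    and \<sigma>': "slice_step e j \<mu> c P \<sigma> \<in> wasserstein2_ac"
  shows "cost (slice_step e j \<mu> c P \<sigma>) Q \<le> cost \<sigma> Q - 2 * c * (\<integral>x. disp \<sigma> P x \<bullet> disp \<sigma> Q x \<partial>\<sigma>) + c\<^sup>2 * cost \<sigma> P"
proof -
  let ?\<sigma>' = "slice_step e j \<mu> c P \<sigma>"
  note W = wasserstein2D[OF wasserstein2_acD[OF \<sigma>]]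
  note [measurable_cong] = W(2)
  note [measurable] = measurable_disp(1)[OF wasserstein2_acD[OF \<sigma>] P] measurable_disp(1)[OF wasserstein2_acD[OF \<sigma>] Q]
  interpret \<sigma>: prob_space \<sigma> by (rule W)
  let ?T = "\<lambda>i. ot_map (slice \<sigma> (dir Q i)) (slice \<mu> (dir Q i))"
  have rd: "real_distribution (slice \<sigma> \<theta>)" "real_distribution (slice \<mu> \<theta>)" for \<theta>
    using W wasserstein2D[OF \<mu>] by (auto intro: real_distribution_slice)
  have T[measurable]: "?T i \<in> borel_measurable borel" for i
    by (rule borel_measurable_ot_map[OF rd(1) rd(2)])
  have slice_distr: "distr \<sigma> borel (\<lambda>x. F (x \<bullet> \<theta>)) = distr (slice \<sigma> \<theta>) borel F"
    if [measurable]: "F \<in> borel_measurable borel" for F :: "real \<Rightarrow> real" and \<theta>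
    unfolding slice_def by (subst distr_distr) (auto simp: comp_def)
  have int_inner: "integrable \<sigma> (\<lambda>x. disp \<sigma> P x \<bullet> disp \<sigma> Q x)"
    by (intro integrable_inner_of_norm_sq integrable_disp_norm_sq \<sigma> P Q) measurable
  have expand: "(norm (disp \<sigma> Q x - c *\<^sub>R disp \<sigma> P x))\<^sup>2
      = (norm (disp \<sigma> Q x))\<^sup>2 - 2 * c * (disp \<sigma> P x \<bullet> disp \<sigma> Q x) + c\<^sup>2 * (norm (disp \<sigma> P x))\<^sup>2" for x
    unfolding power2_norm_eq_inner inner_diff_left inner_diff_right inner_scaleR_left inner_scaleR_right
    by (simp add: inner_commute power2_eq_square algebra_simps)
  have int: "integrable \<sigma> (\<lambda>x. (norm (disp \<sigma> Q x - c *\<^sub>R disp \<sigma> P x))\<^sup>2)"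
    unfolding expand using int_inner integrable_disp_norm_sq[OF \<sigma> P] integrable_disp_norm_sq[OF \<sigma> Q] by simp
  let ?X = "\<lambda>x. (1 - c) *\<^sub>R x + c *\<^sub>R slice_map e j \<mu> \<sigma> P x"
  have X: "?X x = x + c *\<^sub>R disp \<sigma> P x" for x by (simp add: algebra_simps)
  have "(\<integral>\<^sup>+x. ennreal ((norm (disp ?\<sigma>' Q x))\<^sup>2) \<partial>?\<sigma>') \<le> (\<integral>\<^sup>+x. ennreal (\<Sum>i=1..j. (?X x \<bullet> dir Q i - ?T i (x \<bullet> dir Q i))\<^sup>2) \<partial>\<sigma>)"
  proof (rule disp_cost_le[OF \<sigma>' Q \<sigma>.prob_space_axioms])
    show "?X \<in> borel_measurable \<sigma>" unfolding X by measurable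
    show "(\<lambda>x. ?T i (x \<bullet> dir Q i)) \<in> borel_measurable \<sigma>" for i by measurable
    show "distr \<sigma> borel ?X = ?\<sigma>'" by (simp add: slice_step_def)
    fix i assume i: "i \<in> {1..j}"
    have "distr \<sigma> borel (\<lambda>x. ?T i (x \<bullet> dir Q i)) = distr (slice \<sigma> (dir Q i)) borel (?T i)"
      by (rule slice_distr) measurable
    also have "\<dots> = slice \<mu> (dir Q i)"
      using i j_le by (intro distr_ot_map rd atomless_slice[OF \<sigma>] dir_nonzero[OF Q]) auto
    finally show "distr \<sigma> borel (\<lambda>x. ?T i (x \<bullet> dir Q i)) = slice \<mu> (dir Q i)" .
  qed
  \<comment> \<open>The step in frame P may have components outside the first \<open>j\<close>
    columns of Q; Bessel's inequality accounts for them.\<close>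
  also have "\<dots> \<le> (\<integral>\<^sup>+x. ennreal ((norm (disp \<sigma> Q x - c *\<^sub>R disp \<sigma> P x))\<^sup>2) \<partial>\<sigma>)"
  proof (intro nn_integral_mono ennreal_leI)
    fix x
    have "(\<Sum>i=1..j. (?X x \<bullet> dir Q i - ?T i (x \<bullet> dir Q i))\<^sup>2) = (\<Sum>i=1..j. ((disp \<sigma> Q x - c *\<^sub>R disp \<sigma> P x) \<bullet> dir Q i)\<^sup>2)"
    proof (intro sum.cong refl)
      fix i assume "i \<in> {1..j}"
      from inner_disp_dir[OF Q this, of \<sigma> x]
      have "?X x \<bullet> dir Q i - ?T i (x \<bullet> dir Q i) = - ((disp \<sigma> Q x - c *\<^sub>R disp \<sigma> P x) \<bullet> dir Q i)"
        unfolding X by (simp add: inner_add_left inner_diff_left)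
      then show "(?X x \<bullet> dir Q i - ?T i (x \<bullet> dir Q i))\<^sup>2 = ((disp \<sigma> Q x - c *\<^sub>R disp \<sigma> P x) \<bullet> dir Q i)\<^sup>2"
        by (simp only: power2_minus)
    qed
    also have "\<dots> \<le> (norm (disp \<sigma> Q x - c *\<^sub>R disp \<sigma> P x))\<^sup>2" by (rule bessel[OF Q])
    finally show "(\<Sum>i=1..j. (?X x \<bullet> dir Q i - ?T i (x \<bullet> dir Q i))\<^sup>2) \<le> (norm (disp \<sigma> Q x - c *\<^sub>R disp \<sigma> P x))\<^sup>2" .
  qed
  finally have "cost ?\<sigma>' Q \<le> (\<integral>x. (norm (disp \<sigma> Q x - c *\<^sub>R disp \<sigma> P x))\<^sup>2 \<partial>\<sigma>)"
    using nn_integral_eq_integral[OF integrable_disp_norm_sq[OF \<sigma>' Q]] nn_integral_eq_integral[OF int]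
    by (simp add: cost_def)
  also have "\<dots> = cost \<sigma> Q - 2 * c * (\<integral>x. disp \<sigma> P x \<bullet> disp \<sigma> Q x \<partial>\<sigma>) + c\<^sup>2 * cost \<sigma> P"
    unfolding expand cost_def
    using int_inner integrable_disp_norm_sq[OF \<sigma> P] integrable_disp_norm_sq[OF \<sigma> Q] by simp
  finally show ?thesis .
qed

text \<open>Averaging \<open>cost_slice_step_le\<close> over Q replaces the second displacement in
  the cross term by its mean, that is by -H', so the cross term becomes the drift.\<close>

theorem energy_descent:
  assumes \<sigma>: "\<sigma> \<in> wasserstein2_ac" and P: "P \<in> orthogonal_group"
    and \<sigma>': "slice_step e j \<mu> c P \<sigma> \<in> wasserstein2_ac"
  shows "energy (slice_step e j \<mu> c P \<sigma>) \<le> energy \<sigma> + 2 * c * drift \<sigma> P + c\<^sup>2 * (W2 \<sigma> \<mu>)\<^sup>2"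
proof -
  interpret L2_field u \<sigma> "disp \<sigma>" by (rule L2_field_disp[OF \<sigma>])
  note inner = integral_inner_mean[OF measurable_disp(1)[OF wasserstein2_acD[OF \<sigma>] P] integrable_disp_norm_sq[OF \<sigma> P]]
  have "energy (slice_step e j \<mu> c P \<sigma>) \<le> (\<integral>Q. cost \<sigma> Q - 2 * c * (\<integral>x. disp \<sigma> P x \<bullet> disp \<sigma> Q x \<partial>\<sigma>) + c\<^sup>2 * cost \<sigma> P \<partial>u)"
    unfolding energy_def
  proof (rule integral_mono)
    show "integrable u (\<lambda>Q. cost \<sigma> Q - 2 * c * (\<integral>x. disp \<sigma> P x \<bullet> disp \<sigma> Q x \<partial>\<sigma>) + c\<^sup>2 * cost \<sigma> P)"
      using integrable_cost[OF \<sigma>] inner(1) by simp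
  qed (auto simp: space_u intro: integrable_cost[OF \<sigma>'] cost_slice_step_le[OF \<sigma> P _ \<sigma>'])
  also have "\<dots> = energy \<sigma> - 2 * c * (\<integral>x. disp \<sigma> P x \<bullet> mean x \<partial>\<sigma>) + c\<^sup>2 * cost \<sigma> P"
    using integrable_cost[OF \<sigma>] inner by (simp add: energy_def u.prob_space)
  also have "(\<integral>x. disp \<sigma> P x \<bullet> mean x \<partial>\<sigma>) = - drift \<sigma> P"
    by (simp add: drift_def H_deriv_eq_mean[OF \<sigma>] inner_commute)
  also have "energy \<sigma> - 2 * c * (- drift \<sigma> P) + c\<^sup>2 * cost \<sigma> P \<le> energy \<sigma> + 2 * c * drift \<sigma> P + c\<^sup>2 * (W2 \<sigma> \<mu>)\<^sup>2"
    using mult_left_mono[OF cost_le_W2[OF \<sigma> P], of "c\<^sup>2"] by simp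
  finally show ?thesis .
qed

section \<open>Stability of the derivative\<close>

lemma slice_first_moment_finite: "(\<integral>\<^sup>+y. ennreal \<bar>y\<bar> \<partial>slice \<mu> \<theta>) < \<infinity>"
proof -
  note [measurable_cong] = wasserstein2D(2)[OF \<mu>]
  have "integrable \<mu> (\<lambda>x. x \<bullet> \<theta>)"
    using \<mu>.integrable_of_integrable_norm_sq[OF _ wasserstein2D(4)[OF \<mu>]] by simp
  then show ?thesis unfolding slice_def
    by (subst nn_integral_distr) (auto simp: integrable_iff_bounded)
qed

text \<open>For a fixed frame each of the first \<open>j\<close> coordinates is a one-dimensional
  problem under the projected couplings: \<open>ot_map_stability\<close> handles the transport part,
  the second moment bound the identity part.\<close>

lemma disp_stability:
  assumes \<sigma>: "\<And>k. \<sigma> k \<in> wasserstein2_ac" and \<eta>: "\<eta> \<in> wasserstein2_ac" and P: "P \<in> orthogonal_group"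
    and \<pi>: "\<And>k. \<pi> k \<in> couplings (\<sigma> k) \<eta>"
    and lim: "(\<lambda>k. \<integral>\<^sup>+p. ennreal ((dist (fst p) (snd p))\<^sup>2) \<partial>\<pi> k) \<longlonglongrightarrow> 0"
  shows "(\<lambda>k. \<integral>\<^sup>+p. ennreal (norm (disp (\<sigma> k) P (fst p) - disp \<eta> P (snd p))) \<partial>\<pi> k) \<longlonglongrightarrow> 0"
proof -
  note W = wasserstein2D[OF wasserstein2_acD[OF \<sigma>]] and W\<eta> = wasserstein2D[OF wasserstein2_acD[OF \<eta>]]
  note [measurable] = couplingsD(4,5)[OF \<pi>]
  have \<pi>p: "prob_space (\<pi> k)" for k using couplings_prob_space[OF \<pi>] W(1) by blast
  define T where "T k i = ot_map (slice (\<sigma> k) (dir P i)) (slice \<mu> (dir P i))" for k i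
  define T' where "T' i = ot_map (slice \<eta> (dir P i)) (slice \<mu> (dir P i))" for i
  have [measurable]: "T k i \<in> borel_measurable borel" "T' i \<in> borel_measurable borel" for k i
    using W W\<eta> wasserstein2D[OF \<mu>] unfolding T_def T'_def
    by (auto intro!: borel_measurable_ot_map real_distribution_slice)
  define A where "A k i = (\<integral>\<^sup>+p. ennreal \<bar>T k i (fst p \<bullet> dir P i) - T' i (snd p \<bullet> dir P i)\<bar> \<partial>\<pi> k)" for k i
  define B where "B k i = (\<integral>\<^sup>+p. ennreal \<bar>fst p \<bullet> dir P i - snd p \<bullet> dir P i\<bar> \<partial>\<pi> k)" for k i
  have lim': "(\<lambda>k. \<integral>\<^sup>+p. ennreal ((fst p \<bullet> dir P i - snd p \<bullet> dir P i)\<^sup>2) \<partial>\<pi> k) \<longlonglongrightarrow> 0" if i: "i \<in> {1..j}" for i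
  proof (rule tendsto_sandwich[OF _ _ tendsto_const lim])
    have "(fst p \<bullet> dir P i - snd p \<bullet> dir P i)\<^sup>2 \<le> (dist (fst p) (snd p))\<^sup>2" for p :: "(real^'n) \<times> (real^'n)"
    proof -
      have "((fst p - snd p) \<bullet> dir P i)\<^sup>2 \<le> (\<Sum>i=1..j. ((fst p - snd p) \<bullet> dir P i)\<^sup>2)"
        using i by (intro member_le_sum) auto
      also have "\<dots> \<le> (dist (fst p) (snd p))\<^sup>2" using bessel[OF P] by (simp add: dist_norm)
      finally show ?thesis by (simp add: inner_diff_left)
    qed
    then show "\<forall>\<^sub>F k in sequentially. (\<integral>\<^sup>+p. ennreal ((fst p \<bullet> dir P i - snd p \<bullet> dir P i)\<^sup>2) \<partial>\<pi> k) \<le> (\<integral>\<^sup>+p. ennreal ((dist (fst p) (snd p))\<^sup>2) \<partial>\<pi> k)"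
      by (intro always_eventually allI nn_integral_mono ennreal_leI)
  qed simp
  have A: "(\<lambda>k. A k i) \<longlonglongrightarrow> 0" if i: "i \<in> {1..j}" for i
    unfolding A_def T_def T'_def
  proof (rule ot_map_stability)
    show "real_distribution (slice \<mu> (dir P i))" using wasserstein2D[OF \<mu>] by (intro real_distribution_slice)
    show "(\<integral>\<^sup>+y. ennreal \<bar>y\<bar> \<partial>slice \<mu> (dir P i)) < \<infinity>" by (rule slice_first_moment_finite)
    have "dir P i \<noteq> 0" using i j_le by (intro dir_nonzero[OF P]) auto
    then show "atomless (slice (\<sigma> k) (dir P i))" "atomless (slice \<eta> (dir P i))" for k
      by (intro atomless_slice \<sigma> \<eta>; simp)+
    show "distr (\<pi> k) borel (\<lambda>p. fst p \<bullet> dir P i) = slice (\<sigma> k) (dir P i)" for k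
      unfolding couplingsD(2)[OF \<pi>[of k], symmetric] slice_def by (subst distr_distr) (auto simp: comp_def)
    show "distr (\<pi> k) borel (\<lambda>p. snd p \<bullet> dir P i) = slice \<eta> (dir P i)" for k
      unfolding couplingsD(3)[OF \<pi>[of k], symmetric] slice_def by (subst distr_distr) (auto simp: comp_def)
  qed (use \<pi>p lim'[OF i] in auto)
  have B: "(\<lambda>k. B k i) \<longlonglongrightarrow> 0" if i: "i \<in> {1..j}" for i
  proof (rule order_tendstoI)
    fix \<epsilon> :: ennreal assume "0 < \<epsilon>"
    then obtain s where s: "0 < s" "s < \<epsilon>" using dense by blast
    then have "s \<noteq> top" by auto
    with s obtain r where r: "0 < r" "ennreal r < \<epsilon>" by (cases s) (auto simp: ennreal_less_zero_iff)
    have "eventually (\<lambda>k. (\<integral>\<^sup>+p. ennreal ((fst p \<bullet> dir P i - snd p \<bullet> dir P i)\<^sup>2) \<partial>\<pi> k) < ennreal (r\<^sup>2)) sequentially"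
      using r by (intro order_tendstoD(2)[OF lim'[OF i]]) simp
    then show "eventually (\<lambda>k. B k i < \<epsilon>) sequentially"
    proof eventually_elim
      case (elim k)
      have "B k i \<le> ennreal r" unfolding B_def
        by (rule nn_integral_abs_first_moment_le[OF \<pi>p _ r(1)]) (use elim in auto)
      then show ?case using r(2) by simp
    qed
  qed simp
  have "(\<lambda>k. \<Sum>i=1..j. A k i + B k i) \<longlonglongrightarrow> (\<Sum>i=1..j. 0 + 0)"
    by (intro tendsto_sum tendsto_add A B)
  then have lim_sum: "(\<lambda>k. \<Sum>i=1..j. A k i + B k i) \<longlonglongrightarrow> 0" by simp
  have "(\<integral>\<^sup>+p. ennreal (norm (disp (\<sigma> k) P (fst p) - disp \<eta> P (snd p))) \<partial>\<pi> k) \<le> (\<Sum>i=1..j. A k i + B k i)" for k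
  proof -
    have "norm (disp (\<sigma> k) P x - disp \<eta> P y) \<le> (\<Sum>i=1..j. \<bar>T k i (x \<bullet> dir P i) - T' i (y \<bullet> dir P i)\<bar> + \<bar>x \<bullet> dir P i - y \<bullet> dir P i\<bar>)" for x y
    proof -
      have eq: "disp (\<sigma> k) P x - disp \<eta> P y = (\<Sum>i=1..j. ((T k i (x \<bullet> dir P i) - T' i (y \<bullet> dir P i)) - (x \<bullet> dir P i - y \<bullet> dir P i)) *\<^sub>R dir P i)"
        unfolding disp_eq[OF P] T_def T'_def sum_subtractf[symmetric] scaleR_diff_left[symmetric]
        by (intro sum.cong refl arg_cong2[where f=scaleR]) simp
      have "norm (disp (\<sigma> k) P x - disp \<eta> P y) \<le> (\<Sum>i=1..j. norm (((T k i (x \<bullet> dir P i) - T' i (y \<bullet> dir P i)) - (x \<bullet> dir P i - y \<bullet> dir P i)) *\<^sub>R dir P i))"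
        unfolding eq by (rule norm_sum)
      also have "\<dots> \<le> (\<Sum>i=1..j. \<bar>T k i (x \<bullet> dir P i) - T' i (y \<bullet> dir P i)\<bar> + \<bar>x \<bullet> dir P i - y \<bullet> dir P i\<bar>)"
      proof (rule sum_mono)
        fix i assume "i \<in> {1..j}"
        then have "norm (dir P i) = 1" using dir_orthonormal[OF P, of i i] j_le by (auto simp: norm_eq_1)
        then show "norm (((T k i (x \<bullet> dir P i) - T' i (y \<bullet> dir P i)) - (x \<bullet> dir P i - y \<bullet> dir P i)) *\<^sub>R dir P i)
            \<le> \<bar>T k i (x \<bullet> dir P i) - T' i (y \<bullet> dir P i)\<bar> + \<bar>x \<bullet> dir P i - y \<bullet> dir P i\<bar>"
          by simp
      qed
      finally show ?thesis .
    qed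
    then have "(\<integral>\<^sup>+p. ennreal (norm (disp (\<sigma> k) P (fst p) - disp \<eta> P (snd p))) \<partial>\<pi> k)
        \<le> (\<integral>\<^sup>+p. ennreal (\<Sum>i=1..j. \<bar>T k i (fst p \<bullet> dir P i) - T' i (snd p \<bullet> dir P i)\<bar> + \<bar>fst p \<bullet> dir P i - snd p \<bullet> dir P i\<bar>) \<partial>\<pi> k)"
      by (intro nn_integral_mono ennreal_leI)
    also have "\<dots> = (\<integral>\<^sup>+p. (\<Sum>i=1..j. ennreal \<bar>T k i (fst p \<bullet> dir P i) - T' i (snd p \<bullet> dir P i)\<bar> + ennreal \<bar>fst p \<bullet> dir P i - snd p \<bullet> dir P i\<bar>) \<partial>\<pi> k)"
      by (intro nn_integral_cong) (simp add: sum_ennreal[symmetric])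
    also have "\<dots> = (\<Sum>i=1..j. A k i + B k i)"
      unfolding A_def B_def by (simp add: nn_integral_sum nn_integral_add)
    finally show ?thesis .
  qed
  then show ?thesis
    by (intro tendsto_sandwich[OF _ _ tendsto_const lim_sum]) auto
qed

text \<open>In L^1 along near-optimal couplings, H' at \<eta> is bounded by H' at
  \<open>\<sigma> k\<close> plus the averaged difference of displacements. The first is at most the
  root of the slope; the second vanishes by \<open>disp_stability\<close> and dominated convergence
  over the frames.\<close>

theorem H_deriv_limit_zero:
  assumes \<sigma>: "\<And>k. \<sigma> k \<in> wasserstein2_ac" and \<eta>: "\<eta> \<in> wasserstein2_ac"
    and lim: "(\<lambda>k. W2 (\<sigma> k) \<eta>) \<longlonglongrightarrow> 0" and slope: "(\<lambda>k. slope (\<sigma> k)) \<longlonglongrightarrow> 0"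
  shows "AE x in \<eta>. H_deriv e j u \<mu> \<eta> x = 0"
proof -
  note \<sigma>2 = wasserstein2_acD[OF \<sigma>] and \<eta>2 = wasserstein2_acD[OF \<eta>]
  note W = wasserstein2D[OF \<sigma>2] and W\<eta> = wasserstein2D[OF \<eta>2]
  \<comment> \<open>The vanishing slack gives the strict inequality from which couplings are
    extracted.\<close>
  define c where "c k = W2 (\<sigma> k) \<eta> + inverse (real (Suc k))" for k
  have "W2 (\<sigma> k) \<eta> < c k" for k by (simp add: c_def)
  then have "\<exists>\<pi>. \<pi> \<in> couplings (\<sigma> k) \<eta> \<and> (\<integral>\<^sup>+ p. ennreal ((dist (fst p) (snd p))\<^sup>2) \<partial>\<pi>) < ennreal ((c k)\<^sup>2)" for k
    by (rule W2_less_imp_coupling[OF \<sigma>2[of k] \<eta>2]) blast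
  then have "\<exists>\<pi>. \<forall>k. \<pi> k \<in> couplings (\<sigma> k) \<eta> \<and> (\<integral>\<^sup>+ p. ennreal ((dist (fst p) (snd p))\<^sup>2) \<partial>\<pi> k) < ennreal ((c k)\<^sup>2)"
    by (intro choice allI)
  then obtain \<pi> where \<pi>: "\<And>k. \<pi> k \<in> couplings (\<sigma> k) \<eta>"
    and cost_\<pi>: "\<And>k. (\<integral>\<^sup>+ p. ennreal ((dist (fst p) (snd p))\<^sup>2) \<partial>\<pi> k) < ennreal ((c k)\<^sup>2)"
    by blast
  have "c \<longlonglongrightarrow> 0 + 0"
    unfolding c_def by (intro tendsto_add lim LIMSEQ_inverse_real_of_nat)
  then have lim_c: "(\<lambda>k. ennreal ((c k)\<^sup>2)) \<longlonglongrightarrow> ennreal ((0 + 0)\<^sup>2)"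
    by (intro tendsto_ennrealI tendsto_power)
  have lim\<pi>: "(\<lambda>k. \<integral>\<^sup>+ p. ennreal ((dist (fst p) (snd p))\<^sup>2) \<partial>\<pi> k) \<longlonglongrightarrow> 0"
  proof (rule tendsto_sandwich[OF _ _ tendsto_const, rotated 2])
    show "(\<lambda>k. ennreal ((c k)\<^sup>2)) \<longlonglongrightarrow> 0" using lim_c by simp
    show "\<forall>\<^sub>F k in sequentially. (\<integral>\<^sup>+ p. ennreal ((dist (fst p) (snd p))\<^sup>2) \<partial>\<pi> k) \<le> ennreal ((c k)\<^sup>2)"
      using cost_\<pi> by (intro always_eventually allI) (rule less_imp_le)
  qed simp
  note [measurable] = couplingsD(4,5)[OF \<pi>]
  have \<pi>p: "prob_space (\<pi> k)" for k using couplings_prob_space[OF \<pi>] W(1) by blast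
  have [measurable]: "(\<lambda>q. disp (\<sigma> k) (fst q) (fst (snd q))) \<in> borel_measurable (u \<Otimes>\<^sub>M \<pi> k)"
    "(\<lambda>q. disp \<eta> (fst q) (snd (snd q))) \<in> borel_measurable (u \<Otimes>\<^sub>M \<pi> k)" for k
    by (intro borel_measurable_diff measurable_slice_map[OF const_kernel] \<sigma>2 \<eta>2; measurable)+
  define a where "a k Q = (\<integral>\<^sup>+p. ennreal (norm (disp (\<sigma> k) Q (fst p) - disp \<eta> Q (snd p))) \<partial>\<pi> k)" for k Q
  have [measurable]: "a k \<in> borel_measurable u" for k
  proof -
    interpret \<pi>: prob_space "\<pi> k" by (rule \<pi>p)
    show ?thesis unfolding a_def[abs_def] by (rule \<pi>.borel_measurable_nn_integral) (simp add: split_beta')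
  qed
  obtain C where C: "\<And>k. W2 (\<sigma> k) \<eta> \<le> C"
    using convergent_imp_Bseq[OF convergentI[OF lim]] by (metis Bseq_def abs_le_D1 real_norm_def)
  \<comment> \<open>By the triangle inequality \<open>D\<close> bounds the distances of all
    \<open>\<sigma> k\<close> and of \<eta> to \<mu>; the added 1 makes it positive. It yields the
    dominating constant for \<open>a\<close>.\<close>
  define D where "D = C + W2 \<eta> \<mu> + 1"
  have "0 < D" using C[of 0] W2_nonneg[of "\<sigma> 0" \<eta>] W2_nonneg[of \<eta> \<mu>] by (simp add: D_def)
  have disp_le: "(\<integral>\<^sup>+x. ennreal (norm (disp \<nu> Q x)) \<partial>\<nu>) \<le> ennreal D"
    if \<nu>: "\<nu> \<in> wasserstein2_ac" "W2 \<nu> \<mu> \<le> D" and Q: "Q \<in> orthogonal_group" for \<nu> Q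
  proof -
    have "(\<integral>\<^sup>+x. ennreal ((norm (disp \<nu> Q x))\<^sup>2) \<partial>\<nu>) \<le> ennreal (D\<^sup>2)"
      using that W2_nonneg[of \<nu> \<mu>]
      by (intro order_trans[OF disp_norm_sq_le_W2[OF \<nu>(1) Q]] ennreal_leI power_mono) auto
    from nn_integral_abs_first_moment_le[OF wasserstein2D(1)[OF wasserstein2_acD[OF \<nu>(1)]] _ \<open>0 < D\<close> this]
    show ?thesis using measurable_disp(1)[OF wasserstein2_acD[OF \<nu>(1)] Q] by simp
  qed
  have a_le: "a k Q \<le> ennreal (2 * D)" if Q: "Q \<in> orthogonal_group" for k Q
  proof -
    note [measurable] = measurable_disp(2)[OF \<sigma>2 Q] measurable_disp(2)[OF \<eta>2 Q]
    have "a k Q \<le> (\<integral>\<^sup>+p. ennreal (norm (disp (\<sigma> k) Q (fst p))) + ennreal (norm (disp \<eta> Q (snd p))) \<partial>\<pi> k)"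
      unfolding a_def by (intro nn_integral_mono) (simp add: ennreal_leI norm_triangle_ineq4 flip: ennreal_plus)
    also have "\<dots> = (\<integral>\<^sup>+p. ennreal (norm (disp (\<sigma> k) Q (fst p))) \<partial>\<pi> k) + (\<integral>\<^sup>+p. ennreal (norm (disp \<eta> Q (snd p))) \<partial>\<pi> k)"
      by (rule nn_integral_add) measurable
    also have "(\<integral>\<^sup>+p. ennreal (norm (disp (\<sigma> k) Q (fst p))) \<partial>\<pi> k) = (\<integral>\<^sup>+x. ennreal (norm (disp (\<sigma> k) Q x)) \<partial>distr (\<pi> k) borel fst)"
      by (rule nn_integral_distr[symmetric]) measurable
    also have "distr (\<pi> k) borel fst = \<sigma> k" by (rule couplingsD[OF \<pi>])
    also have "(\<integral>\<^sup>+p. ennreal (norm (disp \<eta> Q (snd p))) \<partial>\<pi> k) = (\<integral>\<^sup>+x. ennreal (norm (disp \<eta> Q x)) \<partial>distr (\<pi> k) borel snd)"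
      by (rule nn_integral_distr[symmetric]) measurable
    also have "distr (\<pi> k) borel snd = \<eta>" by (rule couplingsD[OF \<pi>])
    also have "(\<integral>\<^sup>+x. ennreal (norm (disp (\<sigma> k) Q x)) \<partial>\<sigma> k) + (\<integral>\<^sup>+x. ennreal (norm (disp \<eta> Q x)) \<partial>\<eta>) \<le> ennreal D + ennreal D"
      using W2_triangle[OF \<sigma>2[of k] \<eta>2 \<mu>] C[of k] C[of 0] W2_nonneg[of "\<sigma> 0" \<eta>]
      by (intro add_mono disp_le \<sigma> \<eta> Q) (auto simp: D_def)
    also have "\<dots> = ennreal (2 * D)" using \<open>0 < D\<close> by (simp flip: ennreal_plus)
    finally show ?thesis .
  qed
  have "(\<lambda>k. \<integral>\<^sup>+Q. a k Q \<partial>u) \<longlonglongrightarrow> (\<integral>\<^sup>+Q. 0 \<partial>u)"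
  proof (rule nn_integral_dominated_convergence[where w="\<lambda>_. ennreal (2 * D)"])
    show "AE Q in u. (\<lambda>k. a k Q) \<longlonglongrightarrow> 0"
      unfolding a_def by (intro AE_I2 disp_stability[OF \<sigma> \<eta> _ \<pi> lim\<pi>]) (simp add: space_u)
    show "(\<integral>\<^sup>+Q. ennreal (2 * D) \<partial>u) < \<infinity>" by (simp add: u.emeasure_space_1)
  qed (auto simp: a_le space_u)
  then have lim_a: "(\<lambda>k. \<integral>\<^sup>+Q. a k Q \<partial>u) \<longlonglongrightarrow> 0" by simp
  let ?H = "H_deriv e j u \<mu>"
  have H_borel[measurable]: "?H (\<sigma> k) \<in> borel_measurable borel" "?H \<eta> \<in> borel_measurable borel" for k
    using measurable_H[OF \<sigma>] measurable_H[OF \<eta>] measurable_cong_sets[OF W(2) refl] measurable_cong_sets[OF W\<eta>(2) refl] by blast+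
  \<comment> \<open>Almost everywhere both displacement fields are integrable over the frames, so
    the two averages can be subtracted under one integral; Tonelli then exchanges the order.\<close>
  have diff: "(\<integral>\<^sup>+p. ennreal (norm (?H (\<sigma> k) (fst p) - ?H \<eta> (snd p))) \<partial>\<pi> k) \<le> (\<integral>\<^sup>+Q. a k Q \<partial>u)" for k
  proof -
    interpret \<pi>: prob_space "\<pi> k" by (rule \<pi>p)
    interpret pair_sigma_finite u "\<pi> k" ..
    have "AE p in \<pi> k. integrable u (\<lambda>Q. disp (\<sigma> k) Q (fst p))"
      using L2_field.AE_integrable[OF L2_field_disp[OF \<sigma>[of k]]] unfolding couplingsD(2)[OF \<pi>[of k], symmetric]
      by (rule AE_distrD[rotated]) simp
    moreover have "AE p in \<pi> k. integrable u (\<lambda>Q. disp \<eta> Q (snd p))"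
      using L2_field.AE_integrable[OF L2_field_disp[OF \<eta>]] unfolding couplingsD(3)[OF \<pi>[of k], symmetric]
      by (rule AE_distrD[rotated]) simp
    ultimately have "AE p in \<pi> k. ennreal (norm (?H (\<sigma> k) (fst p) - ?H \<eta> (snd p))) \<le> (\<integral>\<^sup>+Q. ennreal (norm (disp (\<sigma> k) Q (fst p) - disp \<eta> Q (snd p))) \<partial>u)"
    proof eventually_elim
      case (elim p)
      have "?H (\<sigma> k) (fst p) - ?H \<eta> (snd p) = - (\<integral>Q. disp (\<sigma> k) Q (fst p) - disp \<eta> Q (snd p) \<partial>u)"
        using elim by (simp only: H_deriv_eq_mean[OF \<sigma>] H_deriv_eq_mean[OF \<eta>]
          L2_field.mean_def[OF L2_field_disp[OF \<sigma>]] L2_field.mean_def[OF L2_field_disp[OF \<eta>]] Bochner_Integration.integral_diff) simp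
      then have "ennreal (norm (?H (\<sigma> k) (fst p) - ?H \<eta> (snd p))) = ennreal (norm (\<integral>Q. disp (\<sigma> k) Q (fst p) - disp \<eta> Q (snd p) \<partial>u))"
        by (simp only: norm_minus_cancel)
      also have "\<dots> \<le> (\<integral>\<^sup>+Q. ennreal (norm (disp (\<sigma> k) Q (fst p) - disp \<eta> Q (snd p))) \<partial>u)"
        by (rule integral_norm_bound_ennreal) (intro Bochner_Integration.integrable_diff elim)
      finally show ?case .
    qed
    then have "(\<integral>\<^sup>+p. ennreal (norm (?H (\<sigma> k) (fst p) - ?H \<eta> (snd p))) \<partial>\<pi> k) \<le> (\<integral>\<^sup>+p. \<integral>\<^sup>+Q. ennreal (norm (disp (\<sigma> k) Q (fst p) - disp \<eta> Q (snd p))) \<partial>u \<partial>\<pi> k)"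
      by (rule nn_integral_mono_AE)
    also have "\<dots> = (\<integral>\<^sup>+Q. a k Q \<partial>u)"
      unfolding a_def by (rule Fubini') (simp add: split_beta')
    finally show ?thesis .
  qed
  have "(\<integral>\<^sup>+y. ennreal (norm (?H \<eta> y)) \<partial>\<eta>) \<le> ennreal (sqrt (slope (\<sigma> k)) + inverse (real (Suc k))) + (\<integral>\<^sup>+Q. a k Q \<partial>u)" for k
  proof -
    have "(\<integral>\<^sup>+y. ennreal (norm (?H \<eta> y)) \<partial>\<eta>) = (\<integral>\<^sup>+p. ennreal (norm (?H \<eta> (snd p))) \<partial>\<pi> k)"
      by (subst couplingsD(3)[OF \<pi>[of k], symmetric], subst nn_integral_distr) auto
    also have "\<dots> \<le> (\<integral>\<^sup>+p. ennreal (norm (?H (\<sigma> k) (fst p))) + ennreal (norm (?H (\<sigma> k) (fst p) - ?H \<eta> (snd p))) \<partial>\<pi> k)"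
    proof (rule nn_integral_mono)
      fix p
      show "ennreal (norm (?H \<eta> (snd p))) \<le> ennreal (norm (?H (\<sigma> k) (fst p))) + ennreal (norm (?H (\<sigma> k) (fst p) - ?H \<eta> (snd p)))"
        using norm_triangle_ineq4[of "?H (\<sigma> k) (fst p)" "?H (\<sigma> k) (fst p) - ?H \<eta> (snd p)"]
        by (simp add: ennreal_leI flip: ennreal_plus)
    qed
    also have "\<dots> = (\<integral>\<^sup>+p. ennreal (norm (?H (\<sigma> k) (fst p))) \<partial>\<pi> k) + (\<integral>\<^sup>+p. ennreal (norm (?H (\<sigma> k) (fst p) - ?H \<eta> (snd p))) \<partial>\<pi> k)"
      by (rule nn_integral_add) measurable
    also have "(\<integral>\<^sup>+p. ennreal (norm (?H (\<sigma> k) (fst p))) \<partial>\<pi> k) = (\<integral>\<^sup>+x. ennreal (norm (?H (\<sigma> k) x)) \<partial>distr (\<pi> k) borel fst)"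
      by (rule nn_integral_distr[symmetric]) measurable
    also have "distr (\<pi> k) borel fst = \<sigma> k" by (rule couplingsD[OF \<pi>])
    also have "(\<integral>\<^sup>+x. ennreal (norm (?H (\<sigma> k) x)) \<partial>\<sigma> k) \<le> ennreal (sqrt (slope (\<sigma> k)) + inverse (real (Suc k)))"
    proof -
      \<comment> \<open>The slope may be 0, while the first moment bound requires a positive
        constant.\<close>
      let ?r = "sqrt (slope (\<sigma> k)) + inverse (real (Suc k))"
      have "0 < ?r" using slope_nonneg[of "\<sigma> k"] by (intro add_nonneg_pos) auto
      have "slope (\<sigma> k) = (sqrt (slope (\<sigma> k)))\<^sup>2" using slope_nonneg by simp
      also have "\<dots> \<le> ?r\<^sup>2" using slope_nonneg[of "\<sigma> k"] by (intro power_mono) auto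
      finally have "(\<integral>\<^sup>+x. ennreal ((norm (?H (\<sigma> k) x))\<^sup>2) \<partial>\<sigma> k) \<le> ennreal (?r\<^sup>2)"
        using nn_integral_eq_integral[OF integrable_H_norm_sq[OF \<sigma>[of k]]] by (simp add: slope_def ennreal_leI)
      from nn_integral_abs_first_moment_le[OF W(1) _ \<open>0 < ?r\<close> this] show ?thesis
        using measurable_H[OF \<sigma>[of k]] by simp
    qed
    finally show ?thesis using diff[of k] by (meson add_mono order_trans order_refl)
  qed
  moreover have "(\<lambda>k. ennreal (sqrt (slope (\<sigma> k)) + inverse (real (Suc k))) + (\<integral>\<^sup>+Q. a k Q \<partial>u)) \<longlonglongrightarrow> ennreal (sqrt 0 + 0) + 0"
    by (intro tendsto_add tendsto_ennrealI tendsto_real_sqrt slope LIMSEQ_inverse_real_of_nat lim_a)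
  ultimately have "(\<integral>\<^sup>+y. ennreal (norm (?H \<eta> y)) \<partial>\<eta>) \<le> ennreal (sqrt 0 + 0) + 0"
    by (intro LIMSEQ_le_const) auto
  then have "(\<integral>\<^sup>+y. ennreal (norm (?H \<eta> y)) \<partial>\<eta>) = 0" by simp
  then show ?thesis
    using measurable_H[OF \<eta>] by (subst (asm) nn_integral_0_iff_AE) auto
qed

end

section \<open>Convergence of the scheme\<close>

text \<open>With partial sums R of \<open>r\<close> and S of \<open>a k * h k\<close>, the sequence
  E - R + S decreases and is bounded below. The remainder \<open>r\<close> may change sign and
  converge only conditionally, which is all that is known of the noise.\<close>

lemma almost_decreasing_sequence:
  fixes E h a r :: "nat \<Rightarrow> real"
  assumes E: "\<And>k. 0 \<le> E k" and ah: "\<And>k. 0 \<le> a k * h k" and r: "summable r"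
    and step: "\<And>k. E (Suc k) \<le> E k - a k * h k + r k"
  shows "convergent E" and "summable (\<lambda>k. a k * h k)"
proof -
  define R where "R n = (\<Sum>k<n. r k)" for n
  define S where "S n = (\<Sum>k<n. a k * h k)" for n
  have R: "convergent R" using r unfolding R_def by (simp add: summable_iff_convergent)
  then obtain C where C: "\<And>n. \<bar>R n\<bar> \<le> C"
    using convergent_imp_Bseq[OF R] by (auto simp: Bseq_def)
  define Y where "Y n = E n - R n + S n" for n
  have dec: "decseq Y"
    using step by (intro decseq_SucI) (simp add: Y_def R_def S_def algebra_simps)
  have S_nonneg: "0 \<le> S n" for n unfolding S_def by (intro sum_nonneg ah)
  have "S n \<le> Y 0 + C" for n
    using decseqD[OF dec, of 0 n] C[of n] E[of n] by (simp add: Y_def)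
  then show sum: "summable (\<lambda>k. a k * h k)"
    unfolding S_def by (intro summableI_nonneg_bounded ah)
  have "- C \<le> Y n" for n using C[of n] E[of n] S_nonneg[of n] by (simp add: Y_def)
  then have "\<forall>n. - C \<le> Y n" by blast
  then obtain L where "Y \<longlonglongrightarrow> L" by (rule decseq_convergent[OF dec])
  then have "convergent Y" by (rule convergentI)
  moreover have "convergent S" using sum unfolding S_def by (simp add: summable_iff_convergent)
  ultimately have "convergent (\<lambda>n. Y n + R n - S n)"
    using R by (intro convergent_add convergent_diff)
  then show "convergent E" by (simp add: Y_def)
qed

lemma not_summable_imp_frequently_small:
  fixes a h :: "nat \<Rightarrow> real"
  assumes a: "\<And>k. 0 \<le> a k" "\<not> summable a" and h: "\<And>k. 0 \<le> h k" and ah: "summable (\<lambda>k. a k * h k)"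
    and "0 < \<epsilon>"
  shows "\<exists>k\<ge>n. h k < \<epsilon>"
proof (rule ccontr)
  assume "\<not> (\<exists>k\<ge>n. h k < \<epsilon>)"
  then have ge: "\<epsilon> \<le> h k" if "k \<ge> n" for k using that by (auto simp: not_less)
  have "summable a"
  proof (rule summable_comparison_test'[where N=n])
    show "summable (\<lambda>k. a k * h k / \<epsilon>)" using ah by (rule summable_divide)
    show "norm (a k) \<le> a k * h k / \<epsilon>" if "k \<ge> n" for k
      using mult_left_mono[OF ge[OF that] a(1)[of k]] a(1)[of k] \<open>0 < \<epsilon>\<close> by (simp add: field_simps)
  qed
  with a(2) show False by simp
qed

section \<open>Bounds and subsequences from compactness in \<open>W2\<close>\<close>

lemma compactin_W2_bounded:
  assumes "compactin W2_topology K" "\<mu> \<in> wasserstein2"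
  obtains B where "\<And>\<nu>. \<nu> \<in> K \<Longrightarrow> W2 \<nu> \<mu> \<le> B"
proof -
  interpret W: Metric_space wasserstein2 W2 by (rule Metric_space_W2)
  obtain c B where "K \<subseteq> W.mcball c B"
    using W.compactin_imp_mbounded[OF assms(1)] by (auto simp: W.mbounded_def)
  then have "W2 \<nu> \<mu> \<le> B + W2 c \<mu>" if "\<nu> \<in> K" for \<nu>
    using that W2_triangle[of \<nu> c \<mu>] assms(2) W2_commute[of \<nu> c] by (auto simp: W.mcball_def)
  then show ?thesis using that by blast
qed

lemma compactin_W2_subsequence:
  assumes "compactin W2_topology K" "\<And>l. s l \<in> K"
  obtains \<eta> q where "\<eta> \<in> K" "strict_mono (q :: nat \<Rightarrow> nat)" "(\<lambda>l. W2 (s (q l)) \<eta>) \<longlonglongrightarrow> 0"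
proof -
  interpret W: Metric_space wasserstein2 W2 by (rule Metric_space_W2)
  obtain \<eta> q where "\<eta> \<in> K" "strict_mono q" "limitin W.mtopology (s \<circ> q) \<eta> sequentially"
    using assms unfolding W.compactin_sequentially by blast
  then show ?thesis using that by (auto simp: W.limitin_metric_dist_null comp_def)
qed

locale slice_matching_scheme = slice_matching e j \<mu> u
  for e :: "nat \<Rightarrow> 'n::finite" and j \<mu> u +
  fixes \<sigma>0 :: "(real^'n) measure" and K :: "(real^'n) measure set" and \<gamma> :: "nat \<Rightarrow> real"
  assumes \<sigma>0: "\<sigma>0 \<in> wasserstein2_ac"
    and K_ac: "K \<subseteq> wasserstein2_ac"
    and K_compact: "compactin W2_topology K"
    and iter_K: "\<And>P k. (\<forall>i. P i \<in> orthogonal_group) \<Longrightarrow> 1 \<le> k \<Longrightarrow> slice_iter e j \<mu> \<sigma>0 \<gamma> P k \<in> K"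
    and critical: "\<And>\<eta>. \<eta> \<in> K \<Longrightarrow> (AE x in \<eta>. H_deriv e j u \<mu> \<eta> x = 0) \<Longrightarrow> \<eta> = \<mu>"
    and \<gamma>_nonneg: "\<And>k. 0 \<le> \<gamma> k"
    and \<gamma>_div: "\<not> summable \<gamma>"
    and \<gamma>_sq: "summable (\<lambda>k. (\<gamma> k)\<^sup>2)"
begin

section \<open>Random iterates on the space of frame sequences\<close>

abbreviation "iter p k \<equiv> slice_iter e j \<mu> \<sigma>0 \<gamma> p k"
abbreviation "paths \<equiv> (\<Pi>\<^sub>M i\<in>(UNIV :: nat set). u)"

lemma space_paths: "p \<in> space paths \<longleftrightarrow> (\<forall>i. p i \<in> orthogonal_group)"
  by (auto simp: space_PiM space_u PiE_def Pi_def)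

lemma iter_ac: "p \<in> space paths \<Longrightarrow> iter p k \<in> wasserstein2_ac"
  using \<sigma>0 K_ac iter_K[of p k] by (cases "k = 0") (auto simp: space_paths)

lemma ex_W2_bound: "\<exists>B. \<forall>p\<in>space paths. \<forall>k. (W2 (iter p k) \<mu>)\<^sup>2 \<le> B"
proof -
  obtain B where B: "\<And>\<nu>. \<nu> \<in> K \<Longrightarrow> W2 \<nu> \<mu> \<le> B"
    using compactin_W2_bounded[OF K_compact \<mu>] by blast
  \<comment> \<open>The maximum covers \<open>k = 0\<close>, since \<open>\<sigma>0\<close> may lie
    outside \<open>K\<close>.\<close>
  have "W2 (iter p k) \<mu> \<le> max B (W2 \<sigma>0 \<mu>)" if "p \<in> space paths" for p k
    using B[OF iter_K[of p k]] that by (cases "k = 0") (auto simp: space_paths le_max_iff_disj)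
  then have "(W2 (iter p k) \<mu>)\<^sup>2 \<le> (max B (W2 \<sigma>0 \<mu>))\<^sup>2" if "p \<in> space paths" for p k
    using that by (intro power_mono W2_nonneg)
  then show ?thesis by blast
qed

text \<open>Deviation of the drift from its conditional mean, which is minus the slope, weighted by
  the step size.\<close>

definition noise :: "nat \<Rightarrow> (nat \<Rightarrow> real^'n^'n) \<Rightarrow> real" where
  "noise k p = \<gamma> k * (drift (iter p k) (p k) + slope (iter p k))"

lemma measurable_noise [measurable]: "noise k \<in> borel_measurable paths"
proof -
  have [measurable]: "(\<lambda>p. iter p k) \<in> paths \<rightarrow>\<^sub>M subprob_algebra borel"
    by (rule measurable_slice_iter[OF wasserstein2_acD[OF \<sigma>0]])
  have [measurable]: "(\<lambda>p. p k) \<in> paths \<rightarrow>\<^sub>M u" by (rule measurable_component_singleton) simp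
  have [measurable]: "(\<lambda>q. H_deriv e j u \<mu> (iter (fst q) k) (snd q)) \<in> borel_measurable (paths \<Otimes>\<^sub>M borel)"
    by (rule measurable_H_deriv) measurable
  have [measurable]: "(\<lambda>q. slice_map e j \<mu> (iter (fst q) k) (fst q k) (snd q)) \<in> borel_measurable (paths \<Otimes>\<^sub>M borel)"
    by (rule measurable_slice_map) measurable
  have "(\<lambda>p. drift (iter p k) (p k)) \<in> borel_measurable paths"
    unfolding drift_def by (rule measurable_kernel_integral[where S=borel]) (simp_all add: split_beta')
  moreover have "(\<lambda>p. slope (iter p k)) \<in> borel_measurable paths"
    unfolding slope_def by (rule measurable_kernel_integral[where S=borel]) (simp_all add: split_beta')
  ultimately show ?thesis unfolding noise_def[abs_def] by measurable
qed

lemma AE_summable_noise: "AE p in paths. summable (\<lambda>k. noise k p)"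
proof -
  obtain B where B: "\<And>p k. p \<in> space paths \<Longrightarrow> (W2 (iter p k) \<mu>)\<^sup>2 \<le> B" using ex_W2_bound by blast
  interpret martingale_differences u noise "\<lambda>k. \<gamma> k * (2 * B)"
  proof
    show "noise k \<in> borel_measurable paths" for k by measurable
    show "\<bar>noise k p\<bar> \<le> \<gamma> k * (2 * B)" if p: "p \<in> space paths" for k p
    proof -
      note ac = iter_ac[OF p, of k]
      have "\<bar>drift (iter p k) (p k)\<bar> \<le> B"
        using abs_drift_le[OF ac, of "p k"] B[OF p, of k] p by (simp add: space_paths)
      moreover have "0 \<le> slope (iter p k)" "slope (iter p k) \<le> B"
        using slope_nonneg slope_le_energy[OF ac] energy_le_W2[OF ac] B[OF p, of k] by auto
      ultimately have "\<bar>drift (iter p k) (p k) + slope (iter p k)\<bar> \<le> 2 * B" by linarith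
      then show ?thesis unfolding noise_def abs_mult using \<gamma>_nonneg[of k] by (simp add: mult_left_mono)
    qed
    show "noise k p = noise k q" if "\<And>i. i \<le> k \<Longrightarrow> p i = q i" for k p q
      using slice_iter_cong[of k p q] that by (simp add: noise_def)
    show "(\<integral>Q. noise k (p(k := Q)) \<partial>u) = 0" if p: "p \<in> space paths" for k p
    proof -
      \<comment> \<open>The k-th iterate reads only coordinates below k, so redrawing coordinate k
        affects only the frame in the drift.\<close>
      have "iter (p(k := Q)) k = iter p k" for Q by (rule slice_iter_cong) auto
      then have "(\<integral>Q. noise k (p(k := Q)) \<partial>u) = (\<integral>Q. \<gamma> k * (drift (iter p k) Q + slope (iter p k)) \<partial>u)"
        by (simp add: noise_def)
      also have "\<dots> = 0"
        using integrable_drift[OF iter_ac[OF p, of k]] integral_drift[OF iter_ac[OF p, of k]] by (simp add: u.prob_space)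
      finally show ?thesis .
    qed
    show "summable (\<lambda>k. (\<gamma> k * (2 * B))\<^sup>2)"
      using summable_mult2[OF \<gamma>_sq] by (simp add: power_mult_distrib)
  qed
  show ?thesis by (rule AE_summable)
qed

text \<open>\<open>Suc l \<le> r l\<close> excludes the index 0, so the iterates lie in
  \<open>K\<close>; the indices need not increase. It is applied both to indices of small slope and
  to a hypothetical sequence of indices staying away from \<mu>.\<close>

lemma subsequence_to_target:
  assumes p: "p \<in> space paths" and r: "\<And>l. Suc l \<le> r l" and h: "(\<lambda>l. slope (iter p (r l))) \<longlonglongrightarrow> 0"
  obtains q where "strict_mono (q :: nat \<Rightarrow> nat)" "(\<lambda>l. W2 (iter p (r (q l))) \<mu>) \<longlonglongrightarrow> 0"
proof -
  have "iter p (r l) \<in> K" for l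
    using p iter_K[of p "r l"] order_trans[OF _ r[of l], of 1] by (simp add: space_paths)
  from compactin_W2_subsequence[OF K_compact this] obtain \<eta> q
    where \<eta>: "\<eta> \<in> K" and q: "strict_mono q" and lim: "(\<lambda>l. W2 (iter p (r (q l))) \<eta>) \<longlonglongrightarrow> 0" .
  have "(\<lambda>l. slope (iter p (r (q l)))) \<longlonglongrightarrow> 0"
    using LIMSEQ_subseq_LIMSEQ[OF h q] by (simp add: comp_def)
  then have "AE x in \<eta>. H_deriv e j u \<mu> \<eta> x = 0"
    using \<eta> K_ac by (intro H_deriv_limit_zero[OF iter_ac[OF p] _ lim]) auto
  then have "\<eta> = \<mu>" by (rule critical[OF \<eta>])
  with q lim show ?thesis by (intro that) auto
qed

text \<open>The deterministic part, for a single path: once the noise sums, no further probability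
  enters.\<close>

lemma convergence_of_summable_noise:
  assumes p: "p \<in> space paths" and noise: "summable (\<lambda>k. noise k p)"
  shows "(\<lambda>k. W2 (iter p k) \<mu>) \<longlonglongrightarrow> 0"
proof -
  obtain B where B: "\<And>k. (W2 (iter p k) \<mu>)\<^sup>2 \<le> B" using ex_W2_bound p by blast
  define E where "E k = energy (iter p k)" for k
  define h where "h k = slope (iter p k)" for k
  have hE: "0 \<le> h k" "h k \<le> E k" "E k \<le> (W2 (iter p k) \<mu>)\<^sup>2" for k
    using slope_nonneg slope_le_energy energy_le_W2 iter_ac[OF p] by (auto simp: E_def h_def)
  \<comment> \<open>By definition of \<open>noise\<close>, the term with the drift is
    \<open>2 * noise k p\<close> minus \<open>2 * \<gamma> k * h k\<close>.\<close>
  have step: "E (Suc k) \<le> E k - 2 * \<gamma> k * h k + (2 * noise k p + (\<gamma> k)\<^sup>2 * B)" for k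
  proof -
    have "E (Suc k) \<le> E k + 2 * \<gamma> k * drift (iter p k) (p k) + (\<gamma> k)\<^sup>2 * (W2 (iter p k) \<mu>)\<^sup>2"
      using energy_descent[OF iter_ac[OF p, of k], of "p k" "\<gamma> k"] iter_ac[OF p, of "Suc k"] p
      by (simp add: E_def space_paths)
    also have "\<dots> \<le> E k + 2 * \<gamma> k * drift (iter p k) (p k) + (\<gamma> k)\<^sup>2 * B"
      by (intro add_left_mono mult_left_mono B) simp
    also have "\<dots> = E k - 2 * \<gamma> k * h k + (2 * noise k p + (\<gamma> k)\<^sup>2 * B)"
      by (simp add: noise_def h_def algebra_simps)
    finally show ?thesis .
  qed
  have "summable (\<lambda>k. 2 * noise k p + (\<gamma> k)\<^sup>2 * B)"
    by (intro summable_add summable_mult summable_mult2 noise \<gamma>_sq)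
  moreover have "0 \<le> E k" "0 \<le> 2 * \<gamma> k * h k" for k
    using hE(1,2)[of k] \<gamma>_nonneg[of k] by auto
  ultimately have conv: "convergent E" and summ: "summable (\<lambda>k. 2 * \<gamma> k * h k)"
    using almost_decreasing_sequence[of E "\<lambda>k. 2 * \<gamma> k" h] step by auto
  have "\<not> summable (\<lambda>k. 2 * \<gamma> k)"
    using \<gamma>_div summable_cmult_iff[of 2 \<gamma>] by simp
  then have "\<exists>k\<ge>Suc l. h k < inverse (real (Suc l))" for l
    using not_summable_imp_frequently_small[of "\<lambda>k. 2 * \<gamma> k" h "inverse (real (Suc l))" "Suc l"] summ hE \<gamma>_nonneg by simp
  then have "\<exists>r. \<forall>l. Suc l \<le> r l \<and> h (r l) < inverse (real (Suc l))"
    by (intro choice allI) blast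
  then obtain r where r: "\<And>l. Suc l \<le> r l" "\<And>l. h (r l) < inverse (real (Suc l))" by blast
  have "(\<lambda>l. h (r l)) \<longlonglongrightarrow> 0"
    by (rule tendsto_sandwich[OF _ _ tendsto_const LIMSEQ_inverse_real_of_nat])
      (use hE(1) less_imp_le[OF r(2)] in \<open>simp_all del: of_nat_Suc\<close>)
  then obtain q where q: "strict_mono q" "(\<lambda>l. W2 (iter p (r (q l))) \<mu>) \<longlonglongrightarrow> 0"
    using subsequence_to_target[OF p r(1)] unfolding h_def by blast
  have rq: "filterlim (\<lambda>l. r (q l)) at_top sequentially"
  proof (rule filterlim_at_top_mono[OF filterlim_ident])
    have "l \<le> r (q l)" for l
      using seq_suble[OF q(1), of l] r(1)[of "q l"] by linarith
    then show "\<forall>\<^sub>F l in sequentially. l \<le> r (q l)" by simp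
  qed
  \<comment> \<open>The whole sequence of energies converges, so its limit can be read off along the
    subsequence, where the squared distance to \<mu> bounds it.\<close>
  obtain L where L: "E \<longlonglongrightarrow> L" using conv by (auto simp: convergent_def)
  have "(\<lambda>l. E (r (q l))) \<longlonglongrightarrow> 0"
  proof (rule tendsto_sandwich[OF _ _ tendsto_const])
    show "(\<lambda>l. (W2 (iter p (r (q l))) \<mu>)\<^sup>2) \<longlonglongrightarrow> 0" using tendsto_power[OF q(2), of 2] by simp
  qed (use hE in \<open>auto intro!: always_eventually intro: order_trans\<close>)
  moreover have "(\<lambda>l. E (r (q l))) \<longlonglongrightarrow> L" by (rule filterlim_compose[OF L rq])
  ultimately have "L = 0" using LIMSEQ_unique by blast
  with L have E0: "E \<longlonglongrightarrow> 0" by simp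
  have h0: "h \<longlonglongrightarrow> 0"
    by (rule tendsto_sandwich[OF _ _ tendsto_const E0]) (use hE in auto)
  show ?thesis
  proof (rule ccontr)
    assume "\<not> ?thesis"
    then obtain \<epsilon> where \<epsilon>: "0 < \<epsilon>" "\<And>n. \<exists>k\<ge>n. \<epsilon> \<le> W2 (iter p k) \<mu>"
      unfolding LIMSEQ_iff by (auto simp: not_less abs_of_nonneg[OF W2_nonneg])
    \<comment> \<open>Indices with distance at least \<epsilon> still have slopes tending to 0, now
      that the full sequence \<open>h\<close> does, so a further subsequence would converge to
      \<mu>.\<close>
    from \<epsilon>(2) have "\<exists>r. \<forall>l. Suc l \<le> r l \<and> \<epsilon> \<le> W2 (iter p (r l)) \<mu>"
      by (intro choice allI) blast
    then obtain r where r: "\<And>l. Suc l \<le> r l" "\<And>l. \<epsilon> \<le> W2 (iter p (r l)) \<mu>" by blast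
    have "filterlim r at_top sequentially"
    proof (rule filterlim_at_top_mono[OF filterlim_ident])
      have "l \<le> r l" for l using r(1)[of l] by simp
      then show "\<forall>\<^sub>F l in sequentially. l \<le> r l" by simp
    qed
    then have "(\<lambda>l. slope (iter p (r l))) \<longlonglongrightarrow> 0"
      using filterlim_compose[OF h0] by (simp add: h_def)
    then obtain q where "(\<lambda>l. W2 (iter p (r (q l))) \<mu>) \<longlonglongrightarrow> 0"
      using subsequence_to_target[OF p r(1)] by blast
    then have "\<epsilon> \<le> 0" using r(2) by (intro LIMSEQ_le_const) auto
    with \<epsilon>(1) show False by simp
  qed
qed

theorem AE_convergence: "AE p in paths. (\<lambda>k. W2 (iter p k) \<mu>) \<longlonglongrightarrow> 0"
  using AE_summable_noise AE_space by eventually_elim (rule convergence_of_summable_noise)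

end

section \<open>Transfer from the path space to the given probability space\<close>

theorem theorem2:
  fixes e :: "nat \<Rightarrow> 'n::finite"
    and j :: nat
    and \<sigma>0 \<mu> :: "(real^'n) measure"
    and u :: "(real^'n^'n) measure"
    and K :: "(real^'n) measure set"
    and \<gamma> :: "nat \<Rightarrow> real"
    and M :: "'w measure"
    and P :: "nat \<Rightarrow> 'w \<Rightarrow> real^'n^'n"
  assumes labelling: "bij_betw e {1..CARD('n)} UNIV"
    and j: "1 \<le> j" "j \<le> CARD('n)"
    and \<sigma>0: "\<sigma>0 \<in> wasserstein2_ac"
    and \<mu>: "\<mu> \<in> wasserstein2_ac"
    and haar: "haar_prob_orthogonal u"
    and K_ac: "K \<subseteq> wasserstein2_ac"
    and K_compact: "compactin W2_topology K"
    and A1_i: "\<And>\<gamma>' P'. (\<forall>k. \<gamma>' k \<in> {0..1}) \<Longrightarrow> (\<forall>k. P' k \<in> orthogonal_group) \<Longrightarrow>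
                 (\<forall>k\<ge>1. slice_iter e j \<mu> \<sigma>0 \<gamma>' P' k \<in> K)"
    and A1_ii: "\<And>\<eta>. \<eta> \<in> K \<Longrightarrow> (AE x in \<eta>. H_deriv e j u \<mu> \<eta> x = 0) \<Longrightarrow> \<eta> = \<mu>"
    and A2_range: "\<And>k. \<gamma> k \<in> {0..1}"
    and A2_div: "filterlim (\<lambda>N. \<Sum>k<N. \<gamma> k) at_top sequentially"
    and A2_sq: "summable (\<lambda>k. (\<gamma> k)\<^sup>2)"
    and M: "prob_space M"
    and P_indep: "prob_space.indep_vars M (\<lambda>_. u) P UNIV"
    and P_distr: "\<And>k. distr M u (P k) = u"
  shows "AE \<omega> in M.
           (\<lambda>k. W2 (slice_iter e j \<mu> \<sigma>0 \<gamma> (\<lambda>i. P i \<omega>) k) \<mu>) \<longlonglongrightarrow> 0"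
proof -
  interpret M: prob_space M by (rule M)
  \<comment> \<open>Partial sums tending to infinity cannot have a finite limit.\<close>
  have "\<not> summable \<gamma>"
    using A2_div not_tendsto_and_filterlim_at_infinity[of sequentially "\<lambda>N. \<Sum>k<N. \<gamma> k"]
    by (auto simp: summable_def sums_def dest: filterlim_at_top_imp_at_infinity)
  then interpret slice_matching_scheme e j \<mu> u \<sigma>0 K \<gamma>
    using labelling j \<sigma>0 wasserstein2_acD[OF \<mu>] haar K_ac K_compact A1_i[of \<gamma>] A1_ii A2_range A2_sq
    by unfold_locales auto
  have rv: "P i \<in> M \<rightarrow>\<^sub>M u" for i
    using P_indep by (simp add: M.indep_vars_def)
  \<comment> \<open>Independence with common law u says that the joint law of the frames is the
    product measure, where the almost sure statement is already known.\<close>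
  have "distr M paths (\<lambda>\<omega>. \<lambda>i\<in>UNIV. P i \<omega>) = (\<Pi>\<^sub>M i\<in>UNIV. distr M u (P i))"
    using P_indep M.indep_vars_iff_distr_eq_PiM[where M'="\<lambda>_. u" and X=P and I=UNIV] rv by simp
  then have law: "distr M paths (\<lambda>\<omega> i. P i \<omega>) = paths"
    by (simp add: P_distr restrict_UNIV)
  have meas: "(\<lambda>\<omega> i. P i \<omega>) \<in> M \<rightarrow>\<^sub>M paths"
    using rv by (intro measurable_PiM_single') (auto dest: measurable_space)
  have "AE p in distr M paths (\<lambda>\<omega> i. P i \<omega>). (\<lambda>k. W2 (iter p k) \<mu>) \<longlonglongrightarrow> 0"
    unfolding law by (rule AE_convergence)
  then show ?thesis by (rule AE_distrD[OF meas])
qed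

end
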